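(* (Weyl's law for Love waves.) Fix $x\in\mathbb{R}^2$. For any $E<C_S^2(x,Z_I)$, $$N(x,\xi,E)=\frac{|\xi|}{2\pi}\Big(\big|\{(Z,\zeta)\in(-\infty,0]\times\mathbb{R}:\ C_S^2(x,Z)(1+\zeta^2)\le E\}\big|+o(1)\Big)\qquad\text{as }|\xi|\to\infty,$$ where $|\cdot|$ of a set denotes its (Lebesgue) measure and $N(x,\xi,E)=\#\{\Lambda_\alpha(x,\xi):\ \Lambda_\alpha(x,\xi)\le E|\xi|^2\}$ counts the eigenvalues $\Lambda_\alpha(x,\xi)$ of the Love operator $H_0(x,\xi)$.
   Context: Isotropic medium: $\hat\lambda(x,Z),\hat\mu(x,Z)$ are real-valued smooth functions on $\mathbb{R}^2\times(-\infty,0]$ (Lamé moduli divided by density, rescaled in depth) such that the tensor $C_{ijkl}=\hat\lambda\delta_{ij}\delta_{kl}+\hat\mu(\delta_{ik}\delta_{jl}+\delta_{il}\delta_{jk})$ is strongly convex: for some $\delta>0$, $\sum_{i,j,k,l}C_{ijkl}(x,Z)\varepsilon_{ij}\varepsilon_{kl}\ge\delta\sum_{i,j}\varepsilon_{ij}^2$ for all real symmetric $3\times3$ matrices and all $(x,Z)$ (so in particular $\hat\mu$ is bounded below by a positive constant). There is $Z_I<0$ such that $\hat\lambda(x,Z),\hat\mu(x,Z)$ equal their values at $(x,Z_I)$ for all $Z\le Z_I$, and $\inf_{Z\le0}\hat\mu(x,Z)<\hat\mu(x,Z_I)$. Write $C_S^2(x,Z)=\hat\mu(x,Z)$. Love operator: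 for $\xi\in\mathbb{R}^2\setminus\{0\}$, $H_0(x,\xi)v=-\frac{\partial}{\partial Z}\big(C_S^2\frac{\partial v}{\partial Z}\big)+C_S^2|\xi|^2v$ on scalar functions of $Z\in\mathbb{R}^-=(-\infty,0]$, self-adjoint on $L^2(\mathbb{R}^-)$ with domain $\{v\in H^2(\mathbb{R}^-):\frac{dv}{dZ}(0)=0\}$. Its eigenvalues are simple. *)

theory Defs
  imports "HOL-Analysis.Analysis"
begin

(* Derivatives are taken within S. On a closed half-space (or on the whole space) they are
   uniquely determined, and Ck_on k means that the partial derivatives up to order k exist in
   the interior and extend continuously up to the boundary. *)
fun Ck_on :: "nat \<Rightarrow> 'a::euclidean_space set \<Rightarrow> ('a \<Rightarrow> real) \<Rightarrow> bool" where
  "Ck_on 0 S f \<longleftrightarrow> continuous_on S f"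
| "Ck_on (Suc k) S f \<longleftrightarrow>
     (\<exists>g. (\<forall>p\<in>S. (f has_derivative (\<lambda>h. g p \<bullet> h)) (at p within S)) \<and>
          (\<forall>b\<in>Basis. Ck_on k S (\<lambda>p. g p \<bullet> b)))"

definition smooth_on :: "'a::euclidean_space set \<Rightarrow> ('a \<Rightarrow> real) \<Rightarrow> bool" where
  "smooth_on S f \<longleftrightarrow> (\<forall>k. Ck_on k S f)"

definition kronecker :: "'i \<Rightarrow> 'i \<Rightarrow> real" where
  "kronecker i j = (if i = j then 1 else 0)"

definition isotropic_tensor :: "real \<Rightarrow> real \<Rightarrow> 3 \<Rightarrow> 3 \<Rightarrow> 3 \<Rightarrow> 3 \<Rightarrow> real" where
  "isotropic_tensor l m i j k n =
     l * kronecker i j * kronecker k n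
     + m * (kronecker i k * kronecker j n + kronecker i n * kronecker j k)"

definition strongly_convex ::
  "(real^2 \<Rightarrow> real \<Rightarrow> real) \<Rightarrow> (real^2 \<Rightarrow> real \<Rightarrow> real) \<Rightarrow> bool" where
  "strongly_convex lam mu \<longleftrightarrow>
     (\<exists>\<delta>>0. \<forall>x. \<forall>Z\<le>0. \<forall>\<epsilon>::real^3^3. transpose \<epsilon> = \<epsilon> \<longrightarrow>
        (\<Sum>i\<in>UNIV. \<Sum>j\<in>UNIV. \<Sum>k\<in>UNIV. \<Sum>n\<in>UNIV.
           isotropic_tensor (lam x Z) (mu x Z) i j k n * \<epsilon> $ i $ j * \<epsilon> $ k $ n)
        \<ge> \<delta> * (\<Sum>i\<in>UNIV. \<Sum>j\<in>UNIV. (\<epsilon> $ i $ j)\<^sup>2))"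

(* Elements of L^2(R^-) are represented by functions on the real line, of which only the values
   on {..0}, up to null sets, matter. *)
definition L2_neg :: "(real \<Rightarrow> complex) set" where
  "L2_neg = {v. v \<in> borel_measurable (lebesgue_on {..0}) \<and>
                integrable (lebesgue_on {..0}) (\<lambda>Z. (cmod (v Z))\<^sup>2)}"

definition test_function :: "(real \<Rightarrow> real) \<Rightarrow> bool" where
  "test_function \<phi> \<longleftrightarrow>
     smooth_on UNIV \<phi> \<and> compact (closure {Z. \<phi> Z \<noteq> 0}) \<and> closure {Z. \<phi> Z \<noteq> 0} \<subseteq> {..<0}"

definition locally_integrable_neg :: "(real \<Rightarrow> complex) \<Rightarrow> bool" where
  "locally_integrable_neg v \<longleftrightarrow>
     (\<forall>K. compact K \<and> K \<subseteq> {..<0} \<longrightarrow> v absolutely_integrable_on K)"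

definition has_weak_deriv :: "(real \<Rightarrow> complex) \<Rightarrow> (real \<Rightarrow> complex) \<Rightarrow> bool" where
  "has_weak_deriv v w \<longleftrightarrow>
     locally_integrable_neg v \<and> locally_integrable_neg w \<and>
     (\<forall>\<phi>. test_function \<phi> \<longrightarrow>
        (LINT Z|lebesgue_on {..0}. v Z * of_real (deriv \<phi> Z))
        = - (LINT Z|lebesgue_on {..0}. w Z * of_real (\<phi> Z)))"

(* Meaningful only if a weak derivative exists, and then determined up to null sets. *)
definition weak_deriv :: "(real \<Rightarrow> complex) \<Rightarrow> real \<Rightarrow> complex" where
  "weak_deriv v = (SOME w. has_weak_deriv v w)"

definition H2_neg :: "(real \<Rightarrow> complex) set" where
  "H2_neg = {v \<in> L2_neg. \<exists>v1\<in>L2_neg. \<exists>v2\<in>L2_neg. has_weak_deriv v v1 \<and> has_weak_deriv v1 v2}"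

(* The value dv/dZ (0) is that of the representative of the weak derivative which is continuous
   up to the boundary; for v in H^2 it exists and is unique on {..0}. *)
definition neumann_at_0 :: "(real \<Rightarrow> complex) \<Rightarrow> bool" where
  "neumann_at_0 v \<longleftrightarrow> (\<exists>w. has_weak_deriv v w \<and> continuous_on {..0} w \<and> w 0 = 0)"

definition love_domain :: "(real \<Rightarrow> complex) set" where
  "love_domain = {v \<in> H2_neg. neumann_at_0 v}"

(* The first argument of the operator is C_S^2 = mu. *)
definition love_operator ::
  "(real^2 \<Rightarrow> real \<Rightarrow> real) \<Rightarrow> real^2 \<Rightarrow> real^2 \<Rightarrow> (real \<Rightarrow> complex) \<Rightarrow> real \<Rightarrow> complex" where
  "love_operator mu x \<xi> v Z =
     - weak_deriv (\<lambda>Y. of_real (mu x Y) * weak_deriv v Y) Z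
     + of_real (mu x Z * (norm \<xi>)\<^sup>2) * v Z"

(* The operator is self-adjoint, so only real eigenvalues have to be considered. *)
definition love_eigenvalue ::
  "(real^2 \<Rightarrow> real \<Rightarrow> real) \<Rightarrow> real^2 \<Rightarrow> real^2 \<Rightarrow> real \<Rightarrow> bool" where
  "love_eigenvalue mu x \<xi> \<Lambda> \<longleftrightarrow>
     (\<exists>v\<in>love_domain. \<not> (AE Z in lebesgue_on {..0}. v Z = 0) \<and>
        (AE Z in lebesgue_on {..0}. love_operator mu x \<xi> v Z = of_real \<Lambda> * v Z))"

definition love_eigenvalues_upto ::
  "(real^2 \<Rightarrow> real \<Rightarrow> real) \<Rightarrow> real^2 \<Rightarrow> real^2 \<Rightarrow> real \<Rightarrow> real set" where
  "love_eigenvalues_upto mu x \<xi> E = {\<Lambda>. love_eigenvalue mu x \<xi> \<Lambda> \<and> \<Lambda> \<le> E * (norm \<xi>)\<^sup>2}"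

(* All eigenvalues are simple, so counting them as a set counts them with multiplicity. *)
definition love_count ::
  "(real^2 \<Rightarrow> real \<Rightarrow> real) \<Rightarrow> real^2 \<Rightarrow> real^2 \<Rightarrow> real \<Rightarrow> nat" where
  "love_count mu x \<xi> E = card (love_eigenvalues_upto mu x \<xi> E)"

end

theory Submission
  imports Defs
begin

text \<open>
  Fix the point \<open>x\<close> and write \<open>m = mu x\<close>, \<open>k = |\<xi>|\<close> and \<open>\<Lambda> = \<nu> k\<^sup>2\<close>. The eigenvalue equation is the
  Sturm-Liouville equation \<open>- (m v')' + m k\<^sup>2 v = \<nu> k\<^sup>2 v\<close>. Below \<open>ZI\<close> the coefficient is constant and
  exceeds every \<open>\<nu> \<le> E\<close>, so square integrability selects the exponentially decaying solution, and
  the Neumann condition \<open>v' 0 = 0\<close> at the surface becomes an equation for \<open>\<nu>\<close>.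

  Introduce polar coordinates \<open>v = r cos \<theta>\<close>, \<open>m v' / k = r sin \<theta>\<close> (Pruefer). The angle satisfies
  \<open>\<theta>' = k ((m - \<nu>) cos\<^sup>2 \<theta> - sin\<^sup>2 \<theta> / m)\<close> and starts at \<open>ZI\<close> with the direction of the decaying
  solution; \<open>\<nu> k\<^sup>2\<close> is an eigenvalue if and only if the final angle \<open>\<theta> 0\<close> is a multiple of \<open>pi\<close>
  (\<open>love_eigenvalue_iff\<close>). The final angle depends continuously on \<open>\<nu>\<close> and decreases strictly
  (\<open>pruefer_comparison\<close>), and its values for small \<open>\<nu>\<close> stay between bounds that do not depend on
  \<open>k\<close>. So by the intermediate value theorem the number of eigenvalues up to \<open>E k\<^sup>2\<close> is \<open>- \<theta> 0 / pi\<close> at \<open>\<nu> = E\<close>, up to a bounded error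
  (\<open>love_count_bound\<close>).

  What remains is the asymptotics of \<open>\<theta> 0\<close> as \<open>k \<rightarrow> \<infinity>\<close>. If \<open>m < E\<close> is constant on a piece, the vector
  \<open>(v, m v' / k)\<close> runs around an ellipse, and \<open>\<theta>\<close> decreases at the average speed \<open>k sqrt (E / m - 1)\<close>;
  where \<open>m \<ge> E\<close> the angle moves by at most a half turn. Rescaling the ellipse to a circle shifts
  angles by at most a quarter turn, and bounding \<open>m\<close> on a short piece by its extreme values makes both
  statements robust (\<open>pruefer_increment_piece\<close>). Summing over a fixed partition,
  \<open>- \<theta> 0 = k \<integral> sqrt (max 0 (E / m - 1)) + o(k)\<close> (\<open>pruefer_asymptotics\<close>), and twice this integral is the
  volume of the phase space region (\<open>phase_volume\<close>).

  The operator is defined with weak derivatives. The lemma of du Bois-Reymond and a product rule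
  show that its eigenfunctions agree almost everywhere with classical solutions of the equation
  (\<open>love_eigenfunction_classical\<close>); conversely, classical solutions that decay exponentially lie in
  its domain (\<open>decaying_solution_imp_love_eigenvalue\<close>).
\<close>

section \<open>Smooth functions of one variable\<close>

text \<open>In one dimension the gradient in the definition of \<open>Ck_on\<close> is an ordinary derivative.\<close>

lemma Ck_on_Suc_real:
  fixes f :: "real \<Rightarrow> real"
  shows "Ck_on (Suc k) S f \<longleftrightarrow>
    (\<exists>g. (\<forall>p\<in>S. (f has_real_derivative g p) (at p within S)) \<and> Ck_on k S g)"
  by (simp add: has_field_derivative_def)

lemma Ck_on_SucI:
  fixes f g :: "real \<Rightarrow> real"
  shows "Ck_on k S g \<Longrightarrow> (\<And>p. p \<in> S \<Longrightarrow> (f has_real_derivative g p) (at p within S))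
    \<Longrightarrow> Ck_on (Suc k) S f"
  unfolding Ck_on_Suc_real by blast

lemma Ck_on_continuous:
  fixes f :: "real \<Rightarrow> real"
  assumes "Ck_on k S f"
  shows "continuous_on S f"
proof (cases k)
  case 0
  then show ?thesis using assms by simp
next
  case (Suc j)
  then obtain g where "\<forall>p\<in>S. (f has_real_derivative g p) (at p within S)"
    using assms by (metis Ck_on_Suc_real)
  then show ?thesis by (metis DERIV_continuous_on)
qed

lemma Ck_on_SucD:
  fixes f :: "real \<Rightarrow> real"
  shows "Ck_on (Suc k) S f \<Longrightarrow> Ck_on k S f"
proof (induction k arbitrary: f)
  case 0
  then show ?case unfolding Ck_on.simps(1) by (rule Ck_on_continuous)
next
  case (Suc k)
  then show ?case by (metis Ck_on_Suc_real)
qed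

lemma Ck_on_const: "Ck_on k S (\<lambda>_::real. c :: real)"
  by (induction k arbitrary: c) (auto simp: Ck_on_Suc_real simp del: Ck_on.simps(2) intro!: exI[of _ "\<lambda>_. 0"])

lemma Ck_on_add:
  fixes f g :: "real \<Rightarrow> real"
  shows "Ck_on k S f \<Longrightarrow> Ck_on k S g \<Longrightarrow> Ck_on k S (\<lambda>x. f x + g x)"
proof (induction k arbitrary: f g)
  case 0
  then show ?case by (auto intro: continuous_intros)
next
  case (Suc k)
  from Suc.prems obtain f' g' where
    "\<forall>p\<in>S. (f has_real_derivative f' p) (at p within S)" "Ck_on k S f'"
    "\<forall>p\<in>S. (g has_real_derivative g' p) (at p within S)" "Ck_on k S g'"
    by (metis Ck_on_Suc_real)
  then show ?case unfolding Ck_on_Suc_real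
    by (intro exI[of _ "\<lambda>p. f' p + g' p"]) (auto intro: Suc.IH DERIV_add)
qed

lemma Ck_on_mult:
  fixes f g :: "real \<Rightarrow> real"
  shows "Ck_on k S f \<Longrightarrow> Ck_on k S g \<Longrightarrow> Ck_on k S (\<lambda>x. f x * g x)"
proof (induction k arbitrary: f g)
  case 0
  then show ?case by (auto intro: continuous_intros)
next
  case (Suc k)
  from Suc.prems obtain f' g' where
    *: "\<forall>p\<in>S. (f has_real_derivative f' p) (at p within S)" "Ck_on k S f'"
    "\<forall>p\<in>S. (g has_real_derivative g' p) (at p within S)" "Ck_on k S g'"
    by (metis Ck_on_Suc_real)
  have "Ck_on k S (\<lambda>p. f' p * g p + g' p * f p)"
    using *(2,4) Ck_on_SucD[OF Suc.prems(1)] Ck_on_SucD[OF Suc.prems(2)]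
    by (intro Ck_on_add Suc.IH)
  moreover have "\<And>p. p \<in> S \<Longrightarrow> ((\<lambda>x. f x * g x) has_real_derivative f' p * g p + g' p * f p) (at p within S)"
    using * by (auto intro: DERIV_mult)
  ultimately show ?case by (auto intro: Ck_on_SucI simp del: Ck_on.simps)
qed

lemma Ck_on_UNIV_affine:
  fixes f :: "real \<Rightarrow> real"
  shows "Ck_on k UNIV f \<Longrightarrow> Ck_on k UNIV (\<lambda>x. f (c * x + d))"
proof (induction k arbitrary: f)
  case 0
  then have "continuous_on UNIV f" by simp
  then have "continuous_on UNIV (\<lambda>x. f (c * x + d))"
    by (rule continuous_on_compose2) (auto intro: continuous_intros)
  then show ?case by simp
next
  case (Suc k)
  from Suc.prems obtain f' where
    *: "\<forall>p. (f has_real_derivative f' p) (at p)" "Ck_on k UNIV f'"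
    unfolding Ck_on_Suc_real by auto
  have "Ck_on k UNIV (\<lambda>x. f' (c * x + d) * c)"
    by (rule Ck_on_mult[OF Suc.IH[OF *(2)] Ck_on_const])
  moreover have "((\<lambda>x. f (c * x + d)) has_real_derivative f' (c * p + d) * c) (at p)" for p
  proof (rule DERIV_chain2[where f = f])
    show "(f has_real_derivative f' (c * p + d)) (at (c * p + d))" using * by blast
    show "((\<lambda>x. c * x + d) has_real_derivative c) (at p)" by (auto intro!: derivative_eq_intros)
  qed
  ultimately show ?case by (auto intro: Ck_on_SucI simp del: Ck_on.simps)
qed

lemma at_within_atMost_neg: "p < 0 \<Longrightarrow> at p within {..0} = at (p::real)"
  by (rule at_within_open_subset[of _ "{..<0}"]) auto

text \<open>The coefficient is only defined smoothly up to the boundary point \<open>0\<close>. Multiplied by a function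
  with support in a closed subset of the open half-line it becomes smooth on the whole line, because
  near every point either the coefficient is smooth or the product vanishes. This is what makes
  \<open>m \<phi>\<close> an admissible test function.\<close>

lemma Ck_on_mult_support:
  fixes f \<phi> :: "real \<Rightarrow> real"
  assumes K: "closed K" "K \<subseteq> {..<0}"
  shows "Ck_on k {..0} f \<Longrightarrow> Ck_on k UNIV \<phi> \<Longrightarrow> (\<And>x. x \<notin> K \<Longrightarrow> \<phi> x = 0)
    \<Longrightarrow> Ck_on k UNIV (\<lambda>x. f x * \<phi> x)"
proof (induction k arbitrary: f \<phi>)
  case 0
  have "continuous_on {..<0} (\<lambda>x. f x * \<phi> x)"
    using 0 by (intro continuous_intros) (auto intro: continuous_on_subset)
  moreover have "continuous_on (- K) (\<lambda>x. f x * \<phi> x)"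
    using 0 by (subst continuous_on_cong[where g = "\<lambda>_. 0"]) auto
  ultimately have "continuous_on ({..<0} \<union> - K) (\<lambda>x. f x * \<phi> x)"
    using K by (intro continuous_on_open_Un) auto
  moreover have "{..<0} \<union> - K = UNIV" using K by auto
  ultimately show ?case by simp
next
  case (Suc k)
  from Suc.prems obtain f' \<phi>' where
    *: "\<And>p. p \<le> 0 \<Longrightarrow> (f has_real_derivative f' p) (at p within {..0})" "Ck_on k {..0} f'"
    "\<And>p. (\<phi> has_real_derivative \<phi>' p) (at p)" "Ck_on k UNIV \<phi>'"
    unfolding Ck_on_Suc_real by auto
  have z: "\<phi>' x = 0" if "x \<notin> K" for x
  proof -
    have "(\<phi> has_real_derivative 0) (at x)"
      by (rule has_field_derivative_transform_within_open[where f = "\<lambda>_. 0" and S = "- K"])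
        (use that K Suc.prems(3) in auto)
    then show ?thesis using *(3) DERIV_unique by blast
  qed
  have d: "((\<lambda>x. f x * \<phi> x) has_real_derivative f' p * \<phi> p + f p * \<phi>' p) (at p)" for p
  proof (cases "p \<in> K")
    case True
    then have "p < 0" using K by auto
    then have "(f has_real_derivative f' p) (at p)"
      using *(1)[of p] by (simp add: at_within_atMost_neg)
    from DERIV_mult[OF this *(3)[of p]] show ?thesis by (simp add: mult.commute)
  next
    case False
    have "((\<lambda>x. f x * \<phi> x) has_real_derivative 0) (at p)"
      by (rule has_field_derivative_transform_within_open[where f = "\<lambda>_. 0" and S = "- K"])
        (use False K Suc.prems(3) in auto)
    then show ?thesis using False z Suc.prems(3) by simp
  qed
  have "Ck_on k UNIV (\<lambda>p. f' p * \<phi> p + f p * \<phi>' p)"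
    using * z Suc.prems(3) Ck_on_SucD[OF Suc.prems(1)] Ck_on_SucD[OF Suc.prems(2)]
    by (intro Ck_on_add Suc.IH)
  then show ?case by (rule Ck_on_SucI) (rule d)
qed

lemma Ck_on_slice:
  fixes F :: "'a::euclidean_space \<times> real \<Rightarrow> real"
  shows "Ck_on k (UNIV \<times> S) F \<Longrightarrow> Ck_on k S (\<lambda>Z. F (x, Z))"
proof (induction k arbitrary: F)
  case 0
  then show ?case by (auto intro!: continuous_on_compose2[of "UNIV \<times> S" F] continuous_intros)
next
  case (Suc k)
  from Suc.prems obtain g where
    g: "\<forall>p\<in>UNIV \<times> S. (F has_derivative (\<lambda>h. g p \<bullet> h)) (at p within UNIV \<times> S)"
    and *: "\<forall>b\<in>Basis. Ck_on k (UNIV \<times> S) (\<lambda>p. g p \<bullet> b)" by auto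
  have "(0, 1) \<in> (Basis :: ('a \<times> real) set)" by (simp add: Basis_prod_def)
  with * have "Ck_on k S (\<lambda>Z. g (x, Z) \<bullet> (0, 1))" by (intro Suc.IH) auto
  moreover have "((\<lambda>Z. F (x, Z)) has_real_derivative g (x, Z) \<bullet> (0, 1)) (at Z within S)"
    if "Z \<in> S" for Z
  proof -
    have "((\<lambda>Z. F (x, Z)) has_derivative (\<lambda>h. g (x, Z) \<bullet> (0, h))) (at Z within S)"
      by (rule has_derivative_in_compose2[where g = F and t = "UNIV \<times> S" and f = "\<lambda>Z. (x, Z)"])
        (use g that in \<open>auto intro!: derivative_eq_intros\<close>)
    moreover have "(\<lambda>h. g (x, Z) \<bullet> (0, h)) = (*) (g (x, Z) \<bullet> (0, 1))"
      by (rule ext) (simp add: inner_prod_def)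
    ultimately show ?thesis by (simp only: has_field_derivative_def)
  qed
  ultimately show ?case by (auto intro: Ck_on_SucI simp del: Ck_on.simps)
qed

section \<open>Test functions on the negative half-line\<close>

text \<open>The functions \<open>t\<^sup>-\<^sup>n exp (- 1 / t)\<close>, extended by \<open>0\<close>. They span a space that is closed under
  differentiation, so smoothness at the origin follows by induction on the order of the derivative,
  for all \<open>n\<close> at once.\<close>

definition flat_exp :: "nat \<Rightarrow> real \<Rightarrow> real" where
  "flat_exp n t = (if 0 < t then inverse t ^ n * exp (- inverse t) else 0)"

lemma flat_exp_tendsto_0: "(flat_exp n \<longlongrightarrow> 0) (at 0)"
proof -
  have "((\<lambda>x. x ^ n / exp x) \<longlongrightarrow> (0::real)) at_top" by (rule tendsto_power_div_exp_0)
  then have "((\<lambda>t. inverse t ^ n / exp (inverse t)) \<longlongrightarrow> (0::real)) (at_right 0)"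
    by (rule filterlim_compose[OF _ filterlim_inverse_at_top_right])
  then have "(flat_exp n \<longlongrightarrow> 0) (at_right 0)"
    by (rule Lim_transform_eventually)
      (auto simp: flat_exp_def exp_minus field_simps eventually_at_filter)
  moreover have "(flat_exp n \<longlongrightarrow> 0) (at_left 0)"
    by (rule Lim_transform_eventually[OF tendsto_const])
      (auto simp: flat_exp_def eventually_at_filter)
  ultimately show ?thesis by (simp add: filterlim_split_at)
qed

lemma flat_exp_deriv:
  "(flat_exp n has_real_derivative - real n * flat_exp (Suc n) t + flat_exp (Suc (Suc n)) t) (at t)"
proof -
  consider "t > 0" | "t < 0" | "t = 0" by linarith
  then show ?thesis
  proof cases
    case 1
    have "((\<lambda>t. inverse t ^ n) has_real_derivative - real n * inverse t ^ Suc n) (at t)"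
    proof (cases n)
      case (Suc j)
      have "((\<lambda>t. inverse t ^ n) has_real_derivative
          real n * (- (inverse t ^ Suc (Suc 0)) * inverse t ^ (n - Suc 0))) (at t)"
        using 1 by (intro DERIV_power DERIV_inverse) auto
      moreover have "real n * (- (inverse t ^ Suc (Suc 0)) * inverse t ^ (n - Suc 0)) = - real n * inverse t ^ Suc n"
        unfolding Suc by (simp add: algebra_simps)
      ultimately show ?thesis by metis
    qed auto
    moreover have "((\<lambda>t. exp (- inverse t)) has_real_derivative inverse t ^ 2 * exp (- inverse t)) (at t)"
      using 1 by (auto intro!: derivative_eq_intros simp: power2_eq_square)
    ultimately have "((\<lambda>t. inverse t ^ n * exp (- inverse t)) has_real_derivative
       (- real n * inverse t ^ Suc n) * exp (- inverse t) + (inverse t ^ 2 * exp (- inverse t)) * inverse t ^ n) (at t)"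
      by (rule DERIV_mult)
    moreover have "(- real n * inverse t ^ Suc n) * exp (- inverse t) + (inverse t ^ 2 * exp (- inverse t)) * inverse t ^ n
      = - real n * flat_exp (Suc n) t + flat_exp (Suc (Suc n)) t"
      using 1 by (simp add: flat_exp_def power2_eq_square)
    ultimately have "((\<lambda>t. inverse t ^ n * exp (- inverse t)) has_real_derivative
       - real n * flat_exp (Suc n) t + flat_exp (Suc (Suc n)) t) (at t)"
      by simp
    then show ?thesis
      by (rule has_field_derivative_transform_within_open[where S = "{0<..}"])
        (use 1 in \<open>auto simp: flat_exp_def\<close>)
  next
    case 2
    have "((\<lambda>t. 0) has_real_derivative
       - real n * flat_exp (Suc n) t + flat_exp (Suc (Suc n)) t) (at t)"
      using 2 by (auto simp: flat_exp_def)
    then show ?thesis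
      by (rule has_field_derivative_transform_within_open[where S = "{..<0}"])
        (use 2 in \<open>auto simp: flat_exp_def\<close>)
  next
    case 3
    have "(flat_exp (Suc n) \<longlongrightarrow> 0) (at 0)" by (rule flat_exp_tendsto_0)
    then have "((\<lambda>h. (flat_exp n (0 + h) - flat_exp n 0) / h) \<longlongrightarrow> 0) (at 0)"
      by (rule Lim_transform_eventually)
        (auto simp: flat_exp_def eventually_at_filter field_simps)
    then show ?thesis using 3 by (simp add: DERIV_def flat_exp_def)
  qed
qed

lemma flat_exp_Ck: "Ck_on k UNIV (flat_exp n)"
proof (induction k arbitrary: n)
  case 0
  show ?case unfolding Ck_on.simps(1) by (rule DERIV_continuous_on) (rule flat_exp_deriv)
next
  case (Suc k)
  have "Ck_on k UNIV (\<lambda>t. - real n * flat_exp (Suc n) t + flat_exp (Suc (Suc n)) t)"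
    by (intro Ck_on_add Ck_on_mult Ck_on_const Suc.IH)
  then show ?case by (rule Ck_on_SucI) (use flat_exp_deriv in auto)
qed

text \<open>For fixed \<open>a < b\<close> this is a sequence of smooth functions, supported in \<open>[a, b]\<close> and bounded by
  \<open>1\<close>, that converges pointwise to the indicator of \<open>(a, b)\<close>.\<close>

definition bump :: "real \<Rightarrow> real \<Rightarrow> nat \<Rightarrow> real \<Rightarrow> real" where
  "bump a b n t = flat_exp 0 (real (Suc n) * (t - a)) * flat_exp 0 (real (Suc n) * (b - t))"

lemma bump_Ck: "Ck_on k UNIV (bump a b n)"
proof -
  have "Ck_on k UNIV (\<lambda>t. flat_exp 0 (real (Suc n) * t + - (real (Suc n) * a)) *
      flat_exp 0 (- real (Suc n) * t + real (Suc n) * b))"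
    by (rule Ck_on_mult[OF Ck_on_UNIV_affine[OF flat_exp_Ck] Ck_on_UNIV_affine[OF flat_exp_Ck]])
  moreover have "(\<lambda>t. flat_exp 0 (real (Suc n) * t + - (real (Suc n) * a)) *
      flat_exp 0 (- real (Suc n) * t + real (Suc n) * b)) = bump a b n"
    by (auto simp: bump_def algebra_simps)
  ultimately show ?thesis by simp
qed

lemma flat_exp_0_bounds: "0 \<le> flat_exp 0 t" "flat_exp 0 t \<le> 1"
  by (auto simp: flat_exp_def)

lemma bump_zero:
  assumes "t \<le> a \<or> b \<le> t"
  shows "bump a b n t = 0"
proof -
  have "real (Suc n) * (t - a) \<le> 0 \<or> real (Suc n) * (b - t) \<le> 0"
    using assms by (auto intro!: mult_nonneg_nonpos simp del: of_nat_Suc)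
  then show ?thesis unfolding bump_def flat_exp_def by auto
qed

lemma bump_pos:
  assumes "a < t" "t < b"
  shows "0 < bump a b n t"
proof -
  have "0 < real (Suc n) * (t - a)" "0 < real (Suc n) * (b - t)"
    using assms by (auto intro!: mult_pos_pos simp del: of_nat_Suc)
  then show ?thesis unfolding bump_def flat_exp_def by simp
qed

lemma bump_bounds: "0 \<le> bump a b n t" "bump a b n t \<le> 1"
  unfolding bump_def using flat_exp_0_bounds by (simp_all add: mult_le_one del: of_nat_Suc)

lemma bump_tendsto: "(\<lambda>n. bump a b n t) \<longlonglongrightarrow> indicator {a<..<b} t"
proof (cases "t \<in> {a<..<b}")
  case True
  define c d where "c = t - a" and "d = b - t"
  have cd: "c > 0" "d > 0" using True by (auto simp: c_def d_def)
  have "(\<lambda>n. exp (- inverse (real (Suc n) * c)) * exp (- inverse (real (Suc n) * d))) \<longlonglongrightarrow> 1"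
  proof -
    have "(\<lambda>n. exp (- (inverse (real (Suc n)) * inverse c)) * exp (- (inverse (real (Suc n)) * inverse d)))
       \<longlonglongrightarrow> exp (- (0 * inverse c)) * exp (- (0 * inverse d))"
      by (intro tendsto_intros LIMSEQ_inverse_real_of_nat)
    then show ?thesis by simp
  qed
  moreover have "exp (- inverse (real (Suc n) * c)) * exp (- inverse (real (Suc n) * d)) = bump a b n t" for n
  proof -
    have "0 < real (Suc n) * c" "0 < real (Suc n) * d" using cd by (auto simp del: of_nat_Suc)
    then show ?thesis by (simp add: bump_def flat_exp_def c_def d_def del: of_nat_Suc)
  qed
  ultimately show ?thesis using True by simp
next
  case False
  then show ?thesis using bump_zero by (auto simp: not_less)
qed

lemma test_functionI:
  assumes "smooth_on UNIV \<phi>" "\<And>t. t \<notin> {a..b} \<Longrightarrow> \<phi> t = 0" "b < 0"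
  shows "test_function \<phi>"
proof -
  have s: "closure {Z. \<phi> Z \<noteq> 0} \<subseteq> {a..b}"
  proof (rule closure_minimal)
    show "{Z. \<phi> Z \<noteq> 0} \<subseteq> {a..b}" using assms(2) by blast
  qed simp
  moreover have "compact (closure {Z. \<phi> Z \<noteq> 0})"
    using s compact_Int_closed[of "{a..b}" "closure {Z. \<phi> Z \<noteq> 0}"]
    by (simp add: Int_absorb1)
  ultimately show ?thesis using assms unfolding test_function_def by force
qed

text \<open>The interval is chosen strictly larger than the support, so that boundary terms in an
  integration by parts vanish at both ends.\<close>

lemma test_functionE:
  assumes "test_function \<phi>"
  obtains a b where "a < b" "b < 0" "\<And>t. t \<le> a \<or> b \<le> t \<Longrightarrow> \<phi> t = 0"
    "\<And>t. t \<le> a \<or> b \<le> t \<Longrightarrow> deriv \<phi> t = 0"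
    "\<And>t. (\<phi> has_real_derivative deriv \<phi> t) (at t)" "continuous_on UNIV (deriv \<phi>)"
    "continuous_on UNIV \<phi>"
proof -
  define K where "K = closure {Z. \<phi> Z \<noteq> 0}"
  have K: "compact K" "K \<subseteq> {..<0}" and sm: "smooth_on UNIV \<phi>"
    using assms by (auto simp: test_function_def K_def)
  have nK: "t \<notin> K \<Longrightarrow> \<phi> t = 0" for t
    unfolding K_def using closure_subset[of "{Z. \<phi> Z \<noteq> 0}"] by auto
  have "\<exists>a b. a < b \<and> b < 0 \<and> K \<subseteq> {a<..<b}"
  proof (cases "K = {}")
    case True
    then show ?thesis by (intro exI[of _ "-2"] exI[of _ "-1"]) auto
  next
    case False
    obtain l where l: "l \<in> K" "\<And>t. t \<in> K \<Longrightarrow> l \<le> t" using compact_attains_inf[OF K(1) False] by auto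
    obtain u where u: "u \<in> K" "\<And>t. t \<in> K \<Longrightarrow> t \<le> u" using compact_attains_sup[OF K(1) False] by auto
    have "u < 0" "l \<le> u" using u K l by auto
    moreover have "K \<subseteq> {l - 1<..<u / 2}"
    proof
      fix t assume "t \<in> K"
      then show "t \<in> {l - 1<..<u / 2}" using l(2)[of t] u(2)[of t] \<open>u < 0\<close> by auto
    qed
    ultimately show ?thesis by (intro exI[of _ "l - 1"] exI[of _ "u / 2"]) auto
  qed
  then obtain a b where ab: "a < b" "b < 0" "K \<subseteq> {a<..<b}" by auto
  have "Ck_on (Suc 0) UNIV \<phi>" using sm unfolding smooth_on_def by blast
  then obtain g where g: "\<And>t. (\<phi> has_real_derivative g t) (at t)" and cg: "continuous_on UNIV g"
    unfolding Ck_on_Suc_real by auto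
  have dg: "deriv \<phi> = g" by (rule ext) (rule DERIV_imp_deriv[OF g])
  have nab: "t \<notin> K" if "t \<le> a \<or> b \<le> t" for t using that ab(3) by force
  show ?thesis
  proof (rule that[OF ab(1,2)])
    show z: "\<phi> t = 0" if "t \<le> a \<or> b \<le> t" for t
      using nK nab that by blast
    show "deriv \<phi> t = 0" if "t \<le> a \<or> b \<le> t" for t
    proof -
      have tK: "t \<notin> K" using that by (rule nab)
      have "(\<phi> has_real_derivative 0) (at t)"
        by (rule has_field_derivative_transform_within_open[where f = "\<lambda>_. 0" and S = "- K"])
          (use tK nK K compact_imp_closed[OF K(1)] in auto)
      then show ?thesis by (rule DERIV_imp_deriv)
    qed
    show "(\<phi> has_real_derivative deriv \<phi> t) (at t)" for t unfolding dg by (rule g)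
    show "continuous_on UNIV (deriv \<phi>)" unfolding dg by (rule cg)
    show "continuous_on UNIV \<phi>" by (rule DERIV_continuous_on) (rule g)
  qed
qed

lemma test_function_bump: "b < 0 \<Longrightarrow> test_function (bump a b n)"
  by (rule test_functionI[of _ a b]) (auto simp: smooth_on_def bump_Ck not_le intro: bump_zero[OF disjI1] bump_zero[OF disjI2])

lemma test_function_smooth_mult:
  assumes "smooth_on {..0} f" "test_function \<phi>"
  shows "test_function (\<lambda>x. f x * \<phi> x)"
proof -
  obtain a b where ab: "b < 0" "\<And>t. t \<le> a \<or> b \<le> t \<Longrightarrow> \<phi> t = 0"
    by (rule test_functionE[OF assms(2)], rule that)
  then have z: "\<And>t. t \<notin> {a..b} \<Longrightarrow> \<phi> t = 0" by (auto simp: not_le)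
  show ?thesis
  proof (rule test_functionI[of _ a b])
    show "smooth_on UNIV (\<lambda>x. f x * \<phi> x)"
      unfolding smooth_on_def
    proof
      fix k
      show "Ck_on k UNIV (\<lambda>x. f x * \<phi> x)"
      proof (rule Ck_on_mult_support[of "{a..b}"])
        show "Ck_on k {..0} f" using assms(1) unfolding smooth_on_def by blast
        show "Ck_on k UNIV \<phi>" using assms(2) unfolding test_function_def smooth_on_def by blast
      qed (use z ab(1) in auto)
    qed
  qed (use z ab in auto)
qed

section \<open>Weak derivatives on the negative half-line\<close>

abbreviation half_line :: "real measure" where
  "half_line \<equiv> lebesgue_on {..0}"

text \<open>The action of a locally integrable function, viewed as a distribution, on a test function.\<close>

abbreviation pairing :: "(real \<Rightarrow> complex) \<Rightarrow> (real \<Rightarrow> real) \<Rightarrow> complex" where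
  "pairing f \<phi> \<equiv> LINT Z|half_line. f Z * of_real (\<phi> Z)"

lemma AE_lebesgue_on_neg_iff:
  "(AE Z in half_line. P Z) \<longleftrightarrow> (AE Z in lebesgue. Z < (0::real) \<longrightarrow> P Z)"
proof -
  have "(AE Z in half_line. P Z) \<longleftrightarrow> (AE Z in lebesgue. Z \<in> {..0} \<longrightarrow> P Z)"
    by (rule AE_restrict_space_iff) auto
  also have "\<dots> \<longleftrightarrow> (AE Z in lebesgue. Z < (0::real) \<longrightarrow> P Z)"
  proof -
    have 0: "AE Z in lebesgue. Z \<noteq> (0::real)"
      by (rule AE_completion[OF AE_lborel_singleton])
    show ?thesis
    proof
      assume "AE Z in lebesgue. Z \<in> {..0} \<longrightarrow> P Z"
      then show "AE Z in lebesgue. Z < 0 \<longrightarrow> P Z" by eventually_elim auto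
    next
      assume "AE Z in lebesgue. Z < 0 \<longrightarrow> P Z"
      with 0 show "AE Z in lebesgue. Z \<in> {..0} \<longrightarrow> P Z" by eventually_elim auto
    qed
  qed
  finally show ?thesis .
qed

lemma locally_integrable_neg_iff:
  "locally_integrable_neg v \<longleftrightarrow> (\<forall>a b. b < 0 \<longrightarrow> v absolutely_integrable_on {a..b})"
proof
  assume *: "\<forall>a b. b < 0 \<longrightarrow> v absolutely_integrable_on {a..b}"
  show "locally_integrable_neg v" unfolding locally_integrable_neg_def
  proof (intro allI impI)
    fix K :: "real set" assume K: "compact K \<and> K \<subseteq> {..<0}"
    show "v absolutely_integrable_on K"
    proof (cases "K = {}")
      case False
      obtain l where l: "l \<in> K" "\<And>t. t \<in> K \<Longrightarrow> l \<le> t" using compact_attains_inf[of K] K False by auto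
      obtain u where u: "u \<in> K" "\<And>t. t \<in> K \<Longrightarrow> t \<le> u" using compact_attains_sup[of K] K False by auto
      have "v absolutely_integrable_on {l..u}" using * K u by auto
      moreover have "K \<subseteq> {l..u}" using l u by auto
      moreover have "K \<in> sets lebesgue" using K lmeasurable_compact by blast
      ultimately show ?thesis using set_integrable_subset by blast
    qed auto
  qed
next
  assume v: "locally_integrable_neg v"
  show "\<forall>a b. b < 0 \<longrightarrow> v absolutely_integrable_on {a..b}"
  proof (intro allI impI)
    fix a b :: real assume "b < 0"
    then have "compact {a..b} \<and> {a..b} \<subseteq> {..<0}" by auto
    then show "v absolutely_integrable_on {a..b}" using v unfolding locally_integrable_neg_def by blast
  qed
qed

lemma locally_integrable_neg_AE:
  assumes "locally_integrable_neg v" "AE Z in half_line. v Z = v' Z"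
  shows "locally_integrable_neg v'"
  unfolding locally_integrable_neg_iff
proof (intro allI impI)
  fix a b :: real assume b: "b < 0"
  have ae: "AE Z in lebesgue. Z < (0::real) \<longrightarrow> v Z = v' Z" using assms(2) AE_lebesgue_on_neg_iff by simp
  then obtain N where N: "{Z. \<not> (Z < 0 \<longrightarrow> v Z = v' Z)} \<subseteq> N" "N \<in> null_sets lebesgue"
    by (auto simp: eventually_ae_filter)
  then have "negligible N" by (simp add: negligible_iff_null_sets)
  moreover have "v absolutely_integrable_on {a..b}" using assms(1) b by (simp add: locally_integrable_neg_iff)
  moreover have "v' x = v x" if "x \<in> {a..b} - N" for x
  proof -
    have "x < 0" using that b by auto
    then show ?thesis using that N(1) by auto
  qed
  ultimately show "v' absolutely_integrable_on {a..b}"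
    by (intro absolutely_integrable_spike[of "{a..b}" v N v'])
qed

lemma LINT_neg_eq_interval:
  fixes h :: "real \<Rightarrow> 'b::euclidean_space"
  assumes "\<And>Z. Z \<notin> {a..b} \<Longrightarrow> h Z = 0" "b \<le> 0" "h absolutely_integrable_on {a..b}"
  shows "(LINT Z|half_line. h Z) = integral {a..b} h"
proof -
  have "(LINT Z|half_line. h Z) = (LINT Z|lebesgue. indicator {..0} Z *\<^sub>R h Z)"
    by (rule integral_restrict_space) auto
  also have "\<dots> = (LINT Z|lebesgue. indicator {a..b} Z *\<^sub>R h Z)"
    using assms by (intro Bochner_Integration.integral_cong) (auto simp: indicator_def)
  also have "\<dots> = integral {a..b} h"
    using set_lebesgue_integral_eq_integral(2)[OF assms(3)] by (simp add: set_lebesgue_integral_def)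
  finally show ?thesis .
qed

lemma absolutely_integrable_mult_continuous:
  fixes f :: "real \<Rightarrow> complex" and g :: "real \<Rightarrow> real"
  assumes "f absolutely_integrable_on {a..b}" "continuous_on {a..b} g"
  shows "(\<lambda>x. f x * of_real (g x)) absolutely_integrable_on {a..b}"
proof -
  have "bounded (g ` {a..b})"
    by (intro compact_imp_bounded compact_continuous_image assms) auto
  moreover have "g \<in> borel_measurable (lebesgue_on {a..b})"
    by (intro continuous_imp_measurable_on_sets_lebesgue assms) auto
  ultimately have "(\<lambda>x. g x *\<^sub>R f x) absolutely_integrable_on {a..b}"
    using absolutely_integrable_bounded_measurable_product[of "(*\<^sub>R)" g "{a..b}" f] assms(1)
    by (auto simp: bilinear_conv_bounded_bilinear bounded_bilinear_scaleR)
  then show ?thesis by (simp add: scaleR_conv_of_real mult.commute)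
qed

lemma integrable_mult_test_function:
  assumes "locally_integrable_neg f" "test_function \<phi>"
  shows "integrable half_line (\<lambda>Z. f Z * of_real (\<phi> Z))"
proof -
  obtain a b where ab: "b < 0" and z: "\<And>t. t \<le> a \<or> b \<le> t \<Longrightarrow> \<phi> t = 0"
    and c: "continuous_on UNIV \<phi>"
    by (rule test_functionE[OF assms(2)], rule that)
  have "(\<lambda>x. f x * of_real (\<phi> x)) absolutely_integrable_on {a..b}"
    using assms(1) ab c
    by (intro absolutely_integrable_mult_continuous) (auto intro: continuous_on_subset simp: locally_integrable_neg_iff)
  then have "integrable lebesgue (\<lambda>x. indicator {a..b} x *\<^sub>R (f x * of_real (\<phi> x)))"
    by (simp add: set_integrable_def)
  also have "(\<lambda>x. indicator {a..b} x *\<^sub>R (f x * of_real (\<phi> x))) = (\<lambda>x. indicator {..0} x *\<^sub>R (f x * of_real (\<phi> x)))"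
  proof
    fix x
    show "indicat_real {a..b} x *\<^sub>R (f x * of_real (\<phi> x)) = indicat_real {..0} x *\<^sub>R (f x * of_real (\<phi> x))"
      using z[of x] ab by (cases "x \<in> {a..b}") (auto simp: not_le)
  qed
  finally show ?thesis by (subst integrable_restrict_space) auto
qed

text \<open>Integration by parts: the boundary terms vanish with the test function.\<close>

lemma has_weak_deriv_classical:
  fixes f g :: "real \<Rightarrow> complex"
  assumes g: "continuous_on {..0} g"
    and d: "\<And>Z. Z \<le> 0 \<Longrightarrow> (f has_vector_derivative g Z) (at Z within {..0})"
  shows "has_weak_deriv f g"
proof -
  have f: "continuous_on {..0} f"
    using d by (auto simp: continuous_on_eq_continuous_within intro: has_vector_derivative_continuous)
  have int: "h absolutely_integrable_on {a..b}" if "continuous_on {..0} h" "b < 0"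
    for h :: "real \<Rightarrow> complex" and a b :: real
    by (rule absolutely_integrable_continuous_real) (rule continuous_on_subset[OF that(1)], use that(2) in auto)
  have "pairing f (deriv \<phi>)
        = - pairing g \<phi>" if \<phi>: "test_function \<phi>" for \<phi>
  proof -
    obtain a b where ab: "a < b" "b < 0" and z: "\<And>t. t \<le> a \<or> b \<le> t \<Longrightarrow> \<phi> t = 0"
        "\<And>t. t \<le> a \<or> b \<le> t \<Longrightarrow> deriv \<phi> t = 0"
      and d\<phi>: "\<And>t. (\<phi> has_real_derivative deriv \<phi> t) (at t)"
      and c: "continuous_on UNIV (deriv \<phi>)" "continuous_on UNIV \<phi>"
      by (rule test_functionE[OF \<phi>], rule that)
    have i1: "(\<lambda>x. f x * of_real (deriv \<phi> x)) absolutely_integrable_on {a..b}"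
      using int[OF f ab(2)] c by (intro absolutely_integrable_mult_continuous) (auto intro: continuous_on_subset)
    have i2: "(\<lambda>x. g x * of_real (\<phi> x)) absolutely_integrable_on {a..b}"
      using int[OF g ab(2)] c by (intro absolutely_integrable_mult_continuous) (auto intro: continuous_on_subset)
    have "((\<lambda>x. f x * of_real (deriv \<phi> x) + g x * of_real (\<phi> x)) has_integral
        (f b * of_real (\<phi> b) - f a * of_real (\<phi> a))) {a..b}"
    proof (rule fundamental_theorem_of_calculus)
      fix x assume x: "x \<in> {a..b}"
      then have x0: "x < 0" using ab by simp
      have "(f has_vector_derivative g x) (at x)"
        using d[of x] x0 by (simp add: at_within_atMost_neg)
      moreover have "((\<lambda>x. complex_of_real (\<phi> x)) has_vector_derivative of_real (deriv \<phi> x)) (at x)"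
        using d\<phi>[of x] has_vector_derivative_of_real by (simp add: has_real_derivative_iff_has_vector_derivative)
      ultimately have "((\<lambda>x. f x * of_real (\<phi> x)) has_vector_derivative
          (f x * of_real (deriv \<phi> x) + g x * of_real (\<phi> x))) (at x)"
        by (rule has_vector_derivative_mult)
      then show "((\<lambda>x. f x * of_real (\<phi> x)) has_vector_derivative
          (f x * of_real (deriv \<phi> x) + g x * of_real (\<phi> x))) (at x within {a..b})"
        by (rule has_vector_derivative_at_within)
    qed (use ab in simp)
    then have "integral {a..b} (\<lambda>x. f x * of_real (deriv \<phi> x) + g x * of_real (\<phi> x)) = 0"
      using z(1)[of a] z(1)[of b] by (auto dest: integral_unique)
    then have "integral {a..b} (\<lambda>x. f x * of_real (deriv \<phi> x)) + integral {a..b} (\<lambda>x. g x * of_real (\<phi> x)) = 0"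
      using i1 i2 by (subst (asm) integral_add) (auto simp: set_lebesgue_integral_eq_integral)
    moreover have "pairing f (deriv \<phi>) = integral {a..b} (\<lambda>x. f x * of_real (deriv \<phi> x))"
      using z ab i1 by (intro LINT_neg_eq_interval) (auto simp: not_le less_imp_le)
    moreover have "pairing g \<phi> = integral {a..b} (\<lambda>x. g x * of_real (\<phi> x))"
      using z ab i2 by (intro LINT_neg_eq_interval) (auto simp: not_le less_imp_le)
    ultimately show ?thesis by (simp add: eq_neg_iff_add_eq_0)
  qed
  moreover have "locally_integrable_neg f" "locally_integrable_neg g"
    using int f g by (auto simp: locally_integrable_neg_iff)
  ultimately show ?thesis unfolding has_weak_deriv_def by blast
qed

lemma sigma_finite_lebesgue: "sigma_finite_measure (lebesgue :: 'a::euclidean_space measure)"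
proof
  obtain A :: "'a set set" where A: "countable A" "A \<subseteq> sets lborel" "\<Union>A = space lborel"
    "\<forall>a\<in>A. emeasure lborel a \<noteq> \<infinity>"
    using lborel.sigma_finite_countable by blast
  then show "\<exists>A::'a set set. countable A \<and> A \<subseteq> sets lebesgue \<and> \<Union>A = space lebesgue \<and> (\<forall>a\<in>A. emeasure lebesgue a \<noteq> \<infinity>)"
    by (intro exI[of _ A]) auto
qed

text \<open>The half-lines form an intersection-stable generator of the Borel sets, so the integral over
  every Borel set vanishes, and then over every Lebesgue set. Hence the function is a density of the
  zero measure.\<close>

lemma AE_zero_if_integral_halflines_zero:
  fixes f :: "real \<Rightarrow> complex"
  assumes f: "integrable lebesgue f"
    and z: "\<And>x. (LINT t|lebesgue. indicator {x<..} t *\<^sub>R f t) = 0"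
  shows "AE t in lebesgue. f t = 0"
proof -
  have si: "set_integrable lebesgue A f" if "A \<in> sets lebesgue" for A
    using f that unfolding set_integrable_def by (rule integrable_mult_indicator[rotated])
  have whole: "(LINT t:UNIV|lebesgue. f t) = 0"
  proof -
    have "(\<lambda>n. LINT t:{- real n<..}|lebesgue. f t) \<longlonglongrightarrow> (LINT t:(\<Union>n. {- real n<..})|lebesgue. f t)"
    proof (rule set_integral_cont_up)
      show "incseq (\<lambda>n. {- real n<..})" by (auto simp: incseq_def)
    qed (auto intro!: si)
    moreover have "(\<Union>n. {- real n<..}) = UNIV"
    proof -
      have "\<exists>n. - real n < x" for x using reals_Archimedean2[of "- x"] by (metis minus_less_iff)
      then show ?thesis by auto
    qed
    moreover have "(LINT t:{- real n<..}|lebesgue. f t) = 0" for n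
      using z by (simp add: set_lebesgue_integral_def)
    ultimately show ?thesis using LIMSEQ_unique[OF _ tendsto_const] by simp
  qed
  have borel0: "(LINT t:A|lebesgue. f t) = 0" if A: "A \<in> sets borel" for A :: "real set"
  proof -
    have "{a<..} \<inter> {b<..} = {max a b<..}" for a b :: real by auto
    then have "Int_stable (range (\<lambda>x::real. {x<..}))" by (auto simp: Int_stable_def)
    moreover have "(range (\<lambda>x::real. {x<..})) \<subseteq> Pow UNIV" by auto
    moreover have "A \<in> sigma_sets UNIV (range (\<lambda>x::real. {x<..}))"
      using A by (simp add: borel_Ioi)
    ultimately show ?thesis
    proof (induction rule: sigma_sets_induct_disjoint)
      case (basic A)
      then show ?case using z by (auto simp: set_lebesgue_integral_def)
    next
      case empty
      show ?case by (simp add: set_lebesgue_integral_def)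
    next
      case (compl A)
      then have "A \<in> sets borel" by (simp add: borel_Ioi)
      then have A: "A \<in> sets lebesgue" by simp
      have "(LINT t:(A \<union> (UNIV - A))|lebesgue. f t) = (LINT t:A|lebesgue. f t) + (LINT t:(UNIV - A)|lebesgue. f t)"
        using A by (intro set_integral_Un si) auto
      then show ?case using whole compl by simp
    next
      case (union A)
      then have "\<And>i. A i \<in> sets borel" by (auto simp: borel_Ioi)
      then have A: "\<And>i. A i \<in> sets lebesgue" by simp
      have "(LINT t:(\<Union>i. A i)|lebesgue. f t) = (\<Sum>i. (LINT t:A i|lebesgue. f t))"
        using A union by (intro lebesgue_integral_countable_add si) (auto simp: disjoint_family_on_def)
      then show ?case using union by simp
    qed
  qed
  have "(LINT t:A|lebesgue. f t) = (LINT t:A|lebesgue. 0)" if A: "A \<in> sets lebesgue" for A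
  proof -
    obtain S N N' where S: "A = S \<union> N" "N \<subseteq> N'" "N' \<in> null_sets lborel" "S \<in> sets lborel"
      using A unfolding sets_completion by (rule completionE) (rule that)
    have "N \<in> null_sets lebesgue" using S(2,3) by (meson completion.complete2 null_sets_completionI)
    then have "AE t in lebesgue. t \<notin> N" by (rule AE_not_in)
    then have ae: "AE t in lebesgue. (t \<in> A) = (t \<in> S)" by eventually_elim (use S in auto)
    have "(LINT t:A|lebesgue. f t) = (LINT t:S|lebesgue. f t)"
      unfolding set_lebesgue_integral_def
    proof (rule integral_cong_AE)
      show "(\<lambda>x. indicat_real A x *\<^sub>R f x) \<in> borel_measurable lebesgue"
        "(\<lambda>x. indicat_real S x *\<^sub>R f x) \<in> borel_measurable lebesgue"
        using f A S by (auto intro!: borel_measurable_scaleR borel_measurable_indicator)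
      show "AE x in lebesgue. indicat_real A x *\<^sub>R f x = indicat_real S x *\<^sub>R f x"
        using ae by eventually_elim (auto simp: indicator_def)
    qed
    then show ?thesis using borel0[of S] S by simp
  qed
  then show ?thesis
    using f sigma_finite_measure.density_unique_banach[OF sigma_finite_lebesgue, of f "\<lambda>_. 0"] by auto
qed


text \<open>The fundamental lemma of the calculus of variations: bump functions converge boundedly to the
  indicators of intervals, so the integral over every interval vanishes. Local integrability gives
  no control up to \<open>0\<close> or at infinity, so the half-line is exhausted by the intervals
  \<open>(- n - 1, - 1 / (n + 1))\<close>.\<close>

lemma AE_zero_if_test_integrals_zero:
  assumes f: "locally_integrable_neg f"
    and z: "\<And>\<phi>. test_function \<phi> \<Longrightarrow> pairing f \<phi> = 0"
  shows "AE Z in half_line. f Z = 0"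
proof -
  have int: "(LINT Z|lebesgue. indicator {a<..<b} Z *\<^sub>R f Z) = 0" if b: "b < 0" for a b
  proof -
    have ai: "integrable lebesgue (\<lambda>Z. indicator {a..b} Z *\<^sub>R f Z)"
      using f b by (simp add: locally_integrable_neg_iff set_integrable_def)
    have "(\<lambda>n. LINT Z|lebesgue. bump a b n Z *\<^sub>R (indicator {a..b} Z *\<^sub>R f Z))
        \<longlonglongrightarrow> (LINT Z|lebesgue. indicator {a<..<b} Z *\<^sub>R (indicator {a..b} Z *\<^sub>R f Z))"
    proof (rule integral_dominated_convergence[where w = "\<lambda>Z. norm (indicator {a..b} Z *\<^sub>R f Z)"])
      have m: "(\<lambda>Z. indicator {a..b} Z *\<^sub>R f Z) \<in> borel_measurable lebesgue" using ai by auto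
      show "(\<lambda>Z. indicat_real {a<..<b} Z *\<^sub>R (indicator {a..b} Z *\<^sub>R f Z)) \<in> borel_measurable lebesgue"
        by (rule borel_measurable_scaleR[OF borel_measurable_indicator m]) auto
      show "(\<lambda>Z. bump a b n Z *\<^sub>R (indicator {a..b} Z *\<^sub>R f Z)) \<in> borel_measurable lebesgue" for n
      proof (rule borel_measurable_scaleR[OF _ m])
        have "bump a b n \<in> borel_measurable borel"
          by (rule borel_measurable_continuous_onI) (rule Ck_on_continuous[OF bump_Ck])
        then show "bump a b n \<in> borel_measurable lebesgue" by (simp add: measurable_completion)
      qed
      show "integrable lebesgue (\<lambda>Z. norm (indicat_real {a..b} Z *\<^sub>R f Z))" using ai by (rule integrable_norm)
      show "AE Z in lebesgue. (\<lambda>n. bump a b n Z *\<^sub>R indicat_real {a..b} Z *\<^sub>R f Z)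
          \<longlonglongrightarrow> indicat_real {a<..<b} Z *\<^sub>R indicat_real {a..b} Z *\<^sub>R f Z"
        by (intro AE_I2 tendsto_scaleR bump_tendsto tendsto_const)
      show "AE Z in lebesgue. norm (bump a b n Z *\<^sub>R indicat_real {a..b} Z *\<^sub>R f Z)
          \<le> norm (indicat_real {a..b} Z *\<^sub>R f Z)" for n
      proof (rule AE_I2)
        fix Z
        show "norm (bump a b n Z *\<^sub>R indicat_real {a..b} Z *\<^sub>R f Z) \<le> norm (indicat_real {a..b} Z *\<^sub>R f Z)"
          unfolding norm_scaleR[of "bump a b n Z"] using bump_bounds[of a b n Z]
          by (intro mult_left_le_one_le) auto
      qed
    qed
    moreover have "(LINT Z|lebesgue. bump a b n Z *\<^sub>R (indicator {a..b} Z *\<^sub>R f Z)) = 0" for n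
    proof -
      have "(LINT Z|lebesgue. bump a b n Z *\<^sub>R (indicator {a..b} Z *\<^sub>R f Z)) =
         (LINT Z|lebesgue. indicator {..0} Z *\<^sub>R (f Z * of_real (bump a b n Z)))"
      proof (rule Bochner_Integration.integral_cong)
        fix Z
        show "bump a b n Z *\<^sub>R (indicat_real {a..b} Z *\<^sub>R f Z) = indicat_real {..0} Z *\<^sub>R (f Z * of_real (bump a b n Z))"
          using bump_zero[of Z a b n] b by (cases "Z \<in> {a..b}") (auto simp: not_le scaleR_conv_of_real)
      qed simp
      also have "\<dots> = (LINT Z|half_line. f Z * of_real (bump a b n Z))"
        by (rule integral_restrict_space[symmetric]) auto
      also have "\<dots> = 0" using z b by (simp add: test_function_bump)
      finally show ?thesis .
    qed
    ultimately have "(LINT Z|lebesgue. indicator {a<..<b} Z *\<^sub>R (indicator {a..b} Z *\<^sub>R f Z)) = 0"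
      using LIMSEQ_unique[OF _ tendsto_const] by simp
    also have "(\<lambda>Z. indicat_real {a<..<b} Z *\<^sub>R (indicat_real {a..b} Z *\<^sub>R f Z)) = (\<lambda>Z. indicator {a<..<b} Z *\<^sub>R f Z)"
      by (auto simp: indicator_def)
    finally show ?thesis .
  qed
  have "AE Z in lebesgue. indicator {- real (Suc n)<..<- inverse (real (Suc n))} Z *\<^sub>R f Z = 0" for n
  proof (rule AE_zero_if_integral_halflines_zero)
    define c where "c = real (Suc n)"
    define d where "d = - inverse (real (Suc n))"
    have d: "d < 0" unfolding d_def by simp
    have "f absolutely_integrable_on {- c..d}" using f d by (simp add: locally_integrable_neg_iff)
    then have "f absolutely_integrable_on {- c<..<d}" by (rule set_integrable_subset) auto
    then show "integrable lebesgue (\<lambda>Z. indicat_real {- real (Suc n)<..<- inverse (real (Suc n))} Z *\<^sub>R f Z)"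
      by (simp add: set_integrable_def c_def d_def)
    fix x
    have "(\<lambda>Z. indicator {x<..} Z *\<^sub>R indicat_real {- c<..<d} Z *\<^sub>R f Z) = (\<lambda>Z. indicator {max x (- c)<..<d} Z *\<^sub>R f Z)"
      by (auto simp: indicator_def)
    then show "(LINT Z|lebesgue. indicator {x<..} Z *\<^sub>R indicat_real {- real (Suc n)<..<- inverse (real (Suc n))} Z *\<^sub>R f Z) = 0"
      using int[OF d] by (simp add: c_def d_def)
  qed
  then have "AE Z in lebesgue. \<forall>n. indicator {- real (Suc n)<..<- inverse (real (Suc n))} Z *\<^sub>R f Z = 0"
    unfolding AE_all_countable by blast
  then have "AE Z in lebesgue. Z < 0 \<longrightarrow> f Z = 0"
  proof eventually_elim
    case (elim Z)
    show ?case
    proof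
      assume "Z < 0"
      obtain n1 where n1: "- Z < real n1" using reals_Archimedean2 by blast
      obtain n2 where n2: "inverse (real (Suc n2)) < - Z" using reals_Archimedean[of "- Z"] \<open>Z < 0\<close> by auto
      define n where "n = max n1 n2"
      have "- real (Suc n) < Z" using n1 by (simp add: n_def max_def)
      moreover
      have "inverse (real (Suc n)) \<le> inverse (real (Suc n2))"
        by (intro le_imp_inverse_le) (auto simp: n_def)
      then have "Z < - inverse (real (Suc n))" using n2 by linarith
      ultimately have "Z \<in> {- real (Suc n)<..<- inverse (real (Suc n))}" by auto
      then show "f Z = 0" using elim[rule_format, of n] by simp
    qed
  qed
  then show ?thesis by (simp add: AE_lebesgue_on_neg_iff)
qed

lemma locally_integrable_neg_diff:
  "locally_integrable_neg f \<Longrightarrow> locally_integrable_neg g \<Longrightarrow> locally_integrable_neg (\<lambda>Z. f Z - g Z)"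
  unfolding locally_integrable_neg_iff by (auto intro: set_integral_diff(1))

lemma locally_integrable_neg_add:
  "locally_integrable_neg f \<Longrightarrow> locally_integrable_neg g \<Longrightarrow> locally_integrable_neg (\<lambda>Z. f Z + g Z)"
  unfolding locally_integrable_neg_iff by (auto intro: set_integral_add(1))

lemma locally_integrable_neg_mult_continuous:
  assumes "locally_integrable_neg f" "continuous_on {..0} g"
  shows "locally_integrable_neg (\<lambda>Z. f Z * of_real (g Z))"
  unfolding locally_integrable_neg_iff
proof (intro allI impI)
  fix a b :: real assume b: "b < 0"
  show "(\<lambda>Z. f Z * of_real (g Z)) absolutely_integrable_on {a..b}"
  proof (rule absolutely_integrable_mult_continuous)
    show "f absolutely_integrable_on {a..b}" using assms(1) b by (simp add: locally_integrable_neg_iff)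
    show "continuous_on {a..b} g" using assms(2) by (rule continuous_on_subset) (use b in auto)
  qed
qed

lemma locally_integrable_neg_continuous:
  assumes "continuous_on {..0} f"
  shows "locally_integrable_neg f"
  unfolding locally_integrable_neg_iff
proof (intro allI impI)
  fix a b :: real assume b: "b < 0"
  have "continuous_on {a..b} f" using assms by (rule continuous_on_subset) (use b in auto)
  then show "f absolutely_integrable_on {a..b}" by (rule absolutely_integrable_continuous_real)
qed

lemma test_function_deriv: "test_function \<phi> \<Longrightarrow> test_function (deriv \<phi>)"
proof -
  assume \<phi>: "test_function \<phi>"
  obtain a b where ab: "b < 0" and z: "\<And>t. t \<le> a \<or> b \<le> t \<Longrightarrow> deriv \<phi> t = 0"
    by (rule test_functionE[OF \<phi>], rule that)
  show "test_function (deriv \<phi>)"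
  proof (rule test_functionI[of _ a b])
    show "smooth_on UNIV (deriv \<phi>)" unfolding smooth_on_def
    proof
      fix k
      have "Ck_on (Suc k) UNIV \<phi>" using \<phi> unfolding test_function_def smooth_on_def by blast
      then obtain g where g: "\<And>p. (\<phi> has_real_derivative g p) (at p)" "Ck_on k UNIV g"
        unfolding Ck_on_Suc_real by auto
      have "deriv \<phi> = g" by (rule ext) (rule DERIV_imp_deriv[OF g(1)])
      then show "Ck_on k UNIV (deriv \<phi>)" using g by simp
    qed
  qed (use z ab in auto)
qed

lemma has_weak_derivD:
  assumes "has_weak_deriv f g"
  shows "test_function \<phi> \<Longrightarrow> pairing f (deriv \<phi>)
        = - pairing g \<phi>"
    and "locally_integrable_neg f" and "locally_integrable_neg g"
  using assms unfolding has_weak_deriv_def by blast+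

lemma has_weak_deriv_unique:
  assumes "has_weak_deriv f g" "has_weak_deriv f g'"
  shows "AE Z in half_line. g Z = g' Z"
proof -
  have l: "locally_integrable_neg g" "locally_integrable_neg g'" using assms by (auto simp: has_weak_deriv_def)
  have "AE Z in half_line. g Z - g' Z = 0"
  proof (rule AE_zero_if_test_integrals_zero)
    fix \<phi> assume \<phi>: "test_function \<phi>"
    have "pairing g \<phi> = pairing g' \<phi>"
      using has_weak_derivD(1)[OF assms(1) \<phi>] has_weak_derivD(1)[OF assms(2) \<phi>] by simp
    then show "(LINT Z|half_line. (g Z - g' Z) * of_real (\<phi> Z)) = 0"
      using l \<phi> by (simp add: left_diff_distrib integrable_mult_test_function)
  qed (intro locally_integrable_neg_diff l)
  then show ?thesis by simp
qed

lemma integral_mult_test_cong_AE: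
  assumes f: "locally_integrable_neg f" and ae: "AE Z in half_line. f Z = f' Z" and \<phi>: "test_function \<phi>"
  shows "pairing f \<phi> = pairing f' \<phi>"
proof (rule integral_cong_AE)
  have f': "locally_integrable_neg f'" using f ae by (rule locally_integrable_neg_AE)
  show "(\<lambda>Z. f Z * of_real (\<phi> Z)) \<in> borel_measurable half_line"
    "(\<lambda>Z. f' Z * of_real (\<phi> Z)) \<in> borel_measurable half_line"
    using integrable_mult_test_function[OF f \<phi>] integrable_mult_test_function[OF f' \<phi>] by auto
  show "AE Z in half_line. f Z * of_real (\<phi> Z) = f' Z * of_real (\<phi> Z)"
    using ae by eventually_elim simp
qed

lemma has_weak_deriv_cong_AE:
  assumes d: "has_weak_deriv f g" and f: "AE Z in half_line. f Z = f' Z"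
    and g: "AE Z in half_line. g Z = g' Z"
  shows "has_weak_deriv f' g'"
proof -
  have l: "locally_integrable_neg f" "locally_integrable_neg g" using d by (auto simp: has_weak_deriv_def)
  show ?thesis unfolding has_weak_deriv_def
  proof (intro conjI allI impI)
    fix \<phi> assume \<phi>: "test_function \<phi>"
    show "pairing f' (deriv \<phi>) = - pairing g' \<phi>"
      using integral_mult_test_cong_AE[OF l(1) f test_function_deriv[OF \<phi>]]
        integral_mult_test_cong_AE[OF l(2) g \<phi>] has_weak_derivD(1)[OF d \<phi>] by simp
  qed (rule locally_integrable_neg_AE[OF l(1) f] locally_integrable_neg_AE[OF l(2) g])+
qed

lemma weak_deriv_AE_eq:
  assumes "has_weak_deriv f g"
  shows "AE Z in half_line. weak_deriv f Z = g Z"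
proof -
  have "has_weak_deriv f (weak_deriv f)" unfolding weak_deriv_def using assms by (rule someI[of "has_weak_deriv f"])
  then show ?thesis using assms by (rule has_weak_deriv_unique)
qed

lemma has_weak_deriv_diff:
  assumes d: "has_weak_deriv f g" "has_weak_deriv f' g'"
  shows "has_weak_deriv (\<lambda>Z. f Z - f' Z) (\<lambda>Z. g Z - g' Z)"
proof -
  have l: "locally_integrable_neg f" "locally_integrable_neg g" "locally_integrable_neg f'" "locally_integrable_neg g'"
    using d by (auto simp: has_weak_deriv_def)
  show ?thesis unfolding has_weak_deriv_def
  proof (intro conjI allI impI locally_integrable_neg_diff l)
    fix \<phi> assume \<phi>: "test_function \<phi>"
    have "pairing f (deriv \<phi>) = - pairing g \<phi>"
      "pairing f' (deriv \<phi>) = - pairing g' \<phi>"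
      by (rule has_weak_derivD(1)[OF d(1) \<phi>], rule has_weak_derivD(1)[OF d(2) \<phi>])
    then show "(LINT Z|half_line. (f Z - f' Z) * of_real (deriv \<phi> Z)) = - (LINT Z|half_line. (g Z - g' Z) * of_real (\<phi> Z))"
      using l \<phi> by (simp add: left_diff_distrib integrable_mult_test_function test_function_deriv)
  qed
qed

text \<open>The product rule follows by testing the weak derivative of \<open>f\<close> against \<open>m \<phi>\<close>. It provides the
  weak derivative of \<open>m v'\<close>, without which the choice operator in the Love operator would be
  uninformative.\<close>

lemma has_weak_deriv_smooth_mult:
  assumes d: "has_weak_deriv f g" and m: "smooth_on {..0} m"
    and m': "\<And>Z. Z \<le> 0 \<Longrightarrow> (m has_real_derivative m' Z) (at Z within {..0})" "continuous_on {..0} m'"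
  shows "has_weak_deriv (\<lambda>Z. f Z * of_real (m Z)) (\<lambda>Z. f Z * of_real (m' Z) + g Z * of_real (m Z))"
proof -
  have l: "locally_integrable_neg f" "locally_integrable_neg g" using d by (auto simp: has_weak_deriv_def)
  have cm: "continuous_on {..0} m" using m Ck_on_continuous unfolding smooth_on_def by blast
  note li = locally_integrable_neg_mult_continuous[OF l(1) cm] locally_integrable_neg_mult_continuous[OF l(2) cm]
    locally_integrable_neg_mult_continuous[OF l(1) m'(2)]
  show ?thesis unfolding has_weak_deriv_def
  proof (intro conjI allI impI locally_integrable_neg_add li)
    fix \<phi> assume \<phi>: "test_function \<phi>"
    have m\<phi>: "test_function (\<lambda>x. m x * \<phi> x)" by (rule test_function_smooth_mult[OF m \<phi>])
    obtain a b where ab: "b < 0" and z: "\<And>t. t \<le> a \<or> b \<le> t \<Longrightarrow> \<phi> t = 0" "\<And>t. t \<le> a \<or> b \<le> t \<Longrightarrow> deriv \<phi> t = 0"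
      and d\<phi>: "\<And>t. (\<phi> has_real_derivative deriv \<phi> t) (at t)"
      by (rule test_functionE[OF \<phi>], rule that)
    have "deriv (\<lambda>x. m x * \<phi> x) Z = m' Z * \<phi> Z + deriv \<phi> Z * m Z" if "Z < 0" for Z
    proof (rule DERIV_imp_deriv)
      have "(m has_real_derivative m' Z) (at Z)" using m'(1)[of Z] that by (simp add: at_within_atMost_neg)
      then show "((\<lambda>x. m x * \<phi> x) has_real_derivative m' Z * \<phi> Z + deriv \<phi> Z * m Z) (at Z)"
        using d\<phi> by (rule DERIV_mult)
    qed
    then have ae: "AE Z in half_line. deriv (\<lambda>x. m x * \<phi> x) Z = m' Z * \<phi> Z + deriv \<phi> Z * m Z"
      by (simp add: AE_lebesgue_on_neg_iff)
    have i: "integrable half_line (\<lambda>Z. f Z * of_real (m' Z) * of_real (\<phi> Z))"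
      "integrable half_line (\<lambda>Z. f Z * of_real (m Z) * of_real (deriv \<phi> Z))"
      "integrable half_line (\<lambda>Z. g Z * of_real (m Z) * of_real (\<phi> Z))"
      "integrable half_line (\<lambda>Z. f Z * of_real (deriv (\<lambda>x. m x * \<phi> x) Z))"
      using li l \<phi> test_function_deriv[OF \<phi>] test_function_deriv[OF m\<phi>] by (auto intro!: integrable_mult_test_function)
    have "(LINT Z|half_line. f Z * of_real (m' Z) * of_real (\<phi> Z)) + (LINT Z|half_line. f Z * of_real (m Z) * of_real (deriv \<phi> Z))
      = (LINT Z|half_line. f Z * of_real (m' Z) * of_real (\<phi> Z) + f Z * of_real (m Z) * of_real (deriv \<phi> Z))"
      using i by simp
    also have "\<dots> = (LINT Z|half_line. f Z * of_real (deriv (\<lambda>x. m x * \<phi> x) Z))"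
    proof (rule integral_cong_AE)
      show "AE Z in half_line. f Z * of_real (m' Z) * of_real (\<phi> Z) + f Z * of_real (m Z) * of_real (deriv \<phi> Z)
        = f Z * of_real (deriv (\<lambda>x. m x * \<phi> x) Z)"
        using ae by eventually_elim (simp add: algebra_simps)
    qed (use i in auto)
    also have "\<dots> = - (LINT Z|half_line. g Z * of_real (m Z * \<phi> Z))"
      by (rule has_weak_derivD(1)[OF d m\<phi>])
    also have "\<dots> = - (LINT Z|half_line. g Z * of_real (m Z) * of_real (\<phi> Z))"
      by (simp add: mult.assoc)
    finally have e: "(LINT Z|half_line. f Z * of_real (m' Z) * of_real (\<phi> Z)) + (LINT Z|half_line. f Z * of_real (m Z) * of_real (deriv \<phi> Z))
      = - (LINT Z|half_line. g Z * of_real (m Z) * of_real (\<phi> Z))" .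
    have "(LINT Z|half_line. (f Z * of_real (m' Z) + g Z * of_real (m Z)) * of_real (\<phi> Z)) =
       (LINT Z|half_line. f Z * of_real (m' Z) * of_real (\<phi> Z)) + (LINT Z|half_line. g Z * of_real (m Z) * of_real (\<phi> Z))"
      using i by (simp add: distrib_right)
    then show "(LINT Z|half_line. f Z * of_real (m Z) * of_real (deriv \<phi> Z)) =
       - (LINT Z|half_line. (f Z * of_real (m' Z) + g Z * of_real (m Z)) * of_real (\<phi> Z))"
      using e by (simp add: algebra_simps eq_neg_iff_add_eq_0)
  qed
qed


text \<open>The mean value zero makes the antiderivative return to \<open>0\<close> to the right of the support.\<close>

lemma test_function_antiderivative:
  assumes \<eta>: "test_function \<eta>" and J: "(LINT Z|half_line. \<eta> Z) = 0"
  obtains \<Phi> where "test_function \<Phi>" "deriv \<Phi> = \<eta>"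
proof -
  obtain a b where ab: "a < b" "b < 0" and z: "\<And>t. t \<le> a \<or> b \<le> t \<Longrightarrow> \<eta> t = 0"
    and c: "continuous_on UNIV \<eta>"
    by (rule test_functionE[OF \<eta>], rule that)
  have "isCont \<eta> t" for t using c by (simp add: continuous_on_eq_continuous_at)
  then obtain F where F: "\<And>t. (F has_vector_derivative \<eta> t) (at t)"
    using einterval_antiderivative[of "-\<infinity>" "\<infinity>" \<eta>] by auto
  have int: "(\<eta> has_integral F v - F u) {u..v}" if "u \<le> v" for u v
    by (rule fundamental_theorem_of_calculus[OF that]) (rule has_vector_derivative_at_within[OF F])
  have Fl: "F t = F a" if "t \<le> a" for t
  proof -
    have "(\<eta> has_integral 0) {t..a}" by (rule has_integral_is_0) (use z in auto)
    from has_integral_unique[OF this int[OF that]] show ?thesis by simp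
  qed
  have Fr: "F t = F b" if "b \<le> t" for t
  proof -
    have "(\<eta> has_integral 0) {b..t}" by (rule has_integral_is_0) (use z in auto)
    from has_integral_unique[OF this int[OF that]] show ?thesis by simp
  qed
  have "integral {a..b} \<eta> = (LINT Z|half_line. \<eta> Z)"
  proof (rule LINT_neg_eq_interval[symmetric])
    show "\<eta> absolutely_integrable_on {a..b}"
      by (rule absolutely_integrable_continuous_real) (rule continuous_on_subset[OF c], simp)
    show "\<eta> Z = 0" if "Z \<notin> {a..b}" for Z using that z[of Z] by (auto simp: not_le)
  qed (use ab in simp)
  then have Fab: "F b = F a" using int[of a b] ab J by (auto dest: integral_unique)
  define \<Phi> where "\<Phi> = (\<lambda>t. F t - F a)"
  have d: "(\<Phi> has_real_derivative \<eta> t) (at t)" for t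
  proof -
    have "(F has_real_derivative \<eta> t) (at t)"
      using F by (simp add: has_real_derivative_iff_has_vector_derivative)
    from DERIV_diff[OF this DERIV_const[of "F a"]] show ?thesis by (simp add: \<Phi>_def)
  qed
  have "test_function \<Phi>"
  proof (rule test_functionI[of _ a b])
    show "\<Phi> t = 0" if "t \<notin> {a..b}" for t
      using that Fl[of t] Fr[of t] Fab by (auto simp: \<Phi>_def not_le)
    show "smooth_on UNIV \<Phi>" unfolding smooth_on_def
    proof
      fix k
      have "Ck_on k UNIV \<eta>" using \<eta> unfolding test_function_def smooth_on_def by blast
      then have "Ck_on (Suc k) UNIV \<Phi>" by (rule Ck_on_SucI) (rule d)
      then show "Ck_on k UNIV \<Phi>" by (rule Ck_on_SucD)
    qed
  qed (use ab in simp)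
  moreover have "deriv \<Phi> = \<eta>" by (rule ext) (rule DERIV_imp_deriv[OF d])
  ultimately show ?thesis by (rule that)
qed

lemma test_function_diff_scaled:
  assumes "test_function \<phi>" "test_function \<psi>"
  shows "test_function (\<lambda>Z. \<phi> Z - c * \<psi> Z)"
proof -
  obtain a b where ab: "b < 0" and z: "\<And>t. t \<le> a \<or> b \<le> t \<Longrightarrow> \<phi> t = 0"
    by (rule test_functionE[OF assms(1)], rule that)
  obtain a' b' where ab': "b' < 0" and z': "\<And>t. t \<le> a' \<or> b' \<le> t \<Longrightarrow> \<psi> t = 0"
    by (rule test_functionE[OF assms(2)], rule that)
  show ?thesis
  proof (rule test_functionI[of _ "min a a'" "max b b'"])
    show "smooth_on UNIV (\<lambda>Z. \<phi> Z - c * \<psi> Z)" unfolding smooth_on_def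
    proof
      fix k
      have "Ck_on k UNIV \<phi>" "Ck_on k UNIV \<psi>" using assms unfolding test_function_def smooth_on_def by blast+
      from Ck_on_add[OF this(1) Ck_on_mult[OF Ck_on_const[of k UNIV "- c"] this(2)]]
      show "Ck_on k UNIV (\<lambda>Z. \<phi> Z - c * \<psi> Z)" by simp
    qed
    show "\<phi> t - c * \<psi> t = 0" if "t \<notin> {min a a'..max b b'}" for t
      using that z[of t] z'[of t] by (auto simp: min_def max_def not_le split: if_splits)
  qed (use ab ab' in simp)
qed

text \<open>The lemma of du Bois-Reymond. Subtracting from a test function \<open>\<psi>\<close> the multiple of a fixed bump
  function with the same integral gives the derivative of a test function, which \<open>f\<close> annihilates.
  Hence \<open>f\<close> acts on every \<open>\<psi>\<close> like the constant \<open>C\<close> that is its mean over the bump.\<close>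

lemma has_weak_deriv_zero_imp_const:
  assumes d: "has_weak_deriv f (\<lambda>_. 0)"
  shows "\<exists>C. AE Z in half_line. f Z = C"
proof -
  have lf: "locally_integrable_neg f" by (rule has_weak_derivD(2)[OF d])
  have l1: "locally_integrable_neg (\<lambda>_. 1)" by (intro locally_integrable_neg_continuous continuous_intros)
  \<comment> \<open>Any test function with nonzero integral would do.\<close>
  define \<psi>0 where "\<psi>0 = bump (-2) (-1) 0"
  have \<psi>0: "test_function \<psi>0" by (simp add: \<psi>0_def test_function_bump)
  define J where "J = (\<lambda>\<psi>::real\<Rightarrow>real. LINT Z|half_line. \<psi> Z)"
  have intr: "integrable half_line \<psi>" if "test_function \<psi>" for \<psi>
    using integrable_Re[OF integrable_mult_test_function[OF l1 that]] by simp
  have "J \<psi>0 = integral {-2..-1} \<psi>0" unfolding J_def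
  proof (rule LINT_neg_eq_interval)
    show "\<psi>0 absolutely_integrable_on {-2..-1}" unfolding \<psi>0_def
      by (rule absolutely_integrable_continuous_real)
        (rule continuous_on_subset[OF Ck_on_continuous[OF bump_Ck]], simp)
    show "\<psi>0 Z = 0" if "Z \<notin> {- 2..- 1}" for Z using that bump_zero[of Z "-2" "-1" 0] by (auto simp: \<psi>0_def not_le)
  qed simp
  moreover have "integral {-2..-1} \<psi>0 \<noteq> 0"
  proof
    assume "integral {-2..-1} \<psi>0 = 0"
    moreover have "continuous_on {-2..-1} \<psi>0"
      unfolding \<psi>0_def by (rule continuous_on_subset[OF Ck_on_continuous[OF bump_Ck]]) simp
    ultimately have "\<forall>x\<in>{-2..-1}. \<psi>0 x = 0"
      by (subst (asm) integral_eq_0_iff) (auto simp: \<psi>0_def bump_bounds)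
    moreover have "\<psi>0 (-3/2) > 0" unfolding \<psi>0_def by (rule bump_pos) auto
    ultimately show False by force
  qed
  ultimately have J0: "J \<psi>0 \<noteq> 0" by simp
  define C where "C = pairing f \<psi>0 / of_real (J \<psi>0)"
  have "AE Z in half_line. f Z - C = 0"
  proof (rule AE_zero_if_test_integrals_zero)
    have lC: "locally_integrable_neg (\<lambda>_. C)" by (intro locally_integrable_neg_continuous continuous_intros)
    then show "locally_integrable_neg (\<lambda>Z. f Z - C)" using lf by (intro locally_integrable_neg_diff)
    fix \<psi> assume \<psi>: "test_function \<psi>"
    define c where "c = J \<psi> / J \<psi>0"
    have \<eta>: "test_function (\<lambda>Z. \<psi> Z - c * \<psi>0 Z)" by (rule test_function_diff_scaled[OF \<psi> \<psi>0])
    have "(LINT Z|half_line. \<psi> Z - c * \<psi>0 Z) = J \<psi> - c * J \<psi>0"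
      using intr[OF \<psi>] intr[OF \<psi>0] by (simp add: J_def)
    then have "(LINT Z|half_line. \<psi> Z - c * \<psi>0 Z) = 0" using J0 by (simp add: c_def)
    with \<eta> obtain \<Phi> where \<Phi>: "test_function \<Phi>" "deriv \<Phi> = (\<lambda>Z. \<psi> Z - c * \<psi>0 Z)"
      by (rule test_function_antiderivative)
    have "(LINT Z|half_line. f Z * of_real (\<psi> Z - c * \<psi>0 Z)) = 0"
      using has_weak_derivD(1)[OF d \<Phi>(1)] by (simp add: \<Phi>(2))
    moreover have "(LINT Z|half_line. f Z * of_real (\<psi> Z - c * \<psi>0 Z)) =
        (LINT Z|half_line. f Z * of_real (\<psi> Z) - of_real c * (f Z * of_real (\<psi>0 Z)))"
      by (simp add: algebra_simps)
    moreover have "\<dots> = pairing f \<psi> - of_real c * pairing f \<psi>0"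
      using integrable_mult_test_function[OF lf \<psi>] integrable_mult_test_function[OF lf \<psi>0] by simp
    ultimately have "pairing f \<psi> = of_real c * pairing f \<psi>0"
      by simp
    also have "\<dots> = C * of_real (J \<psi>)" using J0 by (simp add: C_def c_def)
    also have "\<dots> = (LINT Z|half_line. C * of_real (\<psi> Z))"
      by (simp add: J_def)
    finally show "(LINT Z|half_line. (f Z - C) * of_real (\<psi> Z)) = 0"
      using integrable_mult_test_function[OF lf \<psi>] integrable_mult_test_function[OF lC \<psi>]
      by (simp add: left_diff_distrib)
  qed
  then show ?thesis by (intro exI[of _ C]) simp
qed

lemma antiderivative_on_neg:
  fixes g :: "real \<Rightarrow> 'b::banach"
  assumes g: "continuous_on {..0} g" and Z: "Z \<le> 0"
  shows "((\<lambda>Z. - integral {Z..0} g) has_vector_derivative g Z) (at Z within {..0})"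
proof -
  have c: "continuous_on {Z - 1..0} g" by (rule continuous_on_subset[OF g]) auto
  have "((\<lambda>u. integral {u..0} g) has_vector_derivative - g Z) (at Z within {Z - 1..0})"
    by (rule integral_has_vector_derivative'[OF c]) (use Z in auto)
  then have "((\<lambda>Z. - integral {Z..0} g) has_vector_derivative g Z) (at Z within {Z - 1..0})"
    by (auto dest: has_vector_derivative_minus)
  moreover have "at Z within {Z - 1..0} = at Z within {..0}"
    by (rule at_within_nhd[of _ "{Z - 1<..}"]) auto
  ultimately show ?thesis by simp
qed

text \<open>This turns functions in the domain of the Love operator into classical solutions: subtract the
  antiderivative of the continuous weak derivative; what is left has weak derivative zero.\<close>

lemma has_weak_deriv_continuous_imp_classical:
  assumes d: "has_weak_deriv f g" and g: "continuous_on {..0} g"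
  shows "\<exists>F. (\<forall>Z\<le>0. (F has_vector_derivative g Z) (at Z within {..0})) \<and>
    (AE Z in half_line. f Z = F Z)"
proof -
  define G where "G = (\<lambda>Z. - integral {Z..0} g)"
  have G: "(G has_vector_derivative g Z) (at Z within {..0})" if Z: "Z \<le> 0" for Z
    unfolding G_def by (rule antiderivative_on_neg[OF g Z])
  have "has_weak_deriv G g" by (rule has_weak_deriv_classical[OF g G])
  with d have "has_weak_deriv (\<lambda>Z. f Z - G Z) (\<lambda>Z. g Z - g Z)" by (rule has_weak_deriv_diff)
  then obtain C where C: "AE Z in half_line. f Z - G Z = C"
    using has_weak_deriv_zero_imp_const by auto
  show ?thesis
  proof (intro exI[of _ "\<lambda>Z. G Z + C"] conjI allI impI)
    show "((\<lambda>Z. G Z + C) has_vector_derivative g Z) (at Z within {..0})" if "Z \<le> 0" for Z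
      using G[OF that] has_vector_derivative_add[OF G[OF that] has_vector_derivative_const] by fastforce
    show "AE Z in half_line. f Z = G Z + C" using C by eventually_elim (simp add: algebra_simps)
  qed
qed

section \<open>Differential equations and inequalities\<close>

text \<open>The Picard map is a contraction on the whole interval, not only on a short one, in the norm
  with weight \<open>exp (- 2 L (t - a))\<close>. The weight is built into the unknown, \<open>\<theta> t = exp (2 L (t - a)) u t\<close>,
  and clamping the argument to \<open>[a, b]\<close> places \<open>u\<close> in the Banach space of bounded continuous
  functions on the line.\<close>

lemma lipschitz_ode_exists:
  fixes f :: "real \<Rightarrow> real \<Rightarrow> real"
  assumes ab: "a \<le> b" and L: "L > 0"
    and cf: "continuous_on ({a..b} \<times> UNIV) (\<lambda>(t, y). f t y)"
    and lip: "\<And>t y z. t \<in> {a..b} \<Longrightarrow> \<bar>f t y - f t z\<bar> \<le> L * \<bar>y - z\<bar>"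
    and bd: "\<And>t y. t \<in> {a..b} \<Longrightarrow> \<bar>f t y\<bar> \<le> M"
  shows "\<exists>\<theta>. continuous_on {a..b} \<theta> \<and> (\<forall>t\<in>{a..b}. \<theta> t = y0 + integral {a..t} (\<lambda>s. f s (\<theta> s)))"
proof -
  define cl where "cl = (\<lambda>t. max a (min b t))"
  have cl: "cl t \<in> {a..b}" "t \<in> {a..b} \<Longrightarrow> cl t = t" for t using ab by (auto simp: cl_def)
  have ccl: "continuous_on UNIV cl" unfolding cl_def by (intro continuous_intros)
  define h where "h = (\<lambda>u s. f s (exp (2 * L * (s - a)) * u s))"
  define G where "G = (\<lambda>u t. exp (- (2 * L * (cl t - a))) * (y0 + integral {a..cl t} (h u)))"
  have ch: "continuous_on {a..b} (h u)" if u: "continuous_on UNIV u" for u :: "real \<Rightarrow> real"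
  proof -
    have "continuous_on {a..b} (\<lambda>s. (s, exp (2 * L * (s - a)) * u s))"
      by (intro continuous_intros continuous_on_subset[OF u]) auto
    from continuous_on_compose2[OF cf this] show ?thesis by (auto simp: h_def)
  qed
  have ih: "h u integrable_on {a..t}" if "continuous_on UNIV u" "t \<le> b" for u t
    by (rule integrable_continuous_real) (rule continuous_on_subset[OF ch[OF that(1)]], use that(2) in auto)
  have cG: "continuous_on UNIV (G u)" if u: "continuous_on UNIV u" for u
  proof -
    have "continuous_on {a..b} (\<lambda>t. integral {a..t} (h u))"
      by (rule indefinite_integral_continuous_1[OF ih[OF u order_refl]])
    then have "continuous_on UNIV (\<lambda>t. integral {a..cl t} (h u))"
      by (rule continuous_on_compose2[OF _ ccl]) (use cl in auto)
    then show ?thesis unfolding G_def by (intro continuous_intros ccl)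
  qed
  have bG: "norm (G u t) \<le> \<bar>y0\<bar> + M * (b - a)" if u: "continuous_on UNIV u" for u t
  proof -
    have M: "0 \<le> M" using bd[of a 0] ab by auto
    have "norm (integral {a..cl t} (h u)) \<le> M * (cl t - a)"
      using cl(1)[of t] by (intro integral_bound continuous_on_subset[OF ch[OF u]]) (auto simp: h_def intro!: bd)
    also have "\<dots> \<le> M * (b - a)" using cl(1)[of t] M by (intro mult_left_mono) auto
    finally have "\<bar>y0 + integral {a..cl t} (h u)\<bar> \<le> \<bar>y0\<bar> + M * (b - a)" by simp
    moreover have "exp (- (2 * L * (cl t - a))) \<le> 1" using L cl(1)[of t] by simp
    ultimately show ?thesis unfolding G_def norm_mult
      by (metis abs_exp_cancel abs_ge_zero exp_ge_zero mult_left_le_one_le order_trans real_norm_def)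
  qed
  have Gb: "G u \<in> bcontfun" if "continuous_on UNIV u" for u
    using cG[OF that] bG[OF that] by (rule bcontfun_normI)
  define \<Phi> where "\<Phi> = (\<lambda>u :: real \<Rightarrow>\<^sub>C real. Bcontfun (G (apply_bcontfun u)))"
  have \<Phi>: "apply_bcontfun (\<Phi> u) = G (apply_bcontfun u)" for u
    unfolding \<Phi>_def by (rule Bcontfun_inverse) (rule Gb, simp)
  have "\<exists>!u. \<Phi> u = u"
  proof (rule banach_fix_type[of "1/2"])
    show "\<forall>u v. dist (\<Phi> u) (\<Phi> v) \<le> 1 / 2 * dist u v"
    proof (intro allI dist_bound)
      fix u v :: "real \<Rightarrow>\<^sub>C real" and t :: real
      define \<tau> where "\<tau> = cl t"
      have \<tau>: "a \<le> \<tau>" "\<tau> \<le> b" using cl(1)[of t] by (auto simp: \<tau>_def)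
      define d where "d = dist u v"
      have i: "h u integrable_on {a..\<tau>}" "h v integrable_on {a..\<tau>}" by (rule ih, simp, rule \<tau>)+
      have I: "((\<lambda>s. L * exp (2 * L * (s - a)) * d) has_integral
          exp (2 * L * (\<tau> - a)) * d / 2 - exp (2 * L * (a - a)) * d / 2) {a..\<tau>}"
        by (rule fundamental_theorem_of_calculus[OF \<tau>(1)])
          (auto intro!: derivative_eq_intros simp: has_real_derivative_iff_has_vector_derivative[symmetric])
      have "norm (integral {a..\<tau>} (\<lambda>s. h u s - h v s)) \<le> integral {a..\<tau>} (\<lambda>s. L * exp (2 * L * (s - a)) * d)"
      proof (rule integral_norm_bound_integral)
        show "(\<lambda>s. h u s - h v s) integrable_on {a..\<tau>}" using i by (rule integrable_diff)
        show "(\<lambda>s. L * exp (2 * L * (s - a)) * d) integrable_on {a..\<tau>}" using I by (rule has_integral_integrable)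
        fix s assume s: "s \<in> {a..\<tau>}"
        have "\<bar>u s - v s\<bar> \<le> d" using dist_bounded[of u s v] by (simp add: d_def dist_real_def)
        have "\<bar>h u s - h v s\<bar> \<le> L * \<bar>exp (2 * L * (s - a)) * u s - exp (2 * L * (s - a)) * v s\<bar>"
          unfolding h_def by (rule lip) (use s \<tau> in auto)
        also have "\<dots> = L * exp (2 * L * (s - a)) * \<bar>u s - v s\<bar>"
          by (simp add: abs_mult flip: right_diff_distrib)
        also have "\<dots> \<le> L * exp (2 * L * (s - a)) * d"
          using \<open>\<bar>u s - v s\<bar> \<le> d\<close> L by (intro mult_left_mono) auto
        finally show "norm (h u s - h v s) \<le> L * exp (2 * L * (s - a)) * d" by simp
      qed
      also have "\<dots> = (exp (2 * L * (\<tau> - a)) - 1) * d / 2"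
        using integral_unique[OF I] by (simp add: left_diff_distrib diff_divide_distrib)
      finally have e: "\<bar>integral {a..\<tau>} (h u) - integral {a..\<tau>} (h v)\<bar> \<le> (exp (2 * L * (\<tau> - a)) - 1) * d / 2"
        using i by (simp add: integral_diff)
      have d0: "d \<ge> 0" by (simp add: d_def)
      have "dist (\<Phi> u t) (\<Phi> v t) = exp (- (2 * L * (\<tau> - a))) * \<bar>integral {a..\<tau>} (h u) - integral {a..\<tau>} (h v)\<bar>"
        by (simp add: \<Phi> G_def \<tau>_def dist_real_def abs_mult flip: right_diff_distrib)
      also have "\<dots> \<le> exp (- (2 * L * (\<tau> - a))) * ((exp (2 * L * (\<tau> - a)) - 1) * d / 2)"
        by (rule mult_left_mono[OF e]) simp
      also have "\<dots> = (exp (- (2 * L * (\<tau> - a))) * exp (2 * L * (\<tau> - a)) - exp (- (2 * L * (\<tau> - a)))) * (d / 2)"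
        by (simp only: right_diff_distrib left_diff_distrib times_divide_eq_right mult.assoc mult_1 mult_1_right diff_divide_distrib)
      also have "\<dots> = (1 - exp (- (2 * L * (\<tau> - a)))) * (d / 2)"
        by (simp add: exp_minus)
      also have "\<dots> \<le> 1 * (d / 2)" using d0 by (intro mult_right_mono) auto
      finally show "dist (\<Phi> u t) (\<Phi> v t) \<le> 1 / 2 * dist u v" by (simp add: d_def)
    qed
  qed auto
  then obtain u where u: "\<Phi> u = u" by auto
  define \<theta> where "\<theta> = (\<lambda>t. exp (2 * L * (t - a)) * u t)"
  have hu: "h u = (\<lambda>s. f s (\<theta> s))" by (simp add: h_def \<theta>_def)
  show ?thesis
  proof (intro exI[of _ \<theta>] conjI ballI)
    show "continuous_on {a..b} \<theta>" unfolding \<theta>_def by (intro continuous_intros) auto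
    fix t assume t: "t \<in> {a..b}"
    have "u t = exp (- (2 * L * (t - a))) * (y0 + integral {a..t} (\<lambda>s. f s (\<theta> s)))"
      using \<Phi>[of u] u cl(2)[OF t] by (simp add: G_def hu)
    then have "\<theta> t = exp (2 * L * (t - a)) * exp (- (2 * L * (t - a))) * (y0 + integral {a..t} (\<lambda>s. f s (\<theta> s)))"
      by (simp add: \<theta>_def)
    then show "\<theta> t = y0 + integral {a..t} (\<lambda>s. f s (\<theta> s))" by (simp flip: exp_add)
  qed
qed

text \<open>Up to the first zero \<open>D t exp (L t)\<close> is nondecreasing, so there is no first zero.\<close>

lemma positive_if_derivative_ge:
  fixes D :: "real \<Rightarrow> real"
  assumes ab: "a \<le> b" and c: "continuous_on {a..b} D" and D0: "D a > 0"
    and d: "\<And>t. a < t \<Longrightarrow> t < b \<Longrightarrow> (D has_real_derivative D' t) (at t)"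
    and ge: "\<And>t. a < t \<Longrightarrow> t < b \<Longrightarrow> D t \<ge> 0 \<Longrightarrow> D' t \<ge> - L * D t"
  shows "D b > 0"
proof (rule ccontr)
  assume "\<not> D b > 0"
  define S where "S = {t \<in> {a..b}. D t \<le> 0}"
  have "b \<in> S" using \<open>\<not> D b > 0\<close> ab by (auto simp: S_def)
  moreover have "compact S"
  proof -
    have "closed S" unfolding S_def
      using continuous_closed_preimage[OF c closed_real_atLeastAtMost closed_atMost[of 0]]
      by (simp add: vimage_def Int_def)
    moreover have "bounded S" unfolding S_def by (rule bounded_subset[of "{a..b}"]) auto
    ultimately show ?thesis by (simp add: compact_eq_bounded_closed)
  qed
  ultimately obtain \<tau> where \<tau>: "\<tau> \<in> S" "\<And>t. t \<in> S \<Longrightarrow> \<tau> \<le> t"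
    using compact_attains_inf[of S] by auto
  have \<tau>ab: "a \<le> \<tau>" "\<tau> \<le> b" "D \<tau> \<le> 0" using \<tau> by (auto simp: S_def)
  have pos: "D t > 0" if "a \<le> t" "t < \<tau>" for t using \<tau>(2)[of t] that \<tau>ab by (force simp: S_def)
  have "D a * exp (L * a) \<le> D \<tau> * exp (L * \<tau>)"
  proof (rule DERIV_nonneg_imp_increasing_open[OF \<tau>ab(1)])
    show "continuous_on {a..\<tau>} (\<lambda>t. D t * exp (L * t))"
      by (intro continuous_intros continuous_on_subset[OF c]) (use \<tau>ab in auto)
    fix t assume t: "a < t" "t < \<tau>"
    have "((\<lambda>t. D t * exp (L * t)) has_real_derivative (D' t + L * D t) * exp (L * t)) (at t)"
      using d[of t] t \<tau>ab by (auto intro!: derivative_eq_intros simp: algebra_simps)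
    moreover have "(D' t + L * D t) * exp (L * t) \<ge> 0"
      using ge[of t] pos[of t] t \<tau>ab by auto
    ultimately show "\<exists>y. ((\<lambda>t. D t * exp (L * t)) has_real_derivative y) (at t) \<and> 0 \<le> y" by blast
  qed
  moreover have "D a * exp (L * a) > 0" using D0 by simp
  moreover have "D \<tau> * exp (L * \<tau>) \<le> 0" using \<tau>ab by (simp add: mult_nonpos_nonneg)
  ultimately show False by linarith
qed

lemma gronwall_upper:
  fixes D :: "real \<Rightarrow> real"
  assumes ab: "a \<le> b" and c: "continuous_on {a..b} D" and L: "0 \<le> L" and C: "0 \<le> C"
    and d: "\<And>t. a < t \<Longrightarrow> t < b \<Longrightarrow> (D has_real_derivative D' t) (at t)"
    and le: "\<And>t. a < t \<Longrightarrow> t < b \<Longrightarrow> D' t \<le> L * D t + C"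
  shows "D b \<le> exp (L * (b - a)) * (D a + C * (b - a))"
proof -
  have "D b * exp (- L * (b - a)) - C * b \<le> D a * exp (- L * (a - a)) - C * a"
  proof (rule DERIV_nonpos_imp_decreasing_open[OF ab])
    show "continuous_on {a..b} (\<lambda>t. D t * exp (- L * (t - a)) - C * t)"
      by (intro continuous_intros c)
    fix t assume t: "a < t" "t < b"
    have "((\<lambda>t. D t * exp (- L * (t - a)) - C * t) has_real_derivative (D' t - L * D t) * exp (- L * (t - a)) - C) (at t)"
      using d[OF t] by (auto intro!: derivative_eq_intros simp: algebra_simps)
    moreover have "(D' t - L * D t) * exp (- L * (t - a)) \<le> C * 1"
    proof -
      have "(D' t - L * D t) * exp (- L * (t - a)) \<le> C * exp (- L * (t - a))"
        using le[OF t] by (intro mult_right_mono) auto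
      also have "\<dots> \<le> C * 1" using t L C by (intro mult_left_mono) auto
      finally show ?thesis .
    qed
    ultimately show "\<exists>y. ((\<lambda>t. D t * exp (- L * (t - a)) - C * t) has_real_derivative y) (at t) \<and> y \<le> 0"
      by (intro exI conjI) auto
  qed
  then have "D b * exp (- L * (b - a)) \<le> D a + C * (b - a)" by (simp add: algebra_simps)
  then have "exp (L * (b - a)) * (D b * exp (- L * (b - a))) \<le> exp (L * (b - a)) * (D a + C * (b - a))"
    by (rule mult_left_mono) simp
  moreover have "exp (L * (b - a)) * (D b * exp (- L * (b - a))) = D b"
    by (simp add: exp_minus)
  ultimately show ?thesis by (simp only:)
qed

section \<open>The Pruefer angle\<close>

text \<open>The lift to the line of the circle map induced by scaling the second coordinate of the plane:
  the angle \<open>lift b s\<close> has tangent \<open>b tan s\<close> and lies within a quarter turn of \<open>s\<close>. The quotient inside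
  the arctangent is the tangent of the difference of the two angles.\<close>

definition lift :: "real \<Rightarrow> real \<Rightarrow> real" where
  "lift b s = s + arctan ((b - 1) * sin s * cos s / ((cos s)\<^sup>2 + b * (sin s)\<^sup>2))"

lemma cos_sin_sq_pos:
  assumes "0 < b"
  shows "(cos s)\<^sup>2 + b * (sin s)\<^sup>2 > (0::real)"
proof (cases "sin s = 0")
  case True
  then have "(cos s)\<^sup>2 = 1" using sin_cos_squared_add[of s] by simp
  then show ?thesis using True by simp
next
  case False
  then have "b * (sin s)\<^sup>2 > 0" using assms by simp
  then show ?thesis by (simp add: add_nonneg_pos)
qed

lemma lift_close: "\<bar>lift b s - s\<bar> \<le> pi / 2"
  using arctan_bounded[of "(b - 1) * sin s * cos s / ((cos s)\<^sup>2 + b * (sin s)\<^sup>2)"]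
  unfolding lift_def by (simp only: abs_le_iff add_diff_cancel_left') linarith

text \<open>Both numerators simplify: with \<open>N / Q\<close> the argument of the arctangent and \<open>R\<close> the denominator on
  the right, \<open>Q\<^sup>2 + N\<^sup>2 = R\<close> and \<open>N' Q - N Q' = b - R\<close>.\<close>

lemma lift_deriv:
  assumes b: "0 < b"
  shows "(lift b has_real_derivative b / ((cos s)\<^sup>2 + b\<^sup>2 * (sin s)\<^sup>2)) (at s)"
proof -
  define N where "N = (\<lambda>s. (b - 1) * sin s * cos s)"
  define Q where "Q = (\<lambda>s. (cos s)\<^sup>2 + b * (sin s)\<^sup>2)"
  define N' where "N' = (b - 1) * ((cos s)\<^sup>2 - (sin s)\<^sup>2)"
  define Q' where "Q' = 2 * (b - 1) * sin s * cos s"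
  define R where "R = (cos s)\<^sup>2 + b\<^sup>2 * (sin s)\<^sup>2"
  have Q0: "Q s > 0" and R0: "R > 0" using cos_sin_sq_pos[OF b] cos_sin_sq_pos[of "b\<^sup>2"] b by (auto simp: Q_def R_def)
  have dN: "(N has_real_derivative N') (at s)" unfolding N_def N'_def
    by (auto intro!: derivative_eq_intros simp: power2_eq_square algebra_simps)
  have dQ: "(Q has_real_derivative Q') (at s)" unfolding Q_def Q'_def
    by (auto intro!: derivative_eq_intros simp: power2_eq_square algebra_simps)
  have cs: "(cos s)\<^sup>2 = 1 - (sin s)\<^sup>2" by (rule cos_squared_eq)
  have sum: "(Q s)\<^sup>2 + (N s)\<^sup>2 = R"
    unfolding Q_def N_def R_def power_mult_distrib cs by (simp add: power2_eq_square algebra_simps)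
  have wr: "N' * Q s - N s * Q' = (b - 1) * ((cos s)\<^sup>2 - b * (sin s)\<^sup>2)"
  proof -
    have "N s * Q' = 2 * (b - 1)\<^sup>2 * ((sin s)\<^sup>2 * (cos s)\<^sup>2)"
      by (simp add: N_def Q'_def power2_eq_square algebra_simps)
    then show ?thesis unfolding N'_def Q_def cs by (simp add: power2_eq_square algebra_simps)
  qed
  have "((\<lambda>s. N s / Q s) has_real_derivative (N' * Q s - N s * Q') / (Q s * Q s)) (at s)"
    by (rule DERIV_divide[OF dN dQ]) (use Q0 in simp)
  from DERIV_add[OF DERIV_ident DERIV_arctan[THEN DERIV_chain2, OF this]]
  have "((\<lambda>s. s + arctan (N s / Q s)) has_real_derivative
      1 + inverse (1 + (N s / Q s)\<^sup>2) * ((N' * Q s - N s * Q') / (Q s * Q s))) (at s)" .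
  moreover have "1 + inverse (1 + (N s / Q s)\<^sup>2) * ((N' * Q s - N s * Q') / (Q s * Q s)) = b / R"
  proof -
    have "1 + (N s / Q s)\<^sup>2 = R / (Q s * Q s)"
      using Q0 sum by (simp add: power_divide field_simps power2_eq_square)
    then have "inverse (1 + (N s / Q s)\<^sup>2) * ((N' * Q s - N s * Q') / (Q s * Q s)) = (N' * Q s - N s * Q') / R"
      using Q0 R0 by simp
    moreover have "R + (N' * Q s - N s * Q') = b"
      unfolding wr R_def cs by (simp add: power2_eq_square algebra_simps)
    moreover have "1 + x / R = (R + x) / R" for x using R0 by (simp add: add_divide_distrib)
    ultimately show ?thesis by (simp only:)
  qed
  moreover have "(\<lambda>s. s + arctan (N s / Q s)) = lift b" by (auto simp: lift_def N_def Q_def)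
  ultimately show ?thesis by (simp add: R_def)
qed


text \<open>The squared shear speed \<open>m = C\<^sub>S\<^sup>2\<close> as a function of depth, at a fixed point of the surface.\<close>

locale layered_profile =
  fixes m m' :: "real \<Rightarrow> real" and ZI :: real
  assumes ZI_neg: "ZI < 0"
    and smooth_m: "smooth_on {..0} m"
    and m_deriv: "\<And>Z. Z \<le> 0 \<Longrightarrow> (m has_real_derivative m' Z) (at Z within {..0})"
    and m'_cont: "continuous_on {..0} m'"
    and m_pos: "\<And>Z. Z \<le> 0 \<Longrightarrow> 0 < m Z"
    and m_const: "\<And>Z. Z \<le> ZI \<Longrightarrow> m Z = m ZI"
begin

lemma m_cont: "continuous_on {..0} m"
  using smooth_m Ck_on_continuous unfolding smooth_on_def by blast

lemma m_bounds: "\<exists>lo hi. 0 < lo \<and> (\<forall>Z\<le>0. lo \<le> m Z \<and> m Z \<le> hi)"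
proof -
  have c: "continuous_on {ZI..0} m" by (rule continuous_on_subset[OF m_cont]) auto
  obtain u where u: "u \<in> {ZI..0}" "\<forall>z\<in>{ZI..0}. m u \<le> m z"
    using continuous_attains_inf[OF compact_Icc _ c] ZI_neg by auto
  obtain v where v: "v \<in> {ZI..0}" "\<forall>z\<in>{ZI..0}. m z \<le> m v"
    using continuous_attains_sup[OF compact_Icc _ c] ZI_neg by auto
  have "m u \<le> m Z \<and> m Z \<le> m v" if "Z \<le> 0" for Z
    using u v that m_const[of Z] ZI_neg by (cases "Z \<le> ZI") auto
  then show ?thesis using m_pos u by (intro exI[of _ "m u"] exI[of _ "m v"]) auto
qed

text \<open>With \<open>v = r cos \<theta>\<close> and \<open>m v' / k = r sin \<theta>\<close> the equation \<open>- (m v')' + m k\<^sup>2 v = \<nu> k\<^sup>2 v\<close> turns into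
  \<open>\<theta>' = k rate \<nu> Z \<theta>\<close>, an equation for the angle alone; the spectral parameter is scaled by \<open>k\<^sup>2\<close>
  so that \<open>k\<close> enters as a factor only.\<close>

definition rate :: "real \<Rightarrow> real \<Rightarrow> real \<Rightarrow> real" where
  "rate \<nu> Z y = (m Z - \<nu>) * (cos y)\<^sup>2 - (sin y)\<^sup>2 / m Z"

text \<open>The direction of the solution that decays as \<open>Z \<rightarrow> - \<infinity>\<close>: there \<open>m\<close> is constant and
  \<open>v = exp (\<kappa> Z)\<close> with \<open>m \<kappa> / k = sqrt (m (m - \<nu>))\<close>. It is a zero of \<open>rate\<close>, so the angle stays constant
  below \<open>ZI\<close>.\<close>

definition init_angle :: "real \<Rightarrow> real" where
  "init_angle \<nu> = arctan (sqrt (m ZI * (m ZI - \<nu>)))"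

definition pruefer :: "real \<Rightarrow> real \<Rightarrow> (real \<Rightarrow> real) \<Rightarrow> bool" where
  "pruefer k \<nu> \<theta> \<longleftrightarrow>
     (\<forall>Z\<le>0. (\<theta> has_real_derivative k * rate \<nu> Z (\<theta> Z)) (at Z within {..0})) \<and>
     (\<forall>Z\<le>ZI. \<theta> Z = init_angle \<nu>)"

lemma rate_lipschitz:
  assumes "Z \<le> 0"
  shows "\<bar>rate \<nu> Z y - rate \<nu> Z z\<bar> \<le> 2 * (\<bar>m Z - \<nu>\<bar> + 1 / m Z) * \<bar>y - z\<bar>"
proof -
  have m: "m Z > 0" using m_pos assms by simp
  have e: "rate \<nu> Z y = (m Z - \<nu>) - (m Z - \<nu> + 1 / m Z) * (sin y)\<^sup>2" for y
    unfolding rate_def cos_squared_eq by (simp add: algebra_simps)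
  have "\<bar>sin z - sin y\<bar> \<le> \<bar>y - z\<bar>"
  proof -
    have "\<bar>sin ((z - y) / 2)\<bar> \<le> \<bar>(z - y) / 2\<bar>" by (rule abs_sin_x_le_abs_x)
    moreover have "\<bar>cos ((z + y) / 2)\<bar> \<le> 1" by simp
    ultimately have "\<bar>sin ((z - y) / 2)\<bar> * \<bar>cos ((z + y) / 2)\<bar> \<le> \<bar>(z - y) / 2\<bar> * 1"
      by (intro mult_mono) auto
    then show ?thesis by (simp add: sin_diff_sin abs_mult)
  qed
  moreover have "\<bar>sin z + sin y\<bar> \<le> 2"
    using abs_sin_le_one[of z] abs_sin_le_one[of y] by linarith
  ultimately have s: "\<bar>(sin z)\<^sup>2 - (sin y)\<^sup>2\<bar> \<le> 2 * \<bar>y - z\<bar>"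
    unfolding power2_eq_square square_diff_square_factored abs_mult by (intro mult_mono) auto
  have "rate \<nu> Z y - rate \<nu> Z z = (m Z - \<nu> + 1 / m Z) * ((sin z)\<^sup>2 - (sin y)\<^sup>2)"
    unfolding e by (simp add: algebra_simps)
  then have "\<bar>rate \<nu> Z y - rate \<nu> Z z\<bar> = \<bar>m Z - \<nu> + 1 / m Z\<bar> * \<bar>(sin z)\<^sup>2 - (sin y)\<^sup>2\<bar>"
    by (simp only: abs_mult)
  also have "\<dots> \<le> (\<bar>m Z - \<nu>\<bar> + 1 / m Z) * (2 * \<bar>y - z\<bar>)"
    using s m abs_triangle_ineq[of "m Z - \<nu>" "1 / m Z"] by (intro mult_mono) auto
  finally show ?thesis by (simp add: algebra_simps)
qed

lemma rate_lipschitz_uniform: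
  "\<exists>A>0. \<forall>\<nu> Z y z. \<bar>\<nu>\<bar> \<le> M \<and> Z \<le> 0 \<longrightarrow>
    \<bar>rate \<nu> Z y\<bar> \<le> A \<and> \<bar>rate \<nu> Z y - rate \<nu> Z z\<bar> \<le> A * \<bar>y - z\<bar>"
proof -
  obtain lo hi where lh: "0 < lo" "\<And>Z. Z \<le> 0 \<Longrightarrow> lo \<le> m Z" "\<And>Z. Z \<le> 0 \<Longrightarrow> m Z \<le> hi"
    using m_bounds by auto
  define B where "B = hi + \<bar>M\<bar> + 1 / lo"
  have B: "\<bar>m Z - \<nu>\<bar> + 1 / m Z \<le> B" if "Z \<le> 0" "\<bar>\<nu>\<bar> \<le> M" for Z \<nu>
  proof -
    have "\<bar>m Z - \<nu>\<bar> \<le> hi + \<bar>M\<bar>" using lh(3)[OF that(1)] m_pos[OF that(1)] that(2) by linarith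
    moreover have "1 / m Z \<le> 1 / lo" using lh(1) lh(2)[OF that(1)] by (simp add: frac_le)
    ultimately show ?thesis by (simp add: B_def)
  qed
  have "0 < hi" using lh(3)[of 0] m_pos[of 0] by simp
  then have B0: "0 < B" using lh(1) by (simp add: B_def add_pos_pos)
  {
    fix \<nu> Z y z assume a: "\<bar>\<nu>\<bar> \<le> M" "Z \<le> (0::real)"
    note b = B[OF a(2,1)]
    have "\<bar>rate \<nu> Z y - rate \<nu> Z z\<bar> \<le> 2 * (\<bar>m Z - \<nu>\<bar> + 1 / m Z) * \<bar>y - z\<bar>"
      by (rule rate_lipschitz[OF a(2)])
    also have "\<dots> \<le> 2 * B * \<bar>y - z\<bar>" using b by (intro mult_right_mono) auto
    finally have 1: "\<bar>rate \<nu> Z y - rate \<nu> Z z\<bar> \<le> 2 * B * \<bar>y - z\<bar>" .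
    have 2: "\<bar>(m Z - \<nu>) * (cos y)\<^sup>2\<bar> \<le> \<bar>m Z - \<nu>\<bar> * 1"
      unfolding abs_mult by (intro mult_left_mono) (auto simp: abs_square_le_1)
    have "(sin y)\<^sup>2 \<le> 1" by (simp add: abs_square_le_1)
    then have 3: "\<bar>(sin y)\<^sup>2 / m Z\<bar> \<le> 1 / m Z" using m_pos[OF a(2)] by (simp add: divide_right_mono)
    have "\<bar>rate \<nu> Z y\<bar> \<le> \<bar>(m Z - \<nu>) * (cos y)\<^sup>2\<bar> + \<bar>(sin y)\<^sup>2 / m Z\<bar>"
      unfolding rate_def by (rule abs_triangle_ineq4)
    also have "\<dots> \<le> B" using add_mono[OF 2 3] b by simp
    finally have "\<bar>rate \<nu> Z y\<bar> \<le> B" .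
    then have "\<bar>rate \<nu> Z y\<bar> \<le> 2 * B \<and> \<bar>rate \<nu> Z y - rate \<nu> Z z\<bar> \<le> 2 * B * \<bar>y - z\<bar>"
      using 1 B0 by simp
  }
  then show ?thesis using B0 by (intro exI[of _ "2 * B"]) auto
qed

lemma rate_init_angle:
  assumes "Z \<le> ZI" "\<nu> \<le> m ZI"
  shows "rate \<nu> Z (init_angle \<nu>) = 0"
proof -
  have m: "m ZI > 0" using m_pos ZI_neg by simp
  define q where "q = m ZI * (m ZI - \<nu>)"
  have q: "q \<ge> 0" using m assms by (simp add: q_def)
  have c: "(cos (init_angle \<nu>))\<^sup>2 = 1 / (1 + q)" "(sin (init_angle \<nu>))\<^sup>2 = q / (1 + q)"
    using q by (simp_all add: init_angle_def cos_arctan sin_arctan power_divide flip: q_def)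
  have "(m ZI - \<nu>) * (1 / (1 + q)) = q / (1 + q) / m ZI"
    using m by (simp add: q_def)
  then show ?thesis unfolding rate_def m_const[OF assms(1)] c by simp
qed

lemma rate_continuous:
  assumes "continuous_on S \<theta>" "S \<subseteq> {..0}"
  shows "continuous_on S (\<lambda>s. rate \<nu> s (\<theta> s))"
  unfolding rate_def
  by (intro continuous_intros continuous_on_subset[OF m_cont] assms) (use m_pos assms in force)

text \<open>Solve on \<open>[ZI, 0]\<close> and continue by the constant initial angle. Writing both branches as one
  antiderivative of the continuous function \<open>H\<close>, which vanishes below \<open>ZI\<close>, gives differentiability at
  \<open>ZI\<close> without a separate gluing argument.\<close>

lemma pruefer_exists:
  assumes k: "0 < k" and \<nu>: "\<nu> \<le> m ZI"
  shows "\<exists>\<theta>. pruefer k \<nu> \<theta>"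
proof -
  obtain A where A: "0 < A" "\<And>Z y. Z \<le> 0 \<Longrightarrow> \<bar>rate \<nu> Z y\<bar> \<le> A"
    "\<And>Z y z. Z \<le> 0 \<Longrightarrow> \<bar>rate \<nu> Z y - rate \<nu> Z z\<bar> \<le> A * \<bar>y - z\<bar>"
    using rate_lipschitz_uniform[of "\<bar>\<nu>\<bar>"] by blast
  have "\<exists>\<theta>. continuous_on {ZI..0} \<theta> \<and>
     (\<forall>t\<in>{ZI..0}. \<theta> t = init_angle \<nu> + integral {ZI..t} (\<lambda>s. k * rate \<nu> s (\<theta> s)))"
  proof (rule lipschitz_ode_exists)
    show "ZI \<le> 0" using ZI_neg by simp
    show "0 < k * A" using k A by simp
    have "continuous_on ({ZI..0} \<times> UNIV) (\<lambda>p. m (fst p))"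
      by (rule continuous_on_compose2[OF m_cont]) (auto intro: continuous_intros)
    then have "continuous_on ({ZI..0} \<times> UNIV) (\<lambda>p. k * rate \<nu> (fst p) (snd p))"
      unfolding rate_def by (intro continuous_intros) (use m_pos in force)+
    then show "continuous_on ({ZI..0} \<times> UNIV) (\<lambda>(t, y). k * rate \<nu> t y)"
      by (simp add: case_prod_unfold)
    fix t y z assume t: "t \<in> {ZI..0}"
    show "\<bar>k * rate \<nu> t y - k * rate \<nu> t z\<bar> \<le> k * A * \<bar>y - z\<bar>"
      using A(3)[of t y z] t k by (simp add: abs_mult flip: right_diff_distrib)
    show "\<bar>k * rate \<nu> t y\<bar> \<le> k * A" using A(2)[of t y] t k by (simp add: abs_mult)
  qed
  then obtain \<theta> where c\<theta>: "continuous_on {ZI..0} \<theta>"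
    and \<theta>: "\<And>t. t \<in> {ZI..0} \<Longrightarrow> \<theta> t = init_angle \<nu> + integral {ZI..t} (\<lambda>s. k * rate \<nu> s (\<theta> s))" by auto
  define \<Theta> where "\<Theta> = (\<lambda>t. \<theta> (max t ZI))"
  define H where "H = (\<lambda>s. k * rate \<nu> s (\<Theta> s))"
  have \<Theta>I: "\<Theta> t = init_angle \<nu>" if "t \<le> ZI" for t
    using \<theta>[of ZI] that ZI_neg by (simp add: \<Theta>_def max_def)
  have c\<Theta>: "continuous_on {..0} \<Theta>" unfolding \<Theta>_def
    by (rule continuous_on_compose2[OF c\<theta>]) (use ZI_neg in \<open>auto intro!: continuous_intros\<close>)
  have cH: "continuous_on {..0} H" unfolding H_def
    by (intro continuous_intros rate_continuous c\<Theta>) auto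
  have H0: "H s = 0" if "s \<le> ZI" for s
    unfolding H_def \<Theta>I[OF that] rate_init_angle[OF that \<nu>] by simp
  have Hi: "H integrable_on {u..v}" if "v \<le> 0" for u v
    by (rule integrable_continuous_real) (rule continuous_on_subset[OF cH], use that in auto)
  define c0 where "c0 = init_angle \<nu> + integral {ZI..0} H"
  have rep: "\<Theta> t = c0 + - integral {t..0} H" if t: "t \<le> 0" for t
  proof (cases "t \<le> ZI")
    case True
    have "integral {t..ZI} H = 0" using H0 by (intro integral_unique has_integral_is_0) auto
    moreover have "integral {t..ZI} H + integral {ZI..0} H = integral {t..0} H"
      using True ZI_neg by (intro Henstock_Kurzweil_Integration.integral_combine Hi) auto
    ultimately show ?thesis using \<Theta>I[OF True] by (simp add: c0_def)
  next
    case False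
    have "integral {ZI..t} (\<lambda>s. k * rate \<nu> s (\<theta> s)) = integral {ZI..t} H"
      by (rule integral_cong) (auto simp: H_def \<Theta>_def max_def)
    moreover have "integral {ZI..t} H + integral {t..0} H = integral {ZI..0} H"
      using False t by (intro Henstock_Kurzweil_Integration.integral_combine Hi) auto
    ultimately show ?thesis using \<theta>[of t] False t by (simp add: \<Theta>_def max_def c0_def)
  qed
  have "pruefer k \<nu> \<Theta>" unfolding pruefer_def
  proof (intro conjI allI impI \<Theta>I)
    fix Z :: real assume Z: "Z \<le> 0"
    have "((\<lambda>t. c0 + - integral {t..0} H) has_real_derivative 0 + H Z) (at Z within {..0})"
      using antiderivative_on_neg[OF cH Z]
      by (intro DERIV_add DERIV_const) (simp add: has_real_derivative_iff_has_vector_derivative)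
    then have "((\<lambda>t. c0 + - integral {t..0} H) has_real_derivative H Z) (at Z within {..0})"
      by simp
    then have "(\<Theta> has_real_derivative H Z) (at Z within {..0})"
      by (rule has_field_derivative_transform_within[where d = 1]) (use Z rep in auto)
    then show "(\<Theta> has_real_derivative k * rate \<nu> Z (\<Theta> Z)) (at Z within {..0})" by (simp add: H_def)
  qed
  then show ?thesis by blast
qed

lemma pruefer_cont: "pruefer k \<nu> \<theta> \<Longrightarrow> continuous_on {..0} \<theta>"
  unfolding pruefer_def by (auto intro: DERIV_continuous_on)

lemma pruefer_deriv:
  "pruefer k \<nu> \<theta> \<Longrightarrow> Z < 0 \<Longrightarrow> (\<theta> has_real_derivative k * rate \<nu> Z (\<theta> Z)) (at Z)"
  using at_within_atMost_neg[of Z] unfolding pruefer_def by (metis less_imp_le)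

lemma pruefer_rate_diff:
  "rate \<nu>1 Z y - rate \<nu>2 Z z = (rate \<nu>1 Z y - rate \<nu>1 Z z) + (\<nu>2 - \<nu>1) * (cos z)\<^sup>2"
  by (simp add: rate_def algebra_simps)

lemma init_angle_strict_decreasing:
  assumes "\<nu>1 < \<nu>2"
  shows "init_angle \<nu>2 < init_angle \<nu>1"
  unfolding init_angle_def using assms m_pos[of ZI] ZI_neg
  by (intro arctan_monotone real_sqrt_less_mono mult_strict_left_mono) auto

text \<open>Increasing \<open>\<nu>\<close> decreases both the initial angle and the rate, so the final angle decreases strictly
  (Sturm comparison); Gronwall's inequality bounds the decrease, which yields continuity in \<open>\<nu>\<close>.\<close>

lemma pruefer_comparison:
  assumes k: "0 < k"
  shows "\<exists>C\<ge>0. \<forall>\<nu>1 \<nu>2 \<theta>1 \<theta>2. \<bar>\<nu>1\<bar> \<le> M \<and> \<nu>1 < \<nu>2 \<and> pruefer k \<nu>1 \<theta>1 \<and> pruefer k \<nu>2 \<theta>2 \<longrightarrow>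
    \<theta>2 0 < \<theta>1 0 \<and> \<theta>1 0 - \<theta>2 0 \<le> C * (init_angle \<nu>1 - init_angle \<nu>2 + (\<nu>2 - \<nu>1))"
proof -
  obtain A where A0: "0 < A" and A: "\<And>\<nu> Z y z. \<bar>\<nu>\<bar> \<le> M \<Longrightarrow> Z \<le> 0 \<Longrightarrow>
      \<bar>rate \<nu> Z y - rate \<nu> Z z\<bar> \<le> A * \<bar>y - z\<bar>"
    using rate_lipschitz_uniform[of M] by blast
  define C where "C = exp (k * A * (0 - ZI)) * (1 + k * (0 - ZI))"
  have "k * (0 - ZI) > 0" using k ZI_neg by (intro mult_pos_pos) auto
  then have C0: "C \<ge> 0" unfolding C_def by (intro mult_nonneg_nonneg) auto
  {
    fix \<nu>1 \<nu>2 \<theta>1 \<theta>2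
    assume \<nu>: "\<bar>\<nu>1\<bar> \<le> M" "\<nu>1 < \<nu>2" and p: "pruefer k \<nu>1 \<theta>1" "pruefer k \<nu>2 \<theta>2"
    define D where "D = (\<lambda>t. \<theta>1 t - \<theta>2 t)"
    define D' where "D' = (\<lambda>Z. k * rate \<nu>1 Z (\<theta>1 Z) - k * rate \<nu>2 Z (\<theta>2 Z))"
    have cD: "continuous_on {ZI..t} D" if "t \<le> 0" for t
      unfolding D_def
      by (intro continuous_intros continuous_on_subset[OF pruefer_cont[OF p(1)]]
          continuous_on_subset[OF pruefer_cont[OF p(2)]]) (use that in auto)
    have dD: "(D has_real_derivative D' t) (at t)" if "ZI < t" "t < 0" for t
      unfolding D_def D'_def by (intro DERIV_diff pruefer_deriv p that)
    have b: "\<bar>k * rate \<nu>1 Z (\<theta>1 Z) - k * rate \<nu>1 Z (\<theta>2 Z)\<bar> \<le> k * A * \<bar>D Z\<bar>" if "Z \<le> 0" for Z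
      using A[OF \<nu>(1) that, of "\<theta>1 Z" "\<theta>2 Z"] k by (simp add: D_def abs_mult flip: right_diff_distrib)
    have D'eq: "D' Z = (k * rate \<nu>1 Z (\<theta>1 Z) - k * rate \<nu>1 Z (\<theta>2 Z)) + k * ((\<nu>2 - \<nu>1) * (cos (\<theta>2 Z))\<^sup>2)" for Z
      unfolding D'_def right_diff_distrib[symmetric] pruefer_rate_diff[of \<nu>1 Z _ \<nu>2] by (simp add: algebra_simps)
    have r: "0 \<le> k * ((\<nu>2 - \<nu>1) * (cos (\<theta>2 Z))\<^sup>2)" "k * ((\<nu>2 - \<nu>1) * (cos (\<theta>2 Z))\<^sup>2) \<le> k * (\<nu>2 - \<nu>1)" for Z
      using k \<nu> by (auto simp: abs_square_le_1 mult_left_le)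
    have DI: "D ZI = init_angle \<nu>1 - init_angle \<nu>2" using p by (simp add: D_def pruefer_def)
    have DIpos: "D ZI > 0" using init_angle_strict_decreasing[OF \<nu>(2)] by (simp add: DI)
    have pos: "D t > 0" if t: "ZI \<le> t" "t \<le> 0" for t
    proof (rule positive_if_derivative_ge[OF t(1) cD[OF t(2)] DIpos, where D' = D' and L = "k * A"])
      fix s assume s: "ZI < s" "s < t"
      then show "(D has_real_derivative D' s) (at s)" using dD t by auto
      assume "0 \<le> D s"
      then show "- (k * A) * D s \<le> D' s"
        using b[of s] r(1)[of s] s t unfolding D'eq by (simp add: abs_le_iff)
    qed
    have "D 0 \<le> exp (k * A * (0 - ZI)) * (D ZI + k * (\<nu>2 - \<nu>1) * (0 - ZI))"
    proof (rule gronwall_upper[where D' = D'])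
      show "D' t \<le> k * A * D t + k * (\<nu>2 - \<nu>1)" if "ZI < t" "t < 0" for t
        using b[of t] r(2)[of t] pos[of t] that unfolding D'eq by (simp add: abs_le_iff)
    qed (use ZI_neg cD dD k A0 \<nu> in auto)
    also have "\<dots> \<le> exp (k * A * (0 - ZI)) * ((1 + k * (0 - ZI)) * (D ZI + (\<nu>2 - \<nu>1)))"
    proof (rule mult_left_mono)
      have "0 \<le> k * (0 - ZI) * D ZI" using k ZI_neg DIpos by (intro mult_nonneg_nonneg) auto
      moreover have "0 \<le> 1 * (\<nu>2 - \<nu>1)" using \<nu> by simp
      ultimately show "D ZI + k * (\<nu>2 - \<nu>1) * (0 - ZI) \<le> (1 + k * (0 - ZI)) * (D ZI + (\<nu>2 - \<nu>1))"
        by (simp add: algebra_simps)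
    qed simp
    finally have "\<theta>2 0 < \<theta>1 0 \<and> \<theta>1 0 - \<theta>2 0 \<le> C * (init_angle \<nu>1 - init_angle \<nu>2 + (\<nu>2 - \<nu>1))"
      using pos[of 0] ZI_neg by (simp add: D_def[of] C_def DI[unfolded D_def] mult.assoc)
  }
  then show ?thesis using C0 by blast
qed

section \<open>Asymptotics of the Pruefer angle\<close>

text \<open>The rescaled angle is the polar angle of \<open>(v, m v' / (a k))\<close>. Its speed is an average, with weights
  \<open>cos\<^sup>2\<close> and \<open>sin\<^sup>2\<close> of that angle, of \<open>k (m - \<nu>) / a\<close> and \<open>- k a / m\<close>.\<close>

lemma lift_rate_deriv:
  assumes p: "pruefer k \<nu> \<theta>" and Z: "Z < 0" and a: "0 < a"
  defines "R \<equiv> (cos (\<theta> Z))\<^sup>2 + (1 / a)\<^sup>2 * (sin (\<theta> Z))\<^sup>2"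
  shows "((\<lambda>t. lift (1 / a) (\<theta> t)) has_real_derivative
      (k * ((m Z - \<nu>) / a * (cos (\<theta> Z))\<^sup>2 + (- a / m Z) * ((1 / a)\<^sup>2 * (sin (\<theta> Z))\<^sup>2)) / R)) (at Z)"
    and "R > 0"
proof -
  show R0: "R > 0" unfolding R_def by (rule cos_sin_sq_pos) (use a in simp)
  have "((\<lambda>t. lift (1 / a) (\<theta> t)) has_real_derivative (1 / a) / R * (k * rate \<nu> Z (\<theta> Z))) (at Z)"
    unfolding R_def by (rule DERIV_chain2[OF lift_deriv pruefer_deriv[OF p Z]]) (use a in simp)
  moreover have "(1 / a) / R * (k * rate \<nu> Z (\<theta> Z)) =
     k * ((m Z - \<nu>) / a * (cos (\<theta> Z))\<^sup>2 + (- a / m Z) * ((1 / a)\<^sup>2 * (sin (\<theta> Z))\<^sup>2)) / R"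
  proof -
    have e: "(- a / m Z) * ((1 / a)\<^sup>2 * y) = - ((1 / a) * (y / m Z))" for y
      using a by (simp add: power2_eq_square)
    have "(1 / a) * rate \<nu> Z (\<theta> Z) =
        (m Z - \<nu>) / a * (cos (\<theta> Z))\<^sup>2 + (- a / m Z) * ((1 / a)\<^sup>2 * (sin (\<theta> Z))\<^sup>2)"
      unfolding e rate_def right_diff_distrib by simp
    moreover have "(1 / a) / R * (k * x) = k * ((1 / a) * x) / R" for x by simp
    ultimately show ?thesis by (simp only:)
  qed
  ultimately show "((\<lambda>t. lift (1 / a) (\<theta> t)) has_real_derivative
      (k * ((m Z - \<nu>) / a * (cos (\<theta> Z))\<^sup>2 + (- a / m Z) * ((1 / a)\<^sup>2 * (sin (\<theta> Z))\<^sup>2)) / R)) (at Z)"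
    by simp
qed

text \<open>Bounding the average speed by the larger of its two values controls the rescaled angle, which
  differs from \<open>\<theta>\<close> by at most a quarter turn at each end: this is the constant \<open>pi\<close>. The sign \<open>\<sigma>\<close>
  covers upper and lower bounds together.\<close>

lemma pruefer_increment_le:
  assumes p: "pruefer k \<nu> \<theta>" and k: "0 < k" and st: "s \<le> t" "t \<le> 0" and a: "0 < a"
    and c: "\<And>z. s \<le> z \<Longrightarrow> z \<le> t \<Longrightarrow> \<sigma> * ((m z - \<nu>) / a) \<le> c" "\<And>z. s \<le> z \<Longrightarrow> z \<le> t \<Longrightarrow> \<sigma> * (- a / m z) \<le> c"
    and \<sigma>: "\<sigma> = 1 \<or> \<sigma> = - 1"
  shows "\<sigma> * (\<theta> t - \<theta> s) \<le> pi + k * c * (t - s)"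
proof -
  define \<phi> where "\<phi> = (\<lambda>t. lift (1 / a) (\<theta> t))"
  have c\<phi>: "continuous_on {s..t} \<phi>"
  proof -
    have "continuous_on UNIV (lift (1 / a))" by (rule DERIV_continuous_on[OF lift_deriv]) (use a in simp)
    moreover have "continuous_on {s..t} \<theta>" by (rule continuous_on_subset[OF pruefer_cont[OF p]]) (use st in auto)
    ultimately show ?thesis unfolding \<phi>_def by (rule continuous_on_compose2) auto
  qed
  have "\<sigma> * \<phi> t - k * c * t \<le> \<sigma> * \<phi> s - k * c * s"
  proof (rule DERIV_nonpos_imp_decreasing_open[OF st(1)])
    show "continuous_on {s..t} (\<lambda>z. \<sigma> * \<phi> z - k * c * z)" by (intro continuous_intros c\<phi>)
    fix z assume z: "s < z" "z < t"
    define x y where "x = (cos (\<theta> z))\<^sup>2" and "y = (1 / a)\<^sup>2 * (sin (\<theta> z))\<^sup>2"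
    have xy: "x \<ge> 0" "y \<ge> 0" by (auto simp: x_def y_def)
    have z0: "z < 0" using z st by simp
    note d = lift_rate_deriv[OF p z0 a, folded x_def y_def \<phi>_def]
    have "\<sigma> * ((m z - \<nu>) / a) * x + \<sigma> * (- a / m z) * y \<le> c * x + c * y"
      using c[of z] z xy by (intro add_mono mult_right_mono) auto
    then have "\<sigma> * ((m z - \<nu>) / a * x + (- a / m z) * y) \<le> c * (x + y)"
      by (simp only: distrib_left mult.assoc)
    then have "\<sigma> * ((m z - \<nu>) / a * x + (- a / m z) * y) / (x + y) \<le> c"
      using d(2) by (simp only: divide_le_eq if_True)
    then have "k * (\<sigma> * ((m z - \<nu>) / a * x + (- a / m z) * y) / (x + y)) \<le> k * c"
      using k by (intro mult_left_mono) auto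
    moreover have "((\<lambda>z. \<sigma> * \<phi> z - k * c * z) has_real_derivative
        \<sigma> * (k * ((m z - \<nu>) / a * x + (- a / m z) * y) / (x + y)) - k * c) (at z)"
      by (intro DERIV_diff DERIV_cmult d(1) DERIV_cmult_Id)
    ultimately show "\<exists>y. ((\<lambda>z. \<sigma> * \<phi> z - k * c * z) has_real_derivative y) (at z) \<and> y \<le> 0"
      by (intro exI conjI) (auto simp: mult.left_commute)
  qed
  moreover have "\<bar>\<phi> t - \<theta> t\<bar> \<le> pi / 2" "\<bar>\<phi> s - \<theta> s\<bar> \<le> pi / 2"
    unfolding \<phi>_def by (rule lift_close)+
  ultimately show ?thesis using \<sigma> unfolding right_diff_distrib abs_le_iff by auto
qed

text \<open>The local vertical wave number per \<open>|\<xi>|\<close>: half the length of the fibre over \<open>Z\<close> of the phase space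
  region, and the average speed of \<open>- \<theta> / k\<close> where \<open>m\<close> is constant.\<close>

definition wave_density :: "real \<Rightarrow> real \<Rightarrow> real" where
  "wave_density \<nu> Z = sqrt (max 0 (\<nu> / m Z - 1))"

lemma wave_density_nonneg: "0 \<le> wave_density \<nu> Z"
  by (simp add: wave_density_def)

lemma wave_density_zero: "Z \<le> 0 \<Longrightarrow> \<nu> \<le> m Z \<Longrightarrow> wave_density \<nu> Z = 0"
  using m_pos[of Z] by (simp add: wave_density_def field_simps)

lemma wave_density_pos:
  assumes "Z \<le> 0" "m Z < \<nu>"
  shows "0 < wave_density \<nu> Z" "\<nu> - m Z = m Z * (wave_density \<nu> Z)\<^sup>2"
  using m_pos[of Z] assms by (auto simp: wave_density_def max_def field_simps)

lemma wave_density_cont: "continuous_on {..0} (wave_density \<nu>)"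
  unfolding wave_density_def by (intro continuous_intros m_cont) (use m_pos in force)

text \<open>Where \<open>m < \<nu>\<close>, the scaling \<open>a = m u w\<close> with \<open>w = wave_density \<nu> u\<close> makes the two speeds of the rescaled
  angle equal to \<open>- w\<close> for \<open>m = m u\<close>, and smaller for smaller \<open>m\<close>. If \<open>m u \<ge> \<nu>\<close>, the positive speed
  \<open>(m u - \<nu>) / a\<close> becomes negligible as \<open>a \<rightarrow> \<infinity>\<close>.\<close>

lemma pruefer_increment_max:
  assumes p: "pruefer k \<nu> \<theta>" and k: "0 < k" and st: "s \<le> t" "t \<le> 0" and u: "s \<le> u" "u \<le> t"
    and hi: "\<And>z. s \<le> z \<Longrightarrow> z \<le> t \<Longrightarrow> m z \<le> m u"
  shows "\<theta> t - \<theta> s \<le> pi - k * wave_density \<nu> u * (t - s)"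
proof (cases "m u < \<nu>")
  case True
  define w where "w = wave_density \<nu> u"
  have u0: "u \<le> 0" using u st by simp
  have w: "0 < w" "\<nu> - m u = m u * w\<^sup>2" using wave_density_pos[OF u0 True] by (auto simp: w_def)
  have mu: "0 < m u" using m_pos u0 by simp
  have a: "0 < m u * w" using mu w by simp
  have "1 * (\<theta> t - \<theta> s) \<le> pi + k * (- w) * (t - s)"
  proof (rule pruefer_increment_le[OF p k st a])
    fix z assume z: "s \<le> z" "z \<le> t"
    have mz: "0 < m z" using m_pos z st by simp
    have "m z - \<nu> \<le> - (m u * w\<^sup>2)" using hi[OF z] w(2) by simp
    then show "1 * ((m z - \<nu>) / (m u * w)) \<le> - w"
      using a by (simp add: pos_divide_le_eq power2_eq_square algebra_simps)
    show "1 * (- (m u * w) / m z) \<le> - w" using hi[OF z] mz w by (simp add: field_simps)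
  qed simp
  then show ?thesis by (simp add: w_def)
next
  case False
  have u0: "u \<le> 0" using u st by simp
  have W: "wave_density \<nu> u = 0" by (rule wave_density_zero[OF u0]) (use False in simp)
  have "\<theta> t - \<theta> s \<le> pi + e" if e: "e > 0" for e
  proof -
    define B where "B = k * (m u - \<nu>) * (t - s)"
    have B: "B \<ge> 0" using k False st by (simp add: B_def)
    \<comment> \<open>The summand \<open>1\<close> keeps \<open>a\<close> positive if \<open>B = 0\<close>.\<close>
    define a where "a = (B + 1) / e"
    have a: "a > 0" using B e by (simp add: a_def)
    have "1 * (\<theta> t - \<theta> s) \<le> pi + k * ((m u - \<nu>) / a) * (t - s)"
    proof (rule pruefer_increment_le[OF p k st a])
      fix z assume z: "s \<le> z" "z \<le> t"
      have mz: "0 < m z" using m_pos z st by simp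
      show "1 * ((m z - \<nu>) / a) \<le> (m u - \<nu>) / a" using hi[OF z] a by (simp add: divide_right_mono)
      have "- a / m z \<le> 0" using a mz by simp
      also have "0 \<le> (m u - \<nu>) / a" using False a by simp
      finally show "1 * (- a / m z) \<le> (m u - \<nu>) / a" by simp
    qed simp
    then have "\<theta> t - \<theta> s \<le> pi + B / a" by (simp add: B_def)
    moreover have "B / a \<le> e" using B e by (simp add: a_def field_simps)
    ultimately show ?thesis by linarith
  qed
  then have "\<theta> t - \<theta> s \<le> pi" by (rule field_le_epsilon)
  then show ?thesis using W by simp
qed

text \<open>The mirror image of the preceding estimate; if \<open>m u \<ge> \<nu>\<close>, now \<open>a \<rightarrow> 0\<close> makes the speed \<open>- a / m\<close>
  negligible.\<close>

lemma pruefer_increment_min: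
  assumes p: "pruefer k \<nu> \<theta>" and k: "0 < k" and st: "s \<le> t" "t \<le> 0" and u: "s \<le> u" "u \<le> t"
    and lo: "\<And>z. s \<le> z \<Longrightarrow> z \<le> t \<Longrightarrow> m u \<le> m z"
  shows "- pi - k * wave_density \<nu> u * (t - s) \<le> \<theta> t - \<theta> s"
proof (cases "m u < \<nu>")
  case True
  define w where "w = wave_density \<nu> u"
  have u0: "u \<le> 0" using u st by simp
  have w: "0 < w" "\<nu> - m u = m u * w\<^sup>2" using wave_density_pos[OF u0 True] by (auto simp: w_def)
  have mu: "0 < m u" using m_pos u0 by simp
  have a: "0 < m u * w" using mu w by simp
  have "- 1 * (\<theta> t - \<theta> s) \<le> pi + k * w * (t - s)"
  proof (rule pruefer_increment_le[OF p k st a])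
    fix z assume z: "s \<le> z" "z \<le> t"
    have mz: "0 < m z" using m_pos z st by simp
    have "m z - \<nu> \<ge> - (m u * w\<^sup>2)" using lo[OF z] w(2) by simp
    then show "- 1 * ((m z - \<nu>) / (m u * w)) \<le> w"
      using a by (simp add: pos_divide_le_eq power2_eq_square algebra_simps)
    show "- 1 * (- (m u * w) / m z) \<le> w" using lo[OF z] mz w by (simp add: field_simps)
  qed simp
  then show ?thesis by (simp add: w_def)
next
  case False
  have u0: "u \<le> 0" using u st by simp
  have mu: "0 < m u" using m_pos u0 by simp
  have W: "wave_density \<nu> u = 0" by (rule wave_density_zero[OF u0]) (use False in simp)
  have "- (\<theta> t - \<theta> s) \<le> pi + e" if e: "e > 0" for e
  proof -
    define B where "B = k * (t - s)"
    have B: "B \<ge> 0" using k st by (simp add: B_def)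
    define a where "a = e * m u / (B + 1)"
    have a: "a > 0" using B e mu by (simp add: a_def)
    have "- 1 * (\<theta> t - \<theta> s) \<le> pi + k * (a / m u) * (t - s)"
    proof (rule pruefer_increment_le[OF p k st a])
      fix z assume z: "s \<le> z" "z \<le> t"
      have mz: "0 < m z" using m_pos z st by simp
      show "- 1 * (- a / m z) \<le> a / m u" using lo[OF z] a mu mz by (simp add: frac_le)
      have "- 1 * ((m z - \<nu>) / a) \<le> 0" using False a lo[OF z] by (simp add: divide_nonpos_pos)
      also have "0 \<le> a / m u" using a mu by simp
      finally show "- 1 * ((m z - \<nu>) / a) \<le> a / m u" .
    qed simp
    moreover have "k * (a / m u) * (t - s) = e * (B / (B + 1))" using mu by (simp add: B_def a_def)
    ultimately have "- (\<theta> t - \<theta> s) \<le> pi + e * (B / (B + 1))" by simp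
    moreover have "e * (B / (B + 1)) \<le> e * 1" using B e by (intro mult_left_mono) auto
    ultimately show ?thesis by linarith
  qed
  then have "- (\<theta> t - \<theta> s) \<le> pi" by (rule field_le_epsilon)
  then show ?thesis using W by simp
qed

lemma pruefer_increment_piece:
  assumes p: "pruefer k \<nu> \<theta>" and k: "0 < k" and st: "s \<le> t" "t \<le> 0"
    and osc: "\<And>z z'. z \<in> {s..t} \<Longrightarrow> z' \<in> {s..t} \<Longrightarrow> \<bar>wave_density \<nu> z - wave_density \<nu> z'\<bar> \<le> \<epsilon>"
  shows "\<bar>\<theta> t - \<theta> s + k * integral {s..t} (wave_density \<nu>)\<bar> \<le> pi + k * \<epsilon> * (t - s)"
proof -
  define W where "W = wave_density \<nu>"
  have W: "W integrable_on {s..t}" unfolding W_def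
    by (rule integrable_continuous_real) (rule continuous_on_subset[OF wave_density_cont], use st in auto)
  have cm: "continuous_on {s..t} m" by (rule continuous_on_subset[OF m_cont]) (use st in auto)
  have ne: "{s..t} \<noteq> {}" using st by simp
  obtain u where u: "u \<in> {s..t}" "\<forall>z\<in>{s..t}. m z \<le> m u"
    using continuous_attains_sup[OF compact_Icc ne cm] by auto
  obtain v where v: "v \<in> {s..t}" "\<forall>z\<in>{s..t}. m v \<le> m z"
    using continuous_attains_inf[OF compact_Icc ne cm] by auto
  have up: "\<theta> t - \<theta> s \<le> pi - k * W u * (t - s)"
    unfolding W_def by (rule pruefer_increment_max[OF p k st]) (use u in auto)
  have lo: "- pi - k * W v * (t - s) \<le> \<theta> t - \<theta> s"
    unfolding W_def by (rule pruefer_increment_min[OF p k st]) (use v in auto)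
  have "integral {s..t} W \<le> integral {s..t} (\<lambda>_. W u + \<epsilon>)"
    using osc[OF _ u(1)] by (intro integral_le W) (auto simp: W_def abs_le_iff algebra_simps)
  then have "integral {s..t} W \<le> (W u + \<epsilon>) * (t - s)" using st by (simp add: mult.commute)
  then have 1: "k * integral {s..t} W \<le> k * ((W u + \<epsilon>) * (t - s))" using k by (intro mult_left_mono) auto
  have "integral {s..t} (\<lambda>_. W v - \<epsilon>) \<le> integral {s..t} W"
    using osc[OF _ v(1)] by (intro integral_le W) (auto simp: W_def abs_le_iff algebra_simps)
  then have "(W v - \<epsilon>) * (t - s) \<le> integral {s..t} W" using st by (simp add: mult.commute)
  then have 2: "k * ((W v - \<epsilon>) * (t - s)) \<le> k * integral {s..t} W" using k by (intro mult_left_mono) auto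
  show ?thesis using up lo 1 2 unfolding W_def by (simp add: abs_le_iff algebra_simps)
qed

text \<open>On pieces where the wave density oscillates by at most \<open>\<epsilon>'\<close> its integral is close to its value at
  any point. The number \<open>n\<close> of pieces depends on \<open>\<epsilon>\<close> but not on \<open>k\<close>, so the half turns lost on the
  pieces add up to a constant.\<close>

lemma pruefer_asymptotics:
  assumes \<epsilon>: "0 < \<epsilon>"
  shows "\<exists>C. \<forall>k \<theta>. 0 < k \<and> pruefer k \<nu> \<theta> \<longrightarrow>
    \<bar>\<theta> 0 - \<theta> ZI + k * integral {ZI..0} (wave_density \<nu>)\<bar> \<le> C + k * \<epsilon>"
proof -
  define W where "W = wave_density \<nu>"
  have cW: "continuous_on {ZI..0} W" unfolding W_def by (rule continuous_on_subset[OF wave_density_cont]) auto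
  define \<epsilon>' where "\<epsilon>' = \<epsilon> / (- ZI)"
  have \<epsilon>': "\<epsilon>' > 0" using \<epsilon> ZI_neg unfolding \<epsilon>'_def by (intro divide_pos_pos) auto
  have "uniformly_continuous_on {ZI..0} W" by (rule compact_uniformly_continuous[OF cW compact_Icc])
  then obtain d where d: "d > 0" "\<And>z z'. z \<in> {ZI..0} \<Longrightarrow> z' \<in> {ZI..0} \<Longrightarrow> dist z' z < d \<Longrightarrow> dist (W z') (W z) < \<epsilon>'"
    using \<epsilon>' unfolding uniformly_continuous_on_def by (elim allE[of _ \<epsilon>']) auto
  obtain n :: nat where n: "(- ZI) / d < real n" using reals_Archimedean2 by blast
  have n0: "0 < real n"
  proof -
    have "(- ZI) / d > 0" using d(1) ZI_neg by (intro divide_pos_pos) auto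
    then show ?thesis using n by linarith
  qed
  define h where "h = (- ZI) / real n"
  have h: "0 < h" unfolding h_def using n0 ZI_neg by (intro divide_pos_pos) auto
  have "- ZI < real n * d" using n d(1) by (simp only: pos_divide_less_eq)
  then have hd: "h < d" unfolding h_def using n0 by (simp only: pos_divide_less_eq mult.commute)
  have nh: "real n * h = - ZI" using n0 by (simp add: h_def)
  {
    fix k \<theta> assume k: "0 < k" and p: "pruefer k \<nu> \<theta>"
    have "i \<le> n \<Longrightarrow> \<bar>\<theta> (ZI + real i * h) - \<theta> ZI + k * integral {ZI..ZI + real i * h} W\<bar> \<le> real i * pi + k * \<epsilon>' * (real i * h)" for i
    proof (induction i)
      case 0
      then show ?case by simp
    next
      case (Suc i)
      define s t where "s = ZI + real i * h" and "t = ZI + real (Suc i) * h"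
      have ts: "t = s + h" by (simp add: s_def t_def algebra_simps)
      have sI: "ZI \<le> s" using h by (simp add: s_def)
      have "real (Suc i) * h \<le> real n * h" using Suc.prems h by (intro mult_right_mono) auto
      then have t0: "t \<le> 0" using nh by (simp add: t_def)
      have "\<bar>\<theta> t - \<theta> s + k * integral {s..t} W\<bar> \<le> pi + k * \<epsilon>' * (t - s)"
        unfolding W_def
      proof (rule pruefer_increment_piece[OF p k])
        show "s \<le> t" "t \<le> 0" using ts h t0 by auto
        fix z z' assume z: "z \<in> {s..t}" "z' \<in> {s..t}"
        then have "dist z' z < d" using ts h hd by (auto simp: dist_real_def)
        then have "dist (W z') (W z) < \<epsilon>'" using z sI t0 by (intro d(2)) auto
        then show "\<bar>wave_density \<nu> z - wave_density \<nu> z'\<bar> \<le> \<epsilon>'" by (simp add: W_def dist_real_def)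
      qed
      moreover have "integral {ZI..s} W + integral {s..t} W = integral {ZI..t} W"
      proof (rule Henstock_Kurzweil_Integration.integral_combine)
        show "W integrable_on {ZI..t}"
          by (rule integrable_continuous_real) (rule continuous_on_subset[OF cW], use t0 in auto)
      qed (use sI ts h in auto)
      then have "k * integral {ZI..t} W = k * integral {ZI..s} W + k * integral {s..t} W"
        by (simp flip: distrib_left)
      moreover have "\<bar>\<theta> s - \<theta> ZI + k * integral {ZI..s} W\<bar> \<le> real i * pi + k * \<epsilon>' * (real i * h)"
        using Suc by (simp add: s_def)
      moreover have "real (Suc i) * pi + k * \<epsilon>' * (real (Suc i) * h) = (real i * pi + k * \<epsilon>' * (real i * h)) + (pi + k * \<epsilon>' * (t - s))"
        unfolding ts by (simp add: algebra_simps)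
      ultimately have "\<bar>\<theta> t - \<theta> ZI + k * integral {ZI..t} W\<bar> \<le> real (Suc i) * pi + k * \<epsilon>' * (real (Suc i) * h)"
        unfolding abs_le_iff by linarith
      then show ?case by (simp add: t_def)
    qed
    from this[of n] have "\<bar>\<theta> 0 - \<theta> ZI + k * integral {ZI..0} W\<bar> \<le> real n * pi + k * \<epsilon>' * (- ZI)"
      using nh by simp
    moreover have "k * \<epsilon>' * (- ZI) = k * \<epsilon>" using ZI_neg by (simp add: \<epsilon>'_def)
    ultimately have "\<bar>\<theta> 0 - \<theta> ZI + k * integral {ZI..0} W\<bar> \<le> real n * pi + k * \<epsilon>" by simp
  }
  then show ?thesis unfolding W_def by blast
qed

lemma init_angle_bounds:
  assumes "\<nu> < m ZI"
  shows "0 < init_angle \<nu>" "init_angle \<nu> < pi / 2"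
proof -
  show "0 < init_angle \<nu>" using assms m_pos[of ZI] ZI_neg by (simp add: init_angle_def)
  show "init_angle \<nu> < pi / 2" unfolding init_angle_def by (rule arctan_ubound)
qed

text \<open>The wave density is nonnegative, so the whole interval counts as a single piece that gains at
  most a half turn.\<close>

lemma pruefer_end_le:
  assumes p: "pruefer k \<nu> \<theta>" and k: "0 < k" and \<nu>: "\<nu> < m ZI"
  shows "\<theta> 0 \<le> 3 * pi / 2"
proof -
  have cm: "continuous_on {ZI..0} m" by (rule continuous_on_subset[OF m_cont]) auto
  have ne: "{ZI..0} \<noteq> {}" using ZI_neg by simp
  obtain u where u: "u \<in> {ZI..0}" "\<forall>z\<in>{ZI..0}. m z \<le> m u"
    using continuous_attains_sup[OF compact_Icc ne cm] by auto
  have "\<theta> 0 - \<theta> ZI \<le> pi - k * wave_density \<nu> u * (0 - ZI)"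
    by (rule pruefer_increment_max[OF p k]) (use u ZI_neg in auto)
  moreover have "k * wave_density \<nu> u * (0 - ZI) \<ge> 0"
    using k wave_density_nonneg[of \<nu> u] ZI_neg by (intro mult_nonneg_nonneg) auto
  moreover have "\<theta> ZI = init_angle \<nu>" using p by (simp add: pruefer_def)
  ultimately show ?thesis using init_angle_bounds[OF \<nu>] by linarith
qed

lemma pruefer_end_ge:
  assumes p: "pruefer k \<nu> \<theta>" and k: "0 < k" and \<nu>: "\<nu> < m ZI" and below: "\<And>z. ZI \<le> z \<Longrightarrow> z \<le> 0 \<Longrightarrow> \<nu> \<le> m z"
  shows "- pi \<le> \<theta> 0"
proof -
  have cm: "continuous_on {ZI..0} m" by (rule continuous_on_subset[OF m_cont]) auto
  have ne: "{ZI..0} \<noteq> {}" using ZI_neg by simp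
  obtain u where u: "u \<in> {ZI..0}" "\<forall>z\<in>{ZI..0}. m u \<le> m z"
    using continuous_attains_inf[OF compact_Icc ne cm] by auto
  have "- pi - k * wave_density \<nu> u * (0 - ZI) \<le> \<theta> 0 - \<theta> ZI"
    by (rule pruefer_increment_min[OF p k]) (use u ZI_neg in auto)
  moreover have "wave_density \<nu> u = 0" by (rule wave_density_zero) (use u below in auto)
  moreover have "\<theta> ZI = init_angle \<nu>" using p by (simp add: pruefer_def)
  ultimately show ?thesis using init_angle_bounds[OF \<nu>] by simp
qed

end

section \<open>Classical eigenfunctions\<close>

lemma continuous_AE_eq_imp_eq:
  fixes f g :: "real \<Rightarrow> 'b::real_normed_vector"
  assumes f: "continuous_on {..0} f" and g: "continuous_on {..0} g"
    and ae: "AE Z in half_line. f Z = g Z" and Z: "Z \<le> 0"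
  shows "f Z = g Z"
proof -
  define C where "C = {z \<in> {..0}. f z - g z = 0}"
  have "closed C" unfolding C_def
    by (rule continuous_closed_preimage_constant) (intro continuous_intros f g, simp)
  moreover have "AE z in lebesgue. z \<in> {..<0} \<longrightarrow> z \<in> C"
  proof -
    have "AE z in lebesgue. z < 0 \<longrightarrow> f z = g z" using ae AE_lebesgue_on_neg_iff by simp
    then show ?thesis by eventually_elim (auto simp: C_def)
  qed
  ultimately have sub: "{..<0} \<subseteq> C"
    by (intro subsetI mem_closed_if_AE_lebesgue_open[of "{..<0}" C]) simp_all
  have "closure {..<0::real} \<subseteq> C" using sub \<open>closed C\<close> by (rule closure_minimal)
  then show ?thesis using Z by (auto simp: C_def closure_lessThan)
qed

lemma has_weak_deriv_weak_deriv: "has_weak_deriv f g \<Longrightarrow> has_weak_deriv f (weak_deriv f)"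
  unfolding weak_deriv_def by (rule someI[of "has_weak_deriv f"])

text \<open>Used to exclude the growing exponential from eigenfunctions.\<close>

lemma not_integrable_if_bounded_below:
  fixes f :: "real \<Rightarrow> real"
  assumes i: "integrable half_line f" and c: "0 < c" and b: "b \<le> 0"
    and ge: "\<And>Z. Z \<le> b \<Longrightarrow> c \<le> f Z" and nn: "\<And>Z. 0 \<le> f Z"
  shows False
proof -
  have i': "integrable lebesgue (\<lambda>Z. indicator {..0} Z *\<^sub>R f Z)"
    using i by (subst (asm) integrable_restrict_space) auto
  define I where "I = (LINT Z|lebesgue. indicator {..0} Z *\<^sub>R f Z)"
  have "real n * c \<le> I" for n :: nat
  proof -
    have e: "(LINT Z|lebesgue. indicator {b - real n..b} Z *\<^sub>R c) = real n * c"
      by (subst integral_scaleR_left) auto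
    have "(LINT Z|lebesgue. indicator {b - real n..b} Z *\<^sub>R c) \<le> I"
      unfolding I_def
    proof (rule integral_mono[OF _ i'])
      show "integrable lebesgue (\<lambda>Z. indicat_real {b - real n..b} Z *\<^sub>R c)"
        by (intro integrable_scaleR_left integrable_real_indicator) auto
      show "indicat_real {b - real n..b} Z *\<^sub>R c \<le> indicat_real {..0} Z *\<^sub>R f Z" for Z
        using ge[of Z] nn[of Z] b by (auto simp: indicator_def)
    qed
    then show ?thesis using e by simp
  qed
  moreover obtain n :: nat where "I / c < real n" using reals_Archimedean2 by blast
  ultimately show False using c by (simp add: pos_divide_less_eq not_less[symmetric])
qed

context layered_profile
begin

text \<open>The Love equation with eigenvalue \<open>\<nu> k\<^sup>2\<close> as a first-order system for \<open>u\<close> and the traction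
  \<open>q = m u'\<close>.\<close>

definition solves :: "real \<Rightarrow> real \<Rightarrow> (real \<Rightarrow> real) \<Rightarrow> (real \<Rightarrow> real) \<Rightarrow> bool" where
  "solves k \<nu> u q \<longleftrightarrow> (\<forall>Z\<le>0. (u has_real_derivative q Z / m Z) (at Z within {..0}) \<and>
     (q has_real_derivative k\<^sup>2 * (m Z - \<nu>) * u Z) (at Z within {..0}))"

lemma solvesD:
  assumes "solves k \<nu> u q"
  shows "\<And>Z. Z \<le> 0 \<Longrightarrow> (u has_real_derivative q Z / m Z) (at Z within {..0})"
    and "\<And>Z. Z \<le> 0 \<Longrightarrow> (q has_real_derivative k\<^sup>2 * (m Z - \<nu>) * u Z) (at Z within {..0})"
    and "continuous_on {..0} u" and "continuous_on {..0} q"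
    and "\<And>Z. Z < 0 \<Longrightarrow> (u has_real_derivative q Z / m Z) (at Z)"
    and "\<And>Z. Z < 0 \<Longrightarrow> (q has_real_derivative k\<^sup>2 * (m Z - \<nu>) * u Z) (at Z)"
proof -
  show u: "(u has_real_derivative q Z / m Z) (at Z within {..0})"
    and q: "(q has_real_derivative k\<^sup>2 * (m Z - \<nu>) * u Z) (at Z within {..0})" if "Z \<le> 0" for Z
    using assms that unfolding solves_def by auto
  show "continuous_on {..0} u" by (rule DERIV_continuous_on) (rule u, simp)
  show "continuous_on {..0} q" by (rule DERIV_continuous_on) (rule q, simp)
  show "(u has_real_derivative q Z / m Z) (at Z)" if "Z < 0" for Z
    using u[of Z] that by (simp add: at_within_atMost_neg)
  show "(q has_real_derivative k\<^sup>2 * (m Z - \<nu>) * u Z) (at Z)" if "Z < 0" for Z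
    using q[of Z] that by (simp add: at_within_atMost_neg)
qed

text \<open>Both sides agree when \<open>(k u, q)\<close> has the direction \<open>\<theta>\<close>. Their difference \<open>Y\<close> is the Wronskian with
  the Pruefer solution, divided by its amplitude, and hence satisfies a linear homogeneous equation
  \<open>Y' = - \<rho> Y\<close>; the factor \<open>\<rho>\<close> is the logarithmic derivative of the amplitude.\<close>

lemma wronskian_zero:
  assumes p: "pruefer k \<nu> \<theta>"
    and sol: "solves k \<nu> u q"
    and start: "k * u ZI * sin (\<theta> ZI) = q ZI * cos (\<theta> ZI)"
  shows "k * u 0 * sin (\<theta> 0) = q 0 * cos (\<theta> 0)"
proof -
  define Y where "Y = (\<lambda>Z. k * u Z * sin (\<theta> Z) - q Z * cos (\<theta> Z))"
  define \<rho> where "\<rho> = (\<lambda>Z. k * sin (\<theta> Z) * cos (\<theta> Z) * (m Z - \<nu> + 1 / m Z))"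
  note cu = solvesD(3)[OF sol] and cq = solvesD(4)[OF sol]
  have cth: "continuous_on {..0} \<theta>" by (rule pruefer_cont[OF p])
  have mnz: "\<forall>Z\<in>{ZI..0}. m Z \<noteq> 0" using m_pos by force
  have cY: "continuous_on {..0} Y" unfolding Y_def by (intro continuous_intros cu cq cth)
  have dY: "(Y has_real_derivative - \<rho> Z * Y Z) (at Z)" if Z: "Z < 0" for Z
  proof -
    note du = solvesD(5)[OF sol Z] and dq = solvesD(6)[OF sol Z]
    define s c where "s = sin (\<theta> Z)" and "c = cos (\<theta> Z)"
    have cs: "s\<^sup>2 = 1 - c\<^sup>2" unfolding s_def c_def by (rule sin_squared_eq)
    define \<theta>' where "\<theta>' = k * rate \<nu> Z (\<theta> Z)"
    have \<theta>': "\<theta>' = k * ((m Z - \<nu>) * c\<^sup>2 - s\<^sup>2 / m Z)" by (simp add: \<theta>'_def rate_def s_def c_def)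
    have dth: "(\<theta> has_real_derivative \<theta>') (at Z)" unfolding \<theta>'_def by (rule pruefer_deriv[OF p Z])
    have "(Y has_real_derivative
        (k * (q Z / m Z) * s + k * u Z * (c * \<theta>')) - (k\<^sup>2 * (m Z - \<nu>) * u Z * c + q Z * (- s * \<theta>'))) (at Z)"
      unfolding Y_def s_def c_def
      by (auto intro!: derivative_eq_intros du dq dth)
    moreover have "(k * (q Z / m Z) * s + k * u Z * (c * \<theta>')) - (k\<^sup>2 * (m Z - \<nu>) * u Z * c + q Z * (- s * \<theta>')) = - \<rho> Z * Y Z"
    proof -
      define a b where "a = m Z - \<nu>" and "b = 1 / m Z"
      have th: "\<theta>' = k * (a * c\<^sup>2 - b * (1 - c\<^sup>2))" by (simp add: \<theta>' a_def b_def cs)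
      have "k * u Z * c * (\<theta>' - k * a) = - (k\<^sup>2 * u Z * c * s\<^sup>2 * (a + b))"
        unfolding th cs by (simp add: power2_eq_square algebra_simps)
      moreover have "q Z * s * (k * b + \<theta>') = k * q Z * s * c\<^sup>2 * (a + b)"
        unfolding th cs by (simp add: power2_eq_square algebra_simps)
      moreover have "(k * (q Z / m Z) * s + k * u Z * (c * \<theta>')) - (k\<^sup>2 * (m Z - \<nu>) * u Z * c + q Z * (- s * \<theta>'))
         = k * u Z * c * (\<theta>' - k * a) + q Z * s * (k * b + \<theta>')"
        by (simp add: a_def b_def power2_eq_square algebra_simps)
      moreover have "- \<rho> Z * Y Z = - (k\<^sup>2 * u Z * c * s\<^sup>2 * (a + b)) + k * q Z * s * c\<^sup>2 * (a + b)"
        by (simp add: \<rho>_def Y_def a_def b_def s_def c_def power2_eq_square algebra_simps)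
      ultimately show ?thesis by simp
    qed
    ultimately show ?thesis by simp
  qed
  have c\<rho>: "continuous_on {ZI..0} \<rho>" unfolding \<rho>_def
    by (intro continuous_intros continuous_on_subset[OF m_cont] continuous_on_subset[OF cth] mnz) auto
  obtain v where v: "\<forall>z\<in>{ZI..0}. - \<rho> z \<le> - \<rho> v"
    using continuous_attains_sup[OF compact_Icc _ continuous_on_minus[OF c\<rho>]] ZI_neg by auto
  define L where "L = max 0 (2 * (- \<rho> v))"
  have "(Y 0)\<^sup>2 \<le> exp (L * (0 - ZI)) * ((Y ZI)\<^sup>2 + 0 * (0 - ZI))"
  proof (rule gronwall_upper[where D' = "\<lambda>Z. 2 * Y Z * (- \<rho> Z * Y Z)"])
    show "continuous_on {ZI..0} (\<lambda>Z. (Y Z)\<^sup>2)" by (intro continuous_intros continuous_on_subset[OF cY]) auto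
    fix Z assume Z: "ZI < Z" "Z < 0"
    show "((\<lambda>Z. (Y Z)\<^sup>2) has_real_derivative 2 * Y Z * (- \<rho> Z * Y Z)) (at Z)"
      using dY[OF Z(2)] by (auto intro!: derivative_eq_intros)
    have "- \<rho> Z \<le> - \<rho> v" using v Z by auto
    then have "2 * (- \<rho> Z) \<le> L" by (simp add: L_def)
    then have "2 * (- \<rho> Z) * (Y Z)\<^sup>2 \<le> L * (Y Z)\<^sup>2" by (intro mult_right_mono) auto
    then show "2 * Y Z * (- \<rho> Z * Y Z) \<le> L * (Y Z)\<^sup>2 + 0" by (simp add: power2_eq_square algebra_simps)
  qed (use ZI_neg in \<open>auto simp: L_def\<close>)
  moreover have "Y ZI = 0" using start by (simp add: Y_def)
  ultimately have "(Y 0)\<^sup>2 \<le> 0" by simp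
  then show ?thesis by (simp add: Y_def)
qed

text \<open>Gronwall's inequality for \<open>u\<^sup>2 + q\<^sup>2\<close>, with depth reversed so that it runs down from the surface.\<close>

lemma zero_initial_data_imp_zero:
  assumes sol: "solves k \<nu> u q"
    and z: "u 0 = 0" "q 0 = 0" and Z: "Z \<le> 0"
  shows "u Z = 0"
proof -
  obtain lo hi where lh: "0 < lo" "\<And>Z. Z \<le> 0 \<Longrightarrow> lo \<le> m Z" "\<And>Z. Z \<le> 0 \<Longrightarrow> m Z \<le> hi"
    using m_bounds by auto
  note cu = solvesD(3)[OF sol] and cq = solvesD(4)[OF sol]
  define D where "D = (\<lambda>s. (u (- s))\<^sup>2 + (q (- s))\<^sup>2)"
  define c where "c = (\<lambda>s. 1 / m (- s) + k\<^sup>2 * (m (- s) - \<nu>))"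
  define L where "L = 1 / lo + k\<^sup>2 * (hi + \<bar>\<nu>\<bar>)"
  have hi0: "0 < hi" using lh(3)[of 0] m_pos[of 0] by simp
  have L0: "L \<ge> 0" using lh(1) hi0 by (simp add: L_def)
  have "D (- Z) \<le> exp (L * (- Z - 0)) * (D 0 + 0 * (- Z - 0))"
  proof (rule gronwall_upper[where D' = "\<lambda>s. - (2 * u (- s) * q (- s) * c s)"])
    show "continuous_on {0..- Z} D" unfolding D_def
      by (intro continuous_intros continuous_on_compose2[OF cu] continuous_on_compose2[OF cq]) auto
    fix s assume s: "0 < s" "s < - Z"
    have du: "(u has_real_derivative q (- s) / m (- s)) (at (- s))"
      and dq: "(q has_real_derivative k\<^sup>2 * (m (- s) - \<nu>) * u (- s)) (at (- s))"
      using solvesD(5,6)[OF sol, of "- s"] s by simp_all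
    have dm: "(uminus has_real_derivative - 1) (at s)" by (auto intro!: derivative_eq_intros)
    have "((\<lambda>s. u (- s)) has_real_derivative q (- s) / m (- s) * (- 1)) (at s)"
      by (rule DERIV_chain2[where f = u and g = uminus, OF du dm])
    moreover have "((\<lambda>s. q (- s)) has_real_derivative k\<^sup>2 * (m (- s) - \<nu>) * u (- s) * (- 1)) (at s)"
      by (rule DERIV_chain2[where f = q and g = uminus, OF dq dm])
    ultimately show "(D has_real_derivative - (2 * u (- s) * q (- s) * c s)) (at s)"
      unfolding D_def c_def by (auto intro!: derivative_eq_intros simp: algebra_simps)
    have "\<bar>2 * u (- s) * q (- s)\<bar> \<le> D s"
      unfolding D_def using sum_squares_bound[of "u (- s)" "q (- s)"] sum_squares_bound[of "u (- s)" "- q (- s)"]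
      by (simp add: abs_le_iff)
    moreover have "\<bar>c s\<bar> \<le> L"
    proof -
      have "\<bar>1 / m (- s)\<bar> \<le> 1 / lo" using lh(1) lh(2)[of "- s"] s by (simp add: frac_le)
      moreover have "\<bar>m (- s) - \<nu>\<bar> \<le> hi + \<bar>\<nu>\<bar>" using lh(3)[of "- s"] m_pos[of "- s"] s by linarith
      then have "\<bar>k\<^sup>2 * (m (- s) - \<nu>)\<bar> \<le> k\<^sup>2 * (hi + \<bar>\<nu>\<bar>)"
        by (simp add: abs_mult mult_left_mono)
      ultimately show ?thesis unfolding c_def L_def by linarith
    qed
    ultimately have "\<bar>2 * u (- s) * q (- s)\<bar> * \<bar>c s\<bar> \<le> D s * L"
      by (intro mult_mono) (auto simp: D_def)
    then have "\<bar>2 * u (- s) * q (- s) * c s\<bar> \<le> D s * L" by (simp only: abs_mult)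
    then show "- (2 * u (- s) * q (- s) * c s) \<le> L * D s + 0" by (simp add: abs_le_iff mult.commute)
  qed (use Z L0 in auto)
  then have "(u Z)\<^sup>2 + (q Z)\<^sup>2 \<le> 0" using z by (simp add: D_def)
  then have "(u Z)\<^sup>2 = 0" using zero_le_power2[of "u Z"] zero_le_power2[of "q Z"] by linarith
  then show ?thesis by simp
qed

text \<open>Below \<open>ZI\<close> the solution is a combination of \<open>exp (\<kappa> Z)\<close> and \<open>exp (- \<kappa> Z)\<close>. Up to their exponential
  factors, \<open>A\<close> and \<open>B\<close> read off the two coefficients, and the second one has to vanish.\<close>

lemma square_integrable_imp_decaying:
  assumes k: "0 < k" and \<nu>: "\<nu> < m ZI"
    and sol: "solves k \<nu> u q"
    and int: "integrable half_line (\<lambda>Z. (u Z)\<^sup>2)"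
  shows "q ZI = k * sqrt (m ZI * (m ZI - \<nu>)) * u ZI"
proof -
  define M where "M = m ZI"
  have M: "M > 0" using m_pos ZI_neg by (simp add: M_def)
  define \<sigma> where "\<sigma> = sqrt (M * (M - \<nu>))"
  have \<sigma>: "\<sigma> > 0" "\<sigma> * \<sigma> = M * (M - \<nu>)" using M \<nu> by (auto simp: \<sigma>_def M_def)
  define \<kappa> where "\<kappa> = k * \<sigma> / M"
  have \<kappa>: "\<kappa> > 0" using k \<sigma> M by (simp add: \<kappa>_def)
  have \<kappa>2: "k\<^sup>2 * (M - \<nu>) = \<kappa> * (k * \<sigma>)"
  proof -
    have "\<kappa> * (k * \<sigma>) = k\<^sup>2 * (\<sigma> * \<sigma>) / M" by (simp add: \<kappa>_def power2_eq_square)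
    then show ?thesis using M by (simp add: \<sigma>(2))
  qed
  have du: "(u has_real_derivative q Z / M) (at Z)" if "Z \<le> ZI" for Z
    using solvesD(5)[OF sol, of Z] that ZI_neg m_const[OF that] by (simp add: M_def)
  have dq: "(q has_real_derivative \<kappa> * (k * \<sigma>) * u Z) (at Z)" if "Z \<le> ZI" for Z
    using solvesD(6)[OF sol, of Z] that ZI_neg m_const[OF that] \<kappa>2 by (simp add: M_def)
  define A where "A = (\<lambda>Z. (k * \<sigma> * u Z + q Z) * exp (- \<kappa> * Z))"
  define B where "B = (\<lambda>Z. (k * \<sigma> * u Z - q Z) * exp (\<kappa> * Z))"
  have dA: "(A has_real_derivative 0) (at Z)" and dB: "(B has_real_derivative 0) (at Z)" if "Z \<le> ZI" for Z
  proof -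
    have "(A has_real_derivative (k * \<sigma> * (q Z / M) + \<kappa> * (k * \<sigma>) * u Z) * exp (- \<kappa> * Z) +
        (k * \<sigma> * u Z + q Z) * (exp (- \<kappa> * Z) * (- \<kappa>))) (at Z)"
      unfolding A_def using du[OF that] dq[OF that] by (auto intro!: derivative_eq_intros)
    moreover have e: "k * \<sigma> * (q Z / M) = \<kappa> * q Z" by (simp add: \<kappa>_def)
    have "(k * \<sigma> * (q Z / M) + \<kappa> * (k * \<sigma>) * u Z) * exp (- \<kappa> * Z) +
        (k * \<sigma> * u Z + q Z) * (exp (- \<kappa> * Z) * (- \<kappa>)) = 0"
      unfolding e by (simp add: algebra_simps)
    ultimately show "(A has_real_derivative 0) (at Z)" by simp
    have "(B has_real_derivative (k * \<sigma> * (q Z / M) - \<kappa> * (k * \<sigma>) * u Z) * exp (\<kappa> * Z) +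
        (k * \<sigma> * u Z - q Z) * (exp (\<kappa> * Z) * \<kappa>)) (at Z)"
      unfolding B_def using du[OF that] dq[OF that] by (auto intro!: derivative_eq_intros)
    moreover have "(k * \<sigma> * (q Z / M) - \<kappa> * (k * \<sigma>) * u Z) * exp (\<kappa> * Z) +
        (k * \<sigma> * u Z - q Z) * (exp (\<kappa> * Z) * \<kappa>) = 0"
      unfolding e by (simp add: algebra_simps)
    ultimately show "(B has_real_derivative 0) (at Z)" by simp
  qed
  have const: "F Z = F ZI" if "\<And>z. z \<le> ZI \<Longrightarrow> (F has_real_derivative 0) (at z)" "Z \<le> ZI" for F :: "real \<Rightarrow> real" and Z
  proof (cases "Z = ZI")
    case False
    have "F ZI - F Z = (ZI - Z) * 0"
      using MVT2[of Z ZI F "\<lambda>_. 0"] that False by force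
    then show ?thesis by simp
  qed simp
  define a b where "a = A ZI" and "b = B ZI"
  have rep: "2 * (k * \<sigma>) * u Z = a * exp (\<kappa> * Z) + b * exp (- \<kappa> * Z)" if "Z \<le> ZI" for Z
  proof -
    have e: "a = A Z" "b = B Z" using const[OF dA that] const[OF dB that] by (auto simp: a_def b_def)
    have "a * exp (\<kappa> * Z) + b * exp (- \<kappa> * Z) =
       (k * \<sigma> * u Z + q Z) * (exp (- \<kappa> * Z) * exp (\<kappa> * Z)) + (k * \<sigma> * u Z - q Z) * (exp (\<kappa> * Z) * exp (- \<kappa> * Z))"
      unfolding e by (simp only: A_def B_def mult.assoc)
    then show ?thesis by (simp add: exp_minus)
  qed
  have "b = 0"
  proof (rule ccontr)
    assume b: "b \<noteq> 0"
    \<comment> \<open>Here \<open>|b| exp (- \<kappa> Z) \<ge> |b| (1 - \<kappa> Z) \<ge> |b| + |a|\<close>, so the growing part dominates.\<close>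
  define Z1 where "Z1 = min ZI (- (\<bar>a\<bar> / (\<bar>b\<bar> * \<kappa>)))"
    have Z1: "Z1 \<le> ZI" "Z1 \<le> - (\<bar>a\<bar> / (\<bar>b\<bar> * \<kappa>))" by (auto simp: Z1_def)
    define c where "c = (\<bar>b\<bar> / 2 / (2 * (k * \<sigma>)))\<^sup>2"
    have ks: "k * \<sigma> > 0" using k \<sigma> by simp
    have "c \<le> (u Z)\<^sup>2" if Z: "Z \<le> Z1" for Z
    proof -
      have ZI': "Z \<le> ZI" using Z Z1 by simp
      have "\<bar>a\<bar> \<le> \<bar>b\<bar> * \<kappa> * (- Z)"
      proof -
        have "\<bar>a\<bar> / (\<bar>b\<bar> * \<kappa>) \<le> - Z" using Z Z1 by linarith
        then show ?thesis using b \<kappa> by (simp add: pos_divide_le_eq mult.commute)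
      qed
      moreover have "1 + (- \<kappa> * Z) \<le> exp (- \<kappa> * Z)" by (rule exp_ge_add_one_self)
      then have "\<bar>b\<bar> * (1 + (- \<kappa> * Z)) \<le> \<bar>b\<bar> * exp (- \<kappa> * Z)" by (intro mult_left_mono) auto
      ultimately have 1: "\<bar>b\<bar> + \<bar>a\<bar> \<le> \<bar>b * exp (- \<kappa> * Z)\<bar>" by (simp add: abs_mult algebra_simps)
      have "exp (\<kappa> * Z) \<le> 1" using \<kappa> ZI' ZI_neg by (simp add: mult_nonneg_nonpos)
      then have 2: "\<bar>a * exp (\<kappa> * Z)\<bar> \<le> \<bar>a\<bar>" by (simp add: abs_mult mult_left_le)
      have "\<bar>b\<bar> / 2 \<le> \<bar>2 * (k * \<sigma>) * u Z\<bar>" using 1 2 unfolding rep[OF ZI'] by linarith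
      also have "\<bar>2 * (k * \<sigma>) * u Z\<bar> = \<bar>u Z\<bar> * (2 * (k * \<sigma>))" 
      proof -
        have "\<bar>2 * (k * \<sigma>)\<bar> = 2 * (k * \<sigma>)" by (rule abs_of_pos) (use ks in simp)
        then show ?thesis unfolding abs_mult[of "2 * (k * \<sigma>)" "u Z"] by (simp only: mult.commute)
      qed
      finally have "\<bar>b\<bar> / 2 / (2 * (k * \<sigma>)) \<le> \<bar>u Z\<bar>" using ks by (subst pos_divide_le_eq) simp_all
      then have "(\<bar>b\<bar> / 2 / (2 * (k * \<sigma>)))\<^sup>2 \<le> \<bar>u Z\<bar>\<^sup>2" using ks by (intro power_mono) auto
      then show ?thesis by (simp add: c_def)
    qed
    moreover have "c > 0" using b k \<sigma>(1) by (simp add: c_def)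
    moreover have "Z1 \<le> 0" using Z1 ZI_neg by simp
    ultimately show False using not_integrable_if_bounded_below[OF int] by auto
  qed
  then show ?thesis by (simp add: b_def B_def \<sigma>_def M_def)
qed

lemma classical_eigenfunction_imp_angle:
  assumes p: "pruefer k \<nu> \<theta>" and k: "0 < k" and \<nu>: "\<nu> < m ZI"
    and sol: "solves k \<nu> u q"
    and int: "integrable half_line (\<lambda>Z. (u Z)\<^sup>2)"
    and q0: "q 0 = 0" and nz: "Z0 \<le> 0" "u Z0 \<noteq> 0"
  shows "sin (\<theta> 0) = 0"
proof -
  define \<sigma> where "\<sigma> = sqrt (m ZI * (m ZI - \<nu>))"
  have th: "\<theta> ZI = arctan \<sigma>" using p by (simp add: pruefer_def init_angle_def \<sigma>_def)
  have "sin (\<theta> ZI) = \<sigma> * cos (\<theta> ZI)" unfolding th by (simp add: sin_arctan cos_arctan)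
  moreover have "q ZI = k * \<sigma> * u ZI"
    unfolding \<sigma>_def by (rule square_integrable_imp_decaying[OF k \<nu> sol int])
  ultimately have "k * u ZI * sin (\<theta> ZI) = q ZI * cos (\<theta> ZI)" by simp
  from wronskian_zero[OF p sol this] have "k * u 0 * sin (\<theta> 0) = 0" using q0 by simp
  moreover have "u 0 \<noteq> 0" using zero_initial_data_imp_zero[OF sol _ q0 nz(1)] nz(2) by blast
  ultimately show ?thesis using k by simp
qed

end

section \<open>Eigenfunctions of the Love operator\<close>

text \<open>The dominating function for the decaying eigenfunctions.\<close>

lemma exp_integrable_neg:
  fixes \<kappa> :: real
  assumes \<kappa>: "0 < \<kappa>"
  shows "integrable half_line (\<lambda>Z. exp (\<kappa> * Z))"
proof -
  have "set_integrable lborel (einterval (-\<infinity>) 0) (\<lambda>Z. exp (\<kappa> * Z))"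
  proof (rule interval_integral_FTC_nonneg(1)[where F = "\<lambda>Z. exp (\<kappa> * Z) / \<kappa>" and A = 0 and B = "1 / \<kappa>"])
    show "((\<lambda>Z. exp (\<kappa> * Z) / \<kappa>) has_real_derivative exp (\<kappa> * x)) (at x)" for x
      using \<kappa> by (auto intro!: derivative_eq_intros)
    show "isCont (\<lambda>Z. exp (\<kappa> * Z)) x" for x by simp
    have "((\<lambda>Z. exp (\<kappa> * Z) / \<kappa>) \<longlongrightarrow> 0) at_bot"
    proof -
      have "filterlim (\<lambda>Z. \<kappa> * Z) at_bot at_bot"
        using \<kappa> by (rule filterlim_tendsto_pos_mult_at_bot[OF tendsto_const]) (rule filterlim_ident)
      then have "((\<lambda>Z. exp (\<kappa> * Z)) \<longlongrightarrow> 0) at_bot" by (rule filterlim_compose[OF exp_at_bot])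
      from tendsto_divide[OF this tendsto_const[of \<kappa>]] show ?thesis using \<kappa> by simp
    qed
    then show "(((\<lambda>Z. exp (\<kappa> * Z) / \<kappa>) \<circ> real_of_ereal) \<longlongrightarrow> 0) (at_right (-\<infinity>))"
      by (simp add: ereal_tendsto_simps)
    have "((\<lambda>Z. exp (\<kappa> * Z) / \<kappa>) \<longlongrightarrow> exp (\<kappa> * 0) / \<kappa>) (at_left 0)"
      using \<kappa> by (intro tendsto_intros) auto
    then show "(((\<lambda>Z. exp (\<kappa> * Z) / \<kappa>) \<circ> real_of_ereal) \<longlongrightarrow> 1 / \<kappa>) (at_left 0)"
      by (simp add: zero_ereal_def ereal_tendsto_simps)
  qed auto
  moreover have "einterval (-\<infinity>) 0 = {..<0}" by (auto simp: einterval_def)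
  ultimately have "set_integrable lborel {..<0} (\<lambda>Z. exp (\<kappa> * Z))" by simp
  then have "(\<lambda>Z. exp (\<kappa> * Z)) absolutely_integrable_on {..<0}"
    unfolding set_integrable_def by (simp add: integrable_completion)
  then have "(\<lambda>Z. exp (\<kappa> * Z)) absolutely_integrable_on {..0}"
    by (rule absolutely_integrable_spike_set) (rule negligible_subset[of "{0}"], auto)+
  then show ?thesis by (simp add: set_integrable_def integrable_restrict_space)
qed

lemma L2_neg_if_exponential_decay:
  assumes f: "continuous_on {..0} f" and \<kappa>: "0 < \<kappa>"
    and b: "\<And>Z. Z \<le> 0 \<Longrightarrow> cmod (f Z) \<le> C * exp (\<kappa> * Z)"
  shows "f \<in> L2_neg"
proof -
  have m: "f \<in> borel_measurable half_line"
    by (rule continuous_imp_measurable_on_sets_lebesgue[OF f]) auto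
  have "integrable half_line (\<lambda>Z. (cmod (f Z))\<^sup>2)"
  proof (rule Bochner_Integration.integrable_bound)
    show "integrable half_line (\<lambda>Z. C\<^sup>2 * exp (2 * \<kappa> * Z))"
      using exp_integrable_neg[of "2 * \<kappa>"] \<kappa> by simp
    show "(\<lambda>Z. (cmod (f Z))\<^sup>2) \<in> borel_measurable half_line" using m by measurable
    show "AE Z in half_line. norm ((cmod (f Z))\<^sup>2) \<le> norm (C\<^sup>2 * exp (2 * \<kappa> * Z))"
    proof (rule AE_I2)
      fix Z :: real assume "Z \<in> space half_line"
      then have "(cmod (f Z))\<^sup>2 \<le> (C * exp (\<kappa> * Z))\<^sup>2" by (intro power_mono b) auto
      also have "\<dots> = C\<^sup>2 * exp (2 * \<kappa> * Z)"
        by (simp add: power_mult_distrib exp_double[symmetric] mult.assoc)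
      finally show "norm ((cmod (f Z))\<^sup>2) \<le> norm (C\<^sup>2 * exp (2 * \<kappa> * Z))" by simp
    qed
  qed
  then show ?thesis using m by (simp add: L2_neg_def)
qed

context layered_profile
begin

text \<open>Elliptic regularity, one order at a time. The Neumann condition supplies a continuous weak
  derivative \<open>w\<close>, so \<open>v\<close> is almost everywhere a differentiable function \<open>V\<close>. The product rule shows that
  \<open>m w\<close> has a weak derivative, and the eigenvalue equation identifies it with a continuous function, so
  \<open>m w\<close> is differentiable too.\<close>

lemma love_eigenfunction_classical:
  assumes \<mu>: "mu x = m" and k: "k = norm \<xi>"
    and v: "v \<in> love_domain" and nz: "\<not> (AE Z in half_line. v Z = 0)"
    and eq: "AE Z in half_line. love_operator mu x \<xi> v Z = of_real (\<nu> * k\<^sup>2) * v Z"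
  shows "\<exists>V Q. (\<forall>Z\<le>0. (V has_vector_derivative Q Z / of_real (m Z)) (at Z within {..0})) \<and>
    (\<forall>Z\<le>0. (Q has_vector_derivative of_real (k\<^sup>2 * (m Z - \<nu>)) * V Z) (at Z within {..0})) \<and>
    Q 0 = 0 \<and> (\<exists>Z0\<le>0. V Z0 \<noteq> 0) \<and> integrable half_line (\<lambda>Z. (cmod (V Z))\<^sup>2)"
proof -
  obtain w where w: "has_weak_deriv v w" "continuous_on {..0} w" "w 0 = 0"
    using v by (auto simp: love_domain_def neumann_at_0_def)
  obtain v1 v2 where v12: "has_weak_deriv v v1" "has_weak_deriv v1 v2" and vL: "v \<in> L2_neg"
    using v by (auto simp: love_domain_def H2_neg_def)
  obtain V where V: "\<And>Z. Z \<le> 0 \<Longrightarrow> (V has_vector_derivative w Z) (at Z within {..0})"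
    and vV: "AE Z in half_line. v Z = V Z"
    using has_weak_deriv_continuous_imp_classical[OF w(1,2)] by blast
  have cV: "continuous_on {..0} V"
    using V by (auto simp: continuous_on_eq_continuous_within intro: has_vector_derivative_continuous)
  define p where "p = (\<lambda>Y. of_real (m Y) * weak_deriv v Y)"
  have pAE: "AE Z in half_line. v1 Z * of_real (m Z) = p Z"
    using weak_deriv_AE_eq[OF v12(1)] by eventually_elim (simp add: p_def)
  have "has_weak_deriv (\<lambda>Z. v1 Z * of_real (m Z)) (\<lambda>Z. v1 Z * of_real (m' Z) + v2 Z * of_real (m Z))"
    by (rule has_weak_deriv_smooth_mult[OF v12(2) smooth_m m_deriv m'_cont])
  then have "has_weak_deriv p (\<lambda>Z. v1 Z * of_real (m' Z) + v2 Z * of_real (m Z))"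
    by (rule has_weak_deriv_cong_AE[OF _ pAE]) simp
  then have dp: "has_weak_deriv p (weak_deriv p)" by (rule has_weak_deriv_weak_deriv)
  define g where "g = (\<lambda>Z. of_real (k\<^sup>2 * (m Z - \<nu>)) * V Z)"
  have "AE Z in half_line. weak_deriv p Z = g Z"
    using eq vV
  proof eventually_elim
    case (elim Z)
    then have "- weak_deriv p Z + of_real (m Z * k\<^sup>2) * v Z = of_real (\<nu> * k\<^sup>2) * v Z"
      by (simp add: love_operator_def \<mu> p_def k)
    then have "weak_deriv p Z = of_real (m Z * k\<^sup>2) * v Z - of_real (\<nu> * k\<^sup>2) * v Z"
      by (simp add: algebra_simps)
    then show ?case using elim(2) by (simp add: g_def algebra_simps)
  qed
  moreover have pw: "AE Z in half_line. p Z = of_real (m Z) * w Z"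
    using weak_deriv_AE_eq[OF w(1)] by eventually_elim (simp add: p_def)
  ultimately have dg: "has_weak_deriv (\<lambda>Z. of_real (m Z) * w Z) g"
    by (intro has_weak_deriv_cong_AE[OF dp])
  have cg: "continuous_on {..0} g" unfolding g_def by (intro continuous_intros cV m_cont)
  obtain Q where Q: "\<And>Z. Z \<le> 0 \<Longrightarrow> (Q has_vector_derivative g Z) (at Z within {..0})"
    and mQ: "AE Z in half_line. of_real (m Z) * w Z = Q Z"
    using has_weak_deriv_continuous_imp_classical[OF dg cg] by blast
  have cQ: "continuous_on {..0} Q"
    using Q by (auto simp: continuous_on_eq_continuous_within intro: has_vector_derivative_continuous)
  have Qw: "of_real (m Z) * w Z = Q Z" if "Z \<le> 0" for Z
    by (rule continuous_AE_eq_imp_eq[OF _ cQ mQ that]) (intro continuous_intros m_cont w)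
  have wQ: "w Z = Q Z / of_real (m Z)" if "Z \<le> 0" for Z
    using Qw[OF that] m_pos[OF that] by (simp add: field_simps)
  have Vnz: "\<exists>Z0\<le>0. V Z0 \<noteq> 0"
  proof (rule ccontr)
    assume "\<not> (\<exists>Z0\<le>0. V Z0 \<noteq> 0)"
    then have V0: "\<And>Z. Z \<le> 0 \<Longrightarrow> V Z = 0" by auto
    have sp: "AE Z in half_line. Z \<le> (0::real)" by (rule AE_I2) simp
    from vV sp have "AE Z in half_line. v Z = 0" by eventually_elim (simp add: V0)
    then show False using nz by contradiction
  qed
  have Vint: "integrable half_line (\<lambda>Z. (cmod (V Z))\<^sup>2)"
  proof -
    have "integrable half_line (\<lambda>Z. (cmod (v Z))\<^sup>2)" using vL by (simp add: L2_neg_def)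
    moreover have "V \<in> borel_measurable half_line"
      by (rule continuous_imp_measurable_on_sets_lebesgue[OF cV]) auto
    then have "(\<lambda>Z. (cmod (V Z))\<^sup>2) \<in> borel_measurable half_line" by measurable
    moreover have "AE Z in half_line. (cmod (v Z))\<^sup>2 = (cmod (V Z))\<^sup>2"
      using vV by eventually_elim simp
    ultimately show ?thesis by (rule integrable_cong_AE_imp)
  qed
  have Q0: "Q 0 = 0" using Qw[of 0] w(3) by simp
  show ?thesis
  proof (rule exI[of _ V], rule exI[of _ Q], intro conjI allI impI)
    fix Z :: real assume Z: "Z \<le> 0"
    show "(V has_vector_derivative Q Z / of_real (m Z)) (at Z within {..0})"
      using V[OF Z] unfolding wQ[OF Z] .
    show "(Q has_vector_derivative of_real (k\<^sup>2 * (m Z - \<nu>)) * V Z) (at Z within {..0})"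
      using Q[OF Z] unfolding g_def .
  qed (rule Q0 Vnz Vint)+
qed

text \<open>Eigenfunctions are complex valued; the real or the imaginary part is a real one.\<close>

lemma love_eigenvalue_imp_angle:
  assumes \<mu>: "mu x = m" and k: "k = norm \<xi>" "0 < k" and \<nu>: "\<nu> < m ZI"
    and p: "pruefer k \<nu> \<theta>" and ev: "love_eigenvalue mu x \<xi> (\<nu> * k\<^sup>2)"
  shows "sin (\<theta> 0) = 0"
proof -
  obtain v where v: "v \<in> love_domain" "\<not> (AE Z in half_line. v Z = 0)"
    "AE Z in half_line. love_operator mu x \<xi> v Z = of_real (\<nu> * k\<^sup>2) * v Z"
    using ev unfolding love_eigenvalue_def by blast
  obtain V Q where V: "\<And>Z. Z \<le> 0 \<Longrightarrow> (V has_vector_derivative Q Z / of_real (m Z)) (at Z within {..0})"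
    and Q: "\<And>Z. Z \<le> 0 \<Longrightarrow> (Q has_vector_derivative of_real (k\<^sup>2 * (m Z - \<nu>)) * V Z) (at Z within {..0})"
    and Q0: "Q 0 = 0" and nz: "\<exists>Z0\<le>0. V Z0 \<noteq> 0"
    and int: "integrable half_line (\<lambda>Z. (cmod (V Z))\<^sup>2)"
    using love_eigenfunction_classical[OF \<mu> k(1) v] by blast
  obtain Z0 where Z0: "Z0 \<le> 0" "V Z0 \<noteq> 0" using nz by blast
  have cV: "continuous_on {..0} V"
    using V by (auto simp: continuous_on_eq_continuous_within intro: has_vector_derivative_continuous)
  have part: "sin (\<theta> 0) = 0" if R: "bounded_linear R" and Rr: "\<And>a z. R (of_real a * z) = a * R z"
    and Rc: "\<And>z. \<bar>R z\<bar> \<le> cmod z" and Rz: "R (V Z0) \<noteq> 0" for R :: "complex \<Rightarrow> real"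
  proof (rule classical_eigenfunction_imp_angle[OF p k(2) \<nu>, where u = "\<lambda>Z. R (V Z)" and q = "\<lambda>Z. R (Q Z)"])
    show "solves k \<nu> (\<lambda>Z. R (V Z)) (\<lambda>Z. R (Q Z))" unfolding solves_def
    proof (intro allI impI conjI)
      fix Z :: real assume Z: "Z \<le> 0"
      have "R (Q Z / of_real (m Z)) = R (Q Z) / m Z"
        using Rr[of "1 / m Z" "Q Z"] by simp
      then show "((\<lambda>Z. R (V Z)) has_real_derivative R (Q Z) / m Z) (at Z within {..0})"
        using bounded_linear.has_vector_derivative[OF R V[OF Z]]
        by (simp add: has_real_derivative_iff_has_vector_derivative)
      show "((\<lambda>Z. R (Q Z)) has_real_derivative k\<^sup>2 * (m Z - \<nu>) * R (V Z)) (at Z within {..0})"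
        using bounded_linear.has_vector_derivative[OF R Q[OF Z]]
        unfolding Rr has_real_derivative_iff_has_vector_derivative .
    qed
  next
    show "integrable half_line (\<lambda>Z. (R (V Z))\<^sup>2)"
    proof (rule Bochner_Integration.integrable_bound[OF int])
      have "continuous_on {..0} (\<lambda>Z. (R (V Z))\<^sup>2)"
        by (intro continuous_intros bounded_linear.continuous_on[OF R] cV)
      then show "(\<lambda>Z. (R (V Z))\<^sup>2) \<in> borel_measurable half_line"
        by (rule continuous_imp_measurable_on_sets_lebesgue) auto
      have "\<bar>R (V Z)\<bar>\<^sup>2 \<le> (cmod (V Z))\<^sup>2" for Z by (intro power_mono Rc) auto
      then show "AE Z in half_line. norm ((R (V Z))\<^sup>2) \<le> norm ((cmod (V Z))\<^sup>2)" by (intro AE_I2) simp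
    qed
    show "R (Q 0) = 0" using Q0 R by (simp add: linear_simps)
  qed (use Z0 Rz in auto)
  show ?thesis
  proof (cases "Re (V Z0) = 0")
    case True
    then have "Im (V Z0) \<noteq> 0" using Z0 by (simp add: complex_eq_iff)
    then show ?thesis by (intro part[of Im] bounded_linear_Im abs_Im_le_cmod) auto
  next
    case False
    then show ?thesis by (intro part[of Re] bounded_linear_Re abs_Re_le_cmod) auto
  qed
qed

lemma m'_bounded: "\<exists>M\<ge>0. \<forall>Z\<le>0. \<bar>m' Z\<bar> \<le> M"
proof -
  have c: "continuous_on {ZI..0} m'" by (rule continuous_on_subset[OF m'_cont]) auto
  then have "bounded (m' ` {ZI..0})" by (intro compact_imp_bounded compact_continuous_image) auto
  then obtain M where "\<forall>Z\<in>{ZI..0}. \<bar>m' Z\<bar> \<le> M" unfolding bounded_iff by auto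
  then have M: "\<And>Z. Z \<in> {ZI..0} \<Longrightarrow> \<bar>m' Z\<bar> \<le> M" by blast
  have M0: "M \<ge> 0" using M[of 0] ZI_neg by auto
  have "m' Z = 0" if "Z < ZI" for Z
  proof -
    have "(m has_real_derivative m' Z) (at Z)"
      using m_deriv[of Z] that ZI_neg by (simp add: at_within_atMost_neg)
    moreover have "(m has_real_derivative 0) (at Z)"
    proof (rule has_field_derivative_transform_within_open[where f = "\<lambda>_. m ZI" and S = "{..<ZI}"])
      show "m ZI = m x" if "x \<in> {..<ZI}" for x using m_const[of x] that by simp
    qed (use that in auto)
    ultimately show ?thesis by (rule DERIV_unique)
  qed
  then have "\<bar>m' Z\<bar> \<le> M" if "Z \<le> 0" for Z using M[of Z] M0 that by (cases "Z < ZI") auto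
  then show ?thesis using M0 by blast
qed

text \<open>The amplitude solves \<open>r' = \<rho> r\<close>. Since \<open>\<rho>\<close> equals the positive constant \<open>\<kappa>\<close> below \<open>ZI\<close>, splitting off
  \<open>exp (\<kappa> Z)\<close> leaves a bounded factor.\<close>

lemma pruefer_amplitude:
  assumes p: "pruefer k \<nu> \<theta>" and k: "0 < k" and \<nu>: "\<nu> < m ZI"
  shows "\<exists>r \<kappa> C. 0 < \<kappa> \<and> (\<forall>Z\<le>0. 0 < r Z \<and> r Z \<le> C * exp (\<kappa> * Z) \<and>
    (r has_real_derivative k * sin (\<theta> Z) * cos (\<theta> Z) * (m Z - \<nu> + 1 / m Z) * r Z) (at Z within {..0}))"
proof -
  define \<rho> where "\<rho> = (\<lambda>Z. k * sin (\<theta> Z) * cos (\<theta> Z) * (m Z - \<nu> + 1 / m Z))"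
  define \<kappa> where "\<kappa> = \<rho> ZI"
  have thI: "\<theta> Z = init_angle \<nu>" if "Z \<le> ZI" for Z using p that by (simp add: pruefer_def)
  have \<rho>I: "\<rho> Z = \<kappa>" if "Z \<le> ZI" for Z
    using thI[OF that] thI[of ZI] m_const[OF that] by (simp add: \<rho>_def \<kappa>_def)
  have \<kappa>: "0 < \<kappa>"
  proof -
    have "0 < init_angle \<nu>" "init_angle \<nu> < pi / 2" by (rule init_angle_bounds[OF \<nu>])+
    then have "0 < sin (init_angle \<nu>)" "0 < cos (init_angle \<nu>)" by (auto intro: sin_gt_zero cos_gt_zero)
    moreover have "0 < m ZI - \<nu> + 1 / m ZI" using \<nu> m_pos[of ZI] ZI_neg by (simp add: add_pos_pos)
    ultimately show ?thesis using k thI[of ZI] by (simp add: \<kappa>_def \<rho>_def)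
  qed
  have c\<rho>: "continuous_on {..0} (\<lambda>Z. \<rho> Z - \<kappa>)" unfolding \<rho>_def
    by (intro continuous_intros m_cont pruefer_cont[OF p]) (use m_pos in force)
  \<comment> \<open>\<open>S\<close> is constant below \<open>ZI\<close>, hence bounded.\<close>
  define S where "S = (\<lambda>Z. - integral {Z..0} (\<lambda>Z. \<rho> Z - \<kappa>))"
  have dS: "(S has_real_derivative \<rho> Z - \<kappa>) (at Z within {..0})" if "Z \<le> 0" for Z
    unfolding S_def has_real_derivative_iff_has_vector_derivative by (rule antiderivative_on_neg[OF c\<rho> that])
  have cS: "continuous_on {..0} S" by (rule DERIV_continuous_on) (rule dS, simp)
  have SI: "S Z = S ZI" if "Z \<le> ZI" for Z
  proof -
    have i: "(\<lambda>Z. \<rho> Z - \<kappa>) integrable_on {Z..0}"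
      by (rule integrable_continuous_real) (rule continuous_on_subset[OF c\<rho>], auto)
    have "integral {Z..ZI} (\<lambda>Z. \<rho> Z - \<kappa>) = 0" using \<rho>I by (intro integral_unique has_integral_is_0) auto
    moreover have "integral {Z..ZI} (\<lambda>Z. \<rho> Z - \<kappa>) + integral {ZI..0} (\<lambda>Z. \<rho> Z - \<kappa>) = integral {Z..0} (\<lambda>Z. \<rho> Z - \<kappa>)"
      using that ZI_neg by (intro Henstock_Kurzweil_Integration.integral_combine i) auto
    ultimately show ?thesis by (simp add: S_def)
  qed
  obtain b where "\<forall>Z\<in>{ZI..0}. S Z \<le> S b"
    using continuous_attains_sup[OF compact_Icc _ continuous_on_subset[OF cS], of ZI 0] ZI_neg by auto
  then have b: "\<And>Z. Z \<in> {ZI..0} \<Longrightarrow> S Z \<le> S b" by blast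
  have Sb: "S Z \<le> S b" if "Z \<le> 0" for Z
  proof (cases "Z \<le> ZI")
    case True
    have "S ZI \<le> S b" by (rule b) (use ZI_neg in simp)
    then show ?thesis using SI[OF True] by linarith
  next
    case False
    show ?thesis by (rule b) (use False that in simp)
  qed
  define r where "r = (\<lambda>Z. exp (\<kappa> * Z + S Z))"
  have rb: "r Z \<le> exp (S b) * exp (\<kappa> * Z)" if "Z \<le> 0" for Z
    using Sb[OF that] by (simp add: r_def flip: exp_add)
  have dr: "(r has_real_derivative \<rho> Z * r Z) (at Z within {..0})" if "Z \<le> 0" for Z
    unfolding r_def by (auto intro!: derivative_eq_intros dS[OF that])
  show ?thesis
  proof (rule exI[of _ r], rule exI[of _ \<kappa>], rule exI[of _ "exp (S b)"], intro conjI allI impI \<kappa>)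
    fix Z :: real assume Z: "Z \<le> 0"
    show "0 < r Z" by (simp add: r_def)
    show "r Z \<le> exp (S b) * exp (\<kappa> * Z)" by (rule rb[OF Z])
    show "(r has_real_derivative k * sin (\<theta> Z) * cos (\<theta> Z) * (m Z - \<nu> + 1 / m Z) * r Z) (at Z within {..0})"
      using dr[OF Z] unfolding \<rho>_def .
  qed
qed

lemma pruefer_solves:
  assumes p: "pruefer k \<nu> \<theta>"
    and dr: "\<And>Z. Z \<le> 0 \<Longrightarrow> (r has_real_derivative k * sin (\<theta> Z) * cos (\<theta> Z) * (m Z - \<nu> + 1 / m Z) * r Z) (at Z within {..0})"
  shows "solves k \<nu> (\<lambda>Z. r Z * cos (\<theta> Z)) (\<lambda>Z. k * r Z * sin (\<theta> Z))"
proof -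
  define u where "u = (\<lambda>Z. r Z * cos (\<theta> Z))"
  define q where "q = (\<lambda>Z. k * r Z * sin (\<theta> Z))"
  define u1 where "u1 = (\<lambda>Z. q Z / m Z)"
  define q1 where "q1 = (\<lambda>Z. k\<^sup>2 * (m Z - \<nu>) * u Z)"
  have dth: "(\<theta> has_real_derivative k * rate \<nu> Z (\<theta> Z)) (at Z within {..0})" if "Z \<le> 0" for Z
    using p that by (simp add: pruefer_def)
  have du: "(u has_real_derivative u1 Z) (at Z within {..0})"
    and dq: "(q has_real_derivative q1 Z) (at Z within {..0})" if Z: "Z \<le> 0" for Z
  proof -
    define s c a b where "s = sin (\<theta> Z)" and "c = cos (\<theta> Z)" and "a = m Z - \<nu>" and "b = 1 / m Z"
    have cs: "s\<^sup>2 = 1 - c\<^sup>2" unfolding s_def c_def by (rule sin_squared_eq)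
    have th': "rate \<nu> Z (\<theta> Z) = a * c\<^sup>2 - b * s\<^sup>2" by (simp add: rate_def s_def c_def a_def b_def)
    have "(u has_real_derivative (k * s * c * (a + b) * r Z) * c + r Z * (- s * (k * rate \<nu> Z (\<theta> Z)))) (at Z within {..0})"
      unfolding u_def s_def c_def a_def b_def by (auto intro!: derivative_eq_intros dr[OF Z] dth[OF Z])
    moreover have "(k * s * c * (a + b) * r Z) * c + r Z * (- s * (k * rate \<nu> Z (\<theta> Z))) = u1 Z"
    proof -
      have "(k * s * c * (a + b) * r Z) * c + r Z * (- s * (k * rate \<nu> Z (\<theta> Z))) = k * s * b * r Z * (c\<^sup>2 + s\<^sup>2)"
        unfolding th' by (simp add: power2_eq_square algebra_simps)
      also have "c\<^sup>2 + s\<^sup>2 = 1" by (simp add: cs)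
      finally show ?thesis by (simp add: u1_def q_def b_def s_def)
    qed
    ultimately show "(u has_real_derivative u1 Z) (at Z within {..0})" by simp
    have "(q has_real_derivative k * (k * s * c * (a + b) * r Z) * s + k * r Z * (c * (k * rate \<nu> Z (\<theta> Z)))) (at Z within {..0})"
      unfolding q_def s_def c_def a_def b_def by (auto intro!: derivative_eq_intros dr[OF Z] dth[OF Z])
    moreover have "k * (k * s * c * (a + b) * r Z) * s + k * r Z * (c * (k * rate \<nu> Z (\<theta> Z))) = q1 Z"
    proof -
      have "k * (k * s * c * (a + b) * r Z) * s + k * r Z * (c * (k * rate \<nu> Z (\<theta> Z))) = k\<^sup>2 * c * a * r Z * (c\<^sup>2 + s\<^sup>2)"
        unfolding th' by (simp add: power2_eq_square algebra_simps)
      also have "c\<^sup>2 + s\<^sup>2 = 1" by (simp add: cs)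
      finally show ?thesis by (simp add: q1_def u_def a_def c_def)
    qed
    ultimately show "(q has_real_derivative q1 Z) (at Z within {..0})" by simp
  qed
  then show ?thesis unfolding solves_def u1_def q1_def u_def q_def by blast
qed

text \<open>The first two derivatives are expressed through \<open>u\<close>, \<open>q\<close> and the bounded coefficients \<open>m\<close> and \<open>m'\<close>,
  so they decay exponentially as well and the solution belongs to the domain of the operator.\<close>

lemma decaying_solution_imp_love_eigenvalue:
  assumes \<mu>: "mu x = m" and k: "k = norm \<xi>" and sol: "solves k \<nu> u q" and \<kappa>: "0 < \<kappa>"
    and bu: "\<And>Z. Z \<le> 0 \<Longrightarrow> \<bar>u Z\<bar> \<le> C * exp (\<kappa> * Z)" and bq: "\<And>Z. Z \<le> 0 \<Longrightarrow> \<bar>q Z\<bar> \<le> C * exp (\<kappa> * Z)"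
    and q0: "q 0 = 0" and u0: "u 0 \<noteq> 0"
  shows "love_eigenvalue mu x \<xi> (\<nu> * k\<^sup>2)"
proof -
  define u1 where "u1 = (\<lambda>Z. q Z / m Z)"
  define q1 where "q1 = (\<lambda>Z. k\<^sup>2 * (m Z - \<nu>) * u Z)"
  define u2 where "u2 = (\<lambda>Z. (q1 Z - m' Z * u1 Z) / m Z)"
  note cu = solvesD(3)[OF sol] and cq = solvesD(4)[OF sol]
  have du: "(u has_real_derivative u1 Z) (at Z within {..0})"
    and dq: "(q has_real_derivative q1 Z) (at Z within {..0})" if "Z \<le> 0" for Z
    using solvesD(1,2)[OF sol that] by (simp_all add: u1_def q1_def)
  have du1: "(u1 has_real_derivative u2 Z) (at Z within {..0})" if Z: "Z \<le> 0" for Z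
  proof -
    have mz: "m Z \<noteq> 0" using m_pos[OF Z] by simp
    have "(u1 has_real_derivative (q1 Z * m Z - q Z * m' Z) / (m Z * m Z)) (at Z within {..0})"
      unfolding u1_def using DERIV_divide[OF dq[OF Z] m_deriv[OF Z] mz] by simp
    moreover have "(q1 Z * m Z - q Z * m' Z) / (m Z * m Z) = u2 Z"
      using mz by (simp add: u2_def u1_def field_simps)
    ultimately show ?thesis by simp
  qed
  have mnz: "\<forall>Z\<in>{..0}. m Z \<noteq> 0" using m_pos by force
  have cu1: "continuous_on {..0} u1" by (rule DERIV_continuous_on) (rule du1, simp)
  have cq1: "continuous_on {..0} q1" unfolding q1_def by (intro continuous_intros cu m_cont)
  have cu2: "continuous_on {..0} u2" unfolding u2_def by (intro continuous_intros cu1 cq1 m_cont m'_cont mnz)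
  obtain lo hi where lh: "0 < lo" "\<And>Z. Z \<le> 0 \<Longrightarrow> lo \<le> m Z" "\<And>Z. Z \<le> 0 \<Longrightarrow> m Z \<le> hi"
    using m_bounds by auto
  obtain M where M: "0 \<le> M" "\<And>Z. Z \<le> 0 \<Longrightarrow> \<bar>m' Z\<bar> \<le> M" using m'_bounded by blast
  define \<rho> where "\<rho> = (\<lambda>Z. C * exp (\<kappa> * Z))"
  have bdiv: "\<bar>y / m Z\<bar> \<le> c / lo * \<rho> Z" if "\<bar>y\<bar> \<le> c * \<rho> Z" "Z \<le> 0" for y c Z
  proof -
    have "\<bar>y / m Z\<bar> \<le> \<bar>y\<bar> / lo" using lh(1) lh(2)[OF that(2)] by (simp add: abs_divide frac_le)
    also have "\<dots> \<le> c * \<rho> Z / lo" using that(1) lh(1) by (intro divide_right_mono) auto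
    finally show ?thesis by simp
  qed
  have bu1: "\<bar>u1 Z\<bar> \<le> 1 / lo * \<rho> Z" if "Z \<le> 0" for Z
    unfolding u1_def by (rule bdiv[OF _ that]) (use bq[OF that] in \<open>simp add: \<rho>_def\<close>)
  define D where "D = k\<^sup>2 * (hi + \<bar>\<nu>\<bar>) + M * (1 / lo)"
  have bu2: "\<bar>u2 Z\<bar> \<le> D / lo * \<rho> Z" if Z: "Z \<le> 0" for Z
    unfolding u2_def
  proof (rule bdiv[OF _ Z])
    have "\<bar>m Z - \<nu>\<bar> \<le> hi + \<bar>\<nu>\<bar>" using lh(3)[OF Z] m_pos[OF Z] by linarith
    then have "\<bar>q1 Z\<bar> \<le> k\<^sup>2 * (hi + \<bar>\<nu>\<bar>) * \<rho> Z"
      unfolding q1_def abs_mult \<rho>_def using bu[OF Z] by (intro mult_mono) auto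
    moreover have "\<bar>m' Z * u1 Z\<bar> \<le> M * (1 / lo * \<rho> Z)"
      unfolding abs_mult using bu1[OF Z] M(2)[OF Z] M(1) by (intro mult_mono) auto
    ultimately have "\<bar>q1 Z - m' Z * u1 Z\<bar> \<le> k\<^sup>2 * (hi + \<bar>\<nu>\<bar>) * \<rho> Z + M * (1 / lo * \<rho> Z)" by linarith
    then show "\<bar>q1 Z - m' Z * u1 Z\<bar> \<le> D * \<rho> Z" by (simp add: D_def algebra_simps)
  qed
  have L2: "(\<lambda>Z. complex_of_real (f Z)) \<in> L2_neg"
    if f: "continuous_on {..0} f" and bf: "\<And>Z. Z \<le> 0 \<Longrightarrow> \<bar>f Z\<bar> \<le> c * \<rho> Z" for f c
  proof (rule L2_neg_if_exponential_decay[OF _ \<kappa>, of _ "c * C"])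
    show "continuous_on {..0} (\<lambda>Z. complex_of_real (f Z))" by (intro continuous_intros f)
    show "cmod (complex_of_real (f Z)) \<le> c * C * exp (\<kappa> * Z)" if "Z \<le> 0" for Z
      using bf[OF that] by (simp add: \<rho>_def)
  qed
  have L2u: "(\<lambda>Z. complex_of_real (u Z)) \<in> L2_neg" by (rule L2[OF cu, of 1]) (simp add: \<rho>_def bu)
  have L2u1: "(\<lambda>Z. complex_of_real (u1 Z)) \<in> L2_neg" by (rule L2[OF cu1 bu1])
  have L2u2: "(\<lambda>Z. complex_of_real (u2 Z)) \<in> L2_neg" by (rule L2[OF cu2 bu2])
  have wd: "has_weak_deriv (\<lambda>Z. complex_of_real (f Z)) (\<lambda>Z. complex_of_real (g Z))"
    if "continuous_on {..0} g" "\<And>Z. Z \<le> 0 \<Longrightarrow> (f has_real_derivative g Z) (at Z within {..0})" for f g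
    by (rule has_weak_deriv_classical)
      (use that in \<open>auto intro!: continuous_intros has_vector_derivative_of_real
        simp: has_real_derivative_iff_has_vector_derivative\<close>)
  define v where "v = (\<lambda>Z. complex_of_real (u Z))"
  have v1: "has_weak_deriv v (\<lambda>Z. complex_of_real (u1 Z))" unfolding v_def by (rule wd[OF cu1 du])
  have v2: "has_weak_deriv (\<lambda>Z. complex_of_real (u1 Z)) (\<lambda>Z. complex_of_real (u2 Z))" by (rule wd[OF cu2 du1])
  have "v \<in> H2_neg" unfolding H2_neg_def using L2u L2u1 L2u2 v1 v2 by (auto simp: v_def)
  moreover have "neumann_at_0 v" unfolding neumann_at_0_def
  proof (intro exI conjI)
    show "has_weak_deriv v (\<lambda>Z. complex_of_real (u1 Z))" by (rule v1)
    show "continuous_on {..0} (\<lambda>Z. complex_of_real (u1 Z))" by (intro continuous_intros cu1)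
    show "complex_of_real (u1 0) = 0" using q0 by (simp add: u1_def)
  qed
  ultimately have dom: "v \<in> love_domain" by (simp add: love_domain_def)
  have nz: "\<not> (AE Z in half_line. v Z = 0)"
  proof
    assume ae: "AE Z in half_line. v Z = 0"
    have "v 0 = 0"
      by (rule continuous_AE_eq_imp_eq[OF _ _ ae]) (auto simp: v_def intro!: continuous_intros cu)
    then show False using u0 by (simp add: v_def)
  qed
  have wq: "has_weak_deriv (\<lambda>Z. complex_of_real (q Z)) (\<lambda>Z. complex_of_real (q1 Z))" by (rule wd[OF cq1 dq])
  have "AE Z in half_line. Z \<le> (0::real)" by (rule AE_I2) simp
  with weak_deriv_AE_eq[OF v1]
  have qAE: "AE Z in half_line. complex_of_real (q Z) = of_real (m Z) * weak_deriv v Z"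
  proof eventually_elim
    case (elim Z)
    then show ?case using m_pos[of Z] by (simp add: u1_def)
  qed
  have "has_weak_deriv (\<lambda>Z. of_real (m Z) * weak_deriv v Z) (\<lambda>Z. complex_of_real (q1 Z))"
    by (rule has_weak_deriv_cong_AE[OF wq qAE]) simp
  from weak_deriv_AE_eq[OF this]
  have "AE Z in half_line. love_operator mu x \<xi> v Z = of_real (\<nu> * k\<^sup>2) * v Z"
  proof eventually_elim
    case (elim Z)
    have "love_operator mu x \<xi> v Z = - of_real (q1 Z) + of_real (m Z * k\<^sup>2) * v Z"
      using elim by (simp add: love_operator_def \<mu> k)
    also have "\<dots> = of_real (- q1 Z + m Z * k\<^sup>2 * u Z)" by (simp add: v_def)
    also have "- q1 Z + m Z * k\<^sup>2 * u Z = \<nu> * k\<^sup>2 * u Z" by (simp add: q1_def algebra_simps)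
    finally show ?case by (simp add: v_def)
  qed
  then show ?thesis unfolding love_eigenvalue_def using dom nz by blast
qed

lemma angle_imp_love_eigenvalue:
  assumes \<mu>: "mu x = m" and k: "k = norm \<xi>" "0 < k" and \<nu>: "\<nu> < m ZI"
    and p: "pruefer k \<nu> \<theta>" and s0: "sin (\<theta> 0) = 0"
  shows "love_eigenvalue mu x \<xi> (\<nu> * k\<^sup>2)"
proof -
  obtain r \<kappa> C where \<kappa>: "0 < \<kappa>" and r: "\<And>Z. Z \<le> 0 \<Longrightarrow> 0 < r Z" "\<And>Z. Z \<le> 0 \<Longrightarrow> r Z \<le> C * exp (\<kappa> * Z)"
    and dr: "\<And>Z. Z \<le> 0 \<Longrightarrow> (r has_real_derivative k * sin (\<theta> Z) * cos (\<theta> Z) * (m Z - \<nu> + 1 / m Z) * r Z) (at Z within {..0})"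
    using pruefer_amplitude[OF p k(2) \<nu>] by blast
  have b: "\<bar>c * r Z * x\<bar> \<le> (1 + k) * C * exp (\<kappa> * Z)" if "Z \<le> 0" "\<bar>x\<bar> \<le> 1" "0 \<le> c" "c \<le> 1 + k" for c x Z
  proof -
    have "\<bar>c * r Z * x\<bar> = c * r Z * \<bar>x\<bar>" using r(1)[OF that(1)] that(3) by (simp add: abs_mult)
    also have "\<dots> \<le> (1 + k) * (C * exp (\<kappa> * Z)) * 1"
      using r[OF that(1)] that k(2) by (intro mult_mono) auto
    finally show ?thesis by simp
  qed
  show ?thesis
  proof (rule decaying_solution_imp_love_eigenvalue[where mu = mu, OF \<mu> k(1) pruefer_solves[OF p dr] \<kappa>])
    show "\<bar>r Z * cos (\<theta> Z)\<bar> \<le> (1 + k) * C * exp (\<kappa> * Z)" if "Z \<le> 0" for Z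
      using b[OF that abs_cos_le_one[of "\<theta> Z"], of 1] k(2) by simp
    show "\<bar>k * r Z * sin (\<theta> Z)\<bar> \<le> (1 + k) * C * exp (\<kappa> * Z)" if "Z \<le> 0" for Z
      using b[OF that abs_sin_le_one[of "\<theta> Z"], of k] k(2) by simp
    show "k * r 0 * sin (\<theta> 0) = 0" by (simp add: s0)
    have "cos (\<theta> 0) \<noteq> 0" using s0 sin_cos_squared_add[of "\<theta> 0"] by auto
    then show "r 0 * cos (\<theta> 0) \<noteq> 0" using r(1)[of 0] by simp
  qed
qed

section \<open>Counting eigenvalues\<close>

text \<open>The choice is immaterial: all statements below hold for every solution of the angle equation.\<close>

definition end_angle :: "real \<Rightarrow> real \<Rightarrow> real" where
  "end_angle k \<nu> = (SOME \<theta>. pruefer k \<nu> \<theta>) 0"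

lemma end_angle_pruefer:
  assumes "0 < k" "\<nu> \<le> m ZI"
  obtains \<theta> where "pruefer k \<nu> \<theta>" "end_angle k \<nu> = \<theta> 0"
  using someI_ex[OF pruefer_exists[OF assms]] that unfolding end_angle_def by blast

lemma end_angle_strict_decreasing:
  assumes k: "0 < k" and \<nu>: "\<nu>1 < \<nu>2" "\<nu>2 \<le> m ZI"
  shows "end_angle k \<nu>2 < end_angle k \<nu>1"
proof -
  obtain \<theta>1 where 1: "pruefer k \<nu>1 \<theta>1" "end_angle k \<nu>1 = \<theta>1 0"
    by (rule end_angle_pruefer[OF k, of \<nu>1]) (use \<nu> in auto)
  obtain \<theta>2 where 2: "pruefer k \<nu>2 \<theta>2" "end_angle k \<nu>2 = \<theta>2 0"
    by (rule end_angle_pruefer[OF k \<nu>(2)])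
  show ?thesis using pruefer_comparison[OF k, of "\<bar>\<nu>1\<bar>"] 1 2 \<nu>(1) by auto
qed

lemma end_angle_cont:
  assumes k: "0 < k" and E: "E \<le> m ZI"
  shows "continuous_on {a..E} (end_angle k)"
proof -
  define M where "M = max \<bar>a\<bar> \<bar>E\<bar>"
  obtain C where C: "0 \<le> C" and cmp: "\<And>\<nu>1 \<nu>2 \<theta>1 \<theta>2. \<bar>\<nu>1\<bar> \<le> M \<Longrightarrow> \<nu>1 < \<nu>2 \<Longrightarrow> pruefer k \<nu>1 \<theta>1 \<Longrightarrow> pruefer k \<nu>2 \<theta>2 \<Longrightarrow>
    \<theta>2 0 < \<theta>1 0 \<and> \<theta>1 0 - \<theta>2 0 \<le> C * (init_angle \<nu>1 - init_angle \<nu>2 + (\<nu>2 - \<nu>1))"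
    using pruefer_comparison[OF k, of M] by blast
  have less: "\<bar>end_angle k \<nu>1 - end_angle k \<nu>2\<bar> \<le> C * (\<bar>init_angle \<nu>1 - init_angle \<nu>2\<bar> + \<bar>\<nu>1 - \<nu>2\<bar>)"
    if \<nu>: "\<nu>1 \<in> {a..E}" "\<nu>2 \<in> {a..E}" "\<nu>1 < \<nu>2" for \<nu>1 \<nu>2
  proof -
    obtain \<theta>1 where 1: "pruefer k \<nu>1 \<theta>1" "end_angle k \<nu>1 = \<theta>1 0"
      by (rule end_angle_pruefer[OF k, of \<nu>1]) (use \<nu> E in auto)
    obtain \<theta>2 where 2: "pruefer k \<nu>2 \<theta>2" "end_angle k \<nu>2 = \<theta>2 0"
      by (rule end_angle_pruefer[OF k, of \<nu>2]) (use \<nu> E in auto)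
    have "\<bar>\<nu>1\<bar> \<le> M" using \<nu>(1) by (auto simp: M_def)
    from cmp[OF this \<nu>(3) 1(1) 2(1)]
    have "\<bar>end_angle k \<nu>1 - end_angle k \<nu>2\<bar> \<le> C * (init_angle \<nu>1 - init_angle \<nu>2 + (\<nu>2 - \<nu>1))"
      by (simp add: 1(2) 2(2))
    also have "\<dots> \<le> C * (\<bar>init_angle \<nu>1 - init_angle \<nu>2\<bar> + \<bar>\<nu>1 - \<nu>2\<bar>)"
      using C by (intro mult_left_mono) auto
    finally show ?thesis .
  qed
  have est: "\<bar>end_angle k \<nu>1 - end_angle k \<nu>2\<bar> \<le> C * (\<bar>init_angle \<nu>1 - init_angle \<nu>2\<bar> + \<bar>\<nu>1 - \<nu>2\<bar>)"
    if \<nu>: "\<nu>1 \<in> {a..E}" "\<nu>2 \<in> {a..E}" for \<nu>1 \<nu>2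
  proof -
    consider "\<nu>1 < \<nu>2" | "\<nu>2 < \<nu>1" | "\<nu>1 = \<nu>2" by linarith
    then show ?thesis
    proof cases
      case 1 then show ?thesis by (rule less[OF \<nu>])
    next
      case 2 from less[OF \<nu>(2,1) this] show ?thesis by (simp only: abs_minus_commute)
    next
      case 3 then show ?thesis by simp
    qed
  qed
  have ci: "continuous_on {a..E} init_angle" unfolding init_angle_def by (intro continuous_intros)
  show ?thesis unfolding continuous_on_def
  proof
    fix \<nu> assume \<nu>: "\<nu> \<in> {a..E}"
    have "(init_angle \<longlongrightarrow> init_angle \<nu>) (at \<nu> within {a..E})" using ci \<nu> by (simp add: continuous_on_def)
    then have "((\<lambda>x. C * (\<bar>init_angle x - init_angle \<nu>\<bar> + \<bar>x - \<nu>\<bar>)) \<longlongrightarrow> C * (\<bar>init_angle \<nu> - init_angle \<nu>\<bar> + \<bar>\<nu> - \<nu>\<bar>)) (at \<nu> within {a..E})"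
      by (intro tendsto_intros)
    then have "((\<lambda>x. C * (\<bar>init_angle x - init_angle \<nu>\<bar> + \<bar>x - \<nu>\<bar>)) \<longlongrightarrow> 0) (at \<nu> within {a..E})" by simp
    then have "((\<lambda>x. end_angle k x - end_angle k \<nu>) \<longlongrightarrow> 0) (at \<nu> within {a..E})"
    proof (rule Lim_null_comparison[rotated])
      show "\<forall>\<^sub>F x in at \<nu> within {a..E}. norm (end_angle k x - end_angle k \<nu>) \<le> C * (\<bar>init_angle x - init_angle \<nu>\<bar> + \<bar>x - \<nu>\<bar>)"
        unfolding eventually_at_filter using est[OF _ \<nu>] by (intro always_eventually) auto
    qed
    then show "(end_angle k \<longlongrightarrow> end_angle k \<nu>) (at \<nu> within {a..E})" by (simp add: LIM_zero_iff)
  qed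
qed

text \<open>The final angle is strictly decreasing and continuous in \<open>\<nu>\<close>, so it meets every multiple of \<open>pi\<close>
  between its value at \<open>E\<close> and its supremum exactly once. The supremum lies between \<open>- pi\<close> and
  \<open>3 pi / 2\<close> whatever \<open>k\<close> is, which leaves an error of at most two multiples.\<close>

lemma end_angle_zeros_count:
  assumes k: "0 < k" and E: "E < m ZI"
  defines "S \<equiv> {\<nu>. \<nu> \<le> E \<and> sin (end_angle k \<nu>) = 0}"
  shows "finite S" "\<bar>real (card S) * pi + end_angle k E\<bar> \<le> 2 * pi"
proof -
  define T where "T = end_angle k"
  define a where "a = \<lceil>T E / pi\<rceil>"
  define g where "g = (\<lambda>\<nu>. \<lfloor>T \<nu> / pi\<rfloor>)"
  have gT: "T \<nu> = real_of_int (g \<nu>) * pi" if "\<nu> \<in> S" for \<nu>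
  proof -
    obtain i :: int where "T \<nu> = real_of_int i * pi"
      using \<open>\<nu> \<in> S\<close> unfolding S_def T_def by (auto simp: sin_zero_iff_int2)
    then show ?thesis by (simp add: g_def)
  qed
  have dec: "T \<nu>2 < T \<nu>1" if "\<nu>1 < \<nu>2" "\<nu>2 \<le> E" for \<nu>1 \<nu>2
    unfolding T_def by (rule end_angle_strict_decreasing[OF k that(1)]) (use that E in simp)
  have up: "T \<nu> \<le> 3 * pi / 2" if "\<nu> \<le> E" for \<nu>
  proof -
    have \<nu>: "\<nu> < m ZI" using that E by simp
    obtain \<theta> where "pruefer k \<nu> \<theta>" "end_angle k \<nu> = \<theta> 0" by (rule end_angle_pruefer[OF k less_imp_le[OF \<nu>]])
    then show ?thesis using pruefer_end_le[OF _ k \<nu>] by (simp add: T_def)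
  qed
  have inj: "inj_on g S"
  proof (rule inj_onI)
    fix \<nu>1 \<nu>2 assume \<nu>: "\<nu>1 \<in> S" "\<nu>2 \<in> S" "g \<nu>1 = g \<nu>2"
    then have e: "T \<nu>1 = T \<nu>2" using gT by simp
    have "\<nu>1 \<le> E" "\<nu>2 \<le> E" using \<nu> by (auto simp: S_def)
    then show "\<nu>1 = \<nu>2" using dec[of \<nu>1 \<nu>2] dec[of \<nu>2 \<nu>1] e by (cases \<nu>1 \<nu>2 rule: linorder_cases) auto
  qed
  have sub: "g ` S \<subseteq> {a..1}"
  proof
    fix i assume "i \<in> g ` S"
    then obtain \<nu> where \<nu>: "\<nu> \<in> S" "i = g \<nu>" by auto
    have \<nu>E: "\<nu> \<le> E" using \<nu> by (simp add: S_def)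
    have "T E \<le> T \<nu>" using dec[of \<nu> E] \<nu>E by (cases "\<nu> = E") auto
    then have "T E / pi \<le> real_of_int i" using gT[OF \<nu>(1)] \<nu>(2) by (simp add: pos_divide_le_eq)
    moreover have "real_of_int i * pi \<le> 3 / 2 * pi" using up[OF \<nu>E] gT[OF \<nu>(1)] \<nu>(2) by simp
    then have "real_of_int i \<le> 3 / 2" by (rule mult_right_le_imp_le) simp
    ultimately show "i \<in> {a..1}" by (auto simp: a_def ceiling_le_iff)
  qed
  then have finI: "finite (g ` S)" by (rule finite_subset) simp
  then show "finite S" using inj by (rule finite_imageD)
  obtain lo hi where lh: "0 < lo" "\<And>Z. Z \<le> 0 \<Longrightarrow> lo \<le> m Z" "\<And>Z. Z \<le> 0 \<Longrightarrow> m Z \<le> hi"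
    using m_bounds by auto
  \<comment> \<open>A value below the whole profile, where the final angle is still at least \<open>- pi\<close>.\<close>
  define \<nu>0 where "\<nu>0 = min E lo"
  have \<nu>0: "\<nu>0 \<le> E" "\<nu>0 < m ZI" using E by (auto simp: \<nu>0_def)
  have T0: "- pi \<le> T \<nu>0"
  proof -
    obtain \<theta> where \<theta>: "pruefer k \<nu>0 \<theta>" "end_angle k \<nu>0 = \<theta> 0" by (rule end_angle_pruefer[OF k less_imp_le[OF \<nu>0(2)]])
    have "- pi \<le> \<theta> 0"
      by (rule pruefer_end_ge[OF \<theta>(1) k \<nu>0(2)]) (use lh(2) in \<open>force simp: \<nu>0_def\<close>)
    then show ?thesis using \<theta>(2) by (simp add: T_def)
  qed
  have sup: "{a..-1} \<subseteq> g ` S"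
  proof
    fix i assume i: "i \<in> {a..-1}"
    have "T E / pi \<le> real_of_int i" using i by (simp add: a_def ceiling_le_iff)
    then have 1: "T E \<le> real_of_int i * pi" by (simp add: pos_divide_le_eq)
    have "real_of_int i * pi \<le> (- 1) * pi" using i by (intro mult_right_mono) auto
    then have 2: "real_of_int i * pi \<le> T \<nu>0" using T0 by simp
    have "\<exists>\<nu>. \<nu>0 \<le> \<nu> \<and> \<nu> \<le> E \<and> T \<nu> = real_of_int i * pi"
      by (rule IVT2'[OF 1 2 \<nu>0(1)]) (use end_angle_cont[OF k less_imp_le[OF E]] in \<open>simp add: T_def\<close>)
    then obtain \<nu> where \<nu>: "\<nu> \<le> E" "T \<nu> = real_of_int i * pi" by blast
    have "\<nu> \<in> S" using \<nu> by (auto simp: S_def sin_zero_iff_int2 T_def[symmetric])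
    moreover have "g \<nu> = i" using \<nu>(2) by (simp add: g_def)
    ultimately show "i \<in> g ` S" by blast
  qed
  have c: "card S = card (g ` S)" by (rule card_image[OF inj, symmetric])
  have "card {a..-1} \<le> card S" unfolding c by (rule card_mono[OF finI sup])
  moreover have "card S \<le> card {a..1}" unfolding c by (rule card_mono[OF _ sub]) simp
  ultimately have cb: "nat (- a) \<le> card S" "card S \<le> nat (2 - a)" by auto
  have "a \<le> 2"
  proof -
    have "T E \<le> 2 * pi" using up[of E] pi_gt_zero by linarith
    then show ?thesis by (simp add: a_def ceiling_le_iff pos_divide_le_eq)
  qed
  then have r: "- real_of_int a \<le> real (card S)" "real (card S) \<le> 2 - real_of_int a" using cb by linarith+
  have "T E / pi \<le> real_of_int a" "real_of_int a < T E / pi + 1" unfolding a_def by linarith+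
  then have "\<bar>real (card S) + T E / pi\<bar> \<le> 2" using r by linarith
  then have "\<bar>real (card S) + T E / pi\<bar> * pi \<le> 2 * pi" by (rule mult_right_mono) simp
  moreover have "\<bar>real (card S) + T E / pi\<bar> * pi = \<bar>(real (card S) + T E / pi) * pi\<bar>"
    by (simp add: abs_mult)
  moreover have "(real (card S) + T E / pi) * pi = real (card S) * pi + end_angle k E"
    by (simp add: T_def distrib_right)
  ultimately show "\<bar>real (card S) * pi + end_angle k E\<bar> \<le> 2 * pi" by (simp only:)
qed

text \<open>The Neumann condition at the surface says that the traction \<open>r sin \<theta>\<close> vanishes there.\<close>

lemma love_eigenvalue_iff:
  assumes \<mu>: "mu x = m" and k: "k = norm \<xi>" "0 < k" and \<nu>: "\<nu> < m ZI"
  shows "love_eigenvalue mu x \<xi> (\<nu> * k\<^sup>2) \<longleftrightarrow> sin (end_angle k \<nu>) = 0"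
proof -
  obtain \<theta> where \<theta>: "pruefer k \<nu> \<theta>" "end_angle k \<nu> = \<theta> 0" by (rule end_angle_pruefer[OF k(2) less_imp_le[OF \<nu>]])
  show ?thesis unfolding \<theta>(2)
    using love_eigenvalue_imp_angle[where mu = mu, OF \<mu> k \<nu> \<theta>(1)]
      angle_imp_love_eigenvalue[where mu = mu, OF \<mu> k \<nu> \<theta>(1)] by blast
qed

lemma love_count_bound:
  assumes \<mu>: "mu x = m" and \<xi>: "\<xi> \<noteq> 0" and E: "E < m ZI"
  shows "finite (love_eigenvalues_upto mu x \<xi> E)"
    "\<bar>real (love_count mu x \<xi> E) * pi + end_angle (norm \<xi>) E\<bar> \<le> 2 * pi"
proof -
  define k where "k = norm \<xi>"
  have k: "0 < k" using \<xi> by (simp add: k_def)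
  define S where "S = {\<nu>. \<nu> \<le> E \<and> sin (end_angle k \<nu>) = 0}"
  have eq: "love_eigenvalues_upto mu x \<xi> E = (\<lambda>\<nu>. \<nu> * k\<^sup>2) ` S"
  proof (intro equalityI subsetI)
    fix \<Lambda> assume "\<Lambda> \<in> love_eigenvalues_upto mu x \<xi> E"
    then have \<Lambda>: "love_eigenvalue mu x \<xi> \<Lambda>" "\<Lambda> \<le> E * k\<^sup>2" by (auto simp: love_eigenvalues_upto_def k_def)
    define \<nu> where "\<nu> = \<Lambda> / k\<^sup>2"
    have e: "\<Lambda> = \<nu> * k\<^sup>2" using k by (simp add: \<nu>_def)
    have "\<nu> \<le> E" using \<Lambda>(2) k by (simp add: \<nu>_def pos_divide_le_eq)
    moreover have "sin (end_angle k \<nu>) = 0"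
      using love_eigenvalue_iff[where mu = mu, OF \<mu> k_def k] \<open>\<nu> \<le> E\<close> E \<Lambda>(1) unfolding e by simp
    ultimately show "\<Lambda> \<in> (\<lambda>\<nu>. \<nu> * k\<^sup>2) ` S" using e by (auto simp: S_def)
  next
    fix \<Lambda> assume "\<Lambda> \<in> (\<lambda>\<nu>. \<nu> * k\<^sup>2) ` S"
    then obtain \<nu> where \<nu>: "\<nu> \<le> E" "sin (end_angle k \<nu>) = 0" "\<Lambda> = \<nu> * k\<^sup>2" by (auto simp: S_def)
    have "love_eigenvalue mu x \<xi> \<Lambda>"
      using love_eigenvalue_iff[where mu = mu, OF \<mu> k_def k] \<nu> E by simp
    moreover have "\<Lambda> \<le> E * k\<^sup>2" using \<nu> by (simp add: mult_right_mono)
    ultimately show "\<Lambda> \<in> love_eigenvalues_upto mu x \<xi> E" by (simp add: love_eigenvalues_upto_def k_def)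
  qed
  have inj: "inj_on (\<lambda>\<nu>. \<nu> * k\<^sup>2) S" using k by (auto simp: inj_on_def)
  note z = end_angle_zeros_count[OF k E, folded S_def]
  show "finite (love_eigenvalues_upto mu x \<xi> E)" unfolding eq using z(1) by simp
  show "\<bar>real (love_count mu x \<xi> E) * pi + end_angle (norm \<xi>) E\<bar> \<le> 2 * pi"
    using z(2) unfolding love_count_def eq card_image[OF inj] by (simp add: k_def)
qed

section \<open>The Weyl law\<close>

text \<open>The fibre over \<open>Z\<close> is the interval \<open>|\<zeta>| \<le> wave_density E Z\<close>, and it is empty where \<open>m Z > E\<close>, in
  particular below \<open>ZI\<close>.\<close>

lemma phase_volume:
  assumes E: "E < m ZI"
  shows "measure lebesgue {(Z, \<zeta>). Z \<le> 0 \<and> m Z * (1 + \<zeta>\<^sup>2) \<le> E} = 2 * integral {ZI..0} (wave_density E)"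
proof -
  define A where "A = {(Z, \<zeta>). Z \<le> 0 \<and> m Z * (1 + \<zeta>\<^sup>2) \<le> E}"
  define W where "W = wave_density E"
  have "continuous_on ({..0} \<times> UNIV) (\<lambda>p. m (fst p))"
    by (rule continuous_on_compose2[OF m_cont]) (auto intro: continuous_intros)
  then have "continuous_on ({..0} \<times> (UNIV :: real set)) (\<lambda>p. m (fst p) * (1 + (snd p)\<^sup>2))"
    by (intro continuous_intros)
  then have "closed (({..0} \<times> UNIV) \<inter> (\<lambda>p. m (fst p) * (1 + (snd p)\<^sup>2)) -` {..E})"
    by (rule continuous_closed_preimage) (auto intro: closed_Times)
  moreover have "({..0} \<times> UNIV) \<inter> (\<lambda>p. m (fst p) * (1 + (snd p)\<^sup>2)) -` {..E} = A"
    by (auto simp: A_def)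
  ultimately have A: "A \<in> sets borel" by simp
  have slice: "emeasure lborel (Pair Z -` A) = indicator {ZI..0} Z * ennreal (2 * W Z)" for Z
  proof (cases "Z \<in> {ZI..0} \<and> m Z \<le> E")
    case True
    then have mz: "0 < m Z" using m_pos by simp
    have W: "W Z = sqrt (E / m Z - 1)" "0 \<le> E / m Z - 1"
      using True mz by (auto simp: W_def wave_density_def max_def field_simps)
    have "Pair Z -` A = {- W Z..W Z}"
    proof (rule set_eqI)
      fix \<zeta>
      have "\<zeta> \<in> Pair Z -` A \<longleftrightarrow> \<zeta>\<^sup>2 \<le> E / m Z - 1"
        using True mz by (simp add: A_def field_simps)
      also have "\<dots> \<longleftrightarrow> sqrt (\<zeta>\<^sup>2) \<le> W Z" by (simp only: W(1) real_sqrt_le_iff)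
      also have "\<dots> \<longleftrightarrow> \<zeta> \<in> {- W Z..W Z}" by (auto simp: abs_le_iff)
      finally show "\<zeta> \<in> Pair Z -` A \<longleftrightarrow> \<zeta> \<in> {- W Z..W Z}" .
    qed
    moreover have "0 \<le> W Z" by (simp add: W_def wave_density_nonneg)
    ultimately show ?thesis using True by simp
  next
    case False
    have "Pair Z -` A = {}"
    proof -
      have "\<not> m Z * (1 + \<zeta>\<^sup>2) \<le> E" if Z: "Z \<le> 0" for \<zeta>
      proof -
        have mE: "E < m Z" using False Z E m_const[of Z] by (cases "Z \<le> ZI") auto
        have "m Z * 1 \<le> m Z * (1 + \<zeta>\<^sup>2)" using m_pos[OF Z] by (intro mult_left_mono) auto
        then show ?thesis using mE by simp
      qed
      then show ?thesis by (auto simp: A_def)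
    qed
    moreover have "W Z = 0" if "Z \<in> {ZI..0}"
      unfolding W_def by (rule wave_density_zero) (use that False in auto)
    ultimately show ?thesis by (auto simp: indicator_def)
  qed
  have cW: "continuous_on {ZI..0} (\<lambda>Z. 2 * W Z)"
    unfolding W_def by (intro continuous_intros continuous_on_subset[OF wave_density_cont]) auto
  define I where "I = integral {ZI..0} (\<lambda>Z. 2 * W Z)"
  have hI: "((\<lambda>Z. 2 * W Z) has_integral I) {ZI..0}"
    unfolding I_def by (rule integrable_integral[OF integrable_continuous_real[OF cW]])
  have "emeasure lborel A = emeasure (lborel \<Otimes>\<^sub>M lborel) A" by (simp only: lborel_prod)
  also have "\<dots> = (\<integral>\<^sup>+ Z. emeasure lborel (Pair Z -` A) \<partial>lborel)"
    by (rule lborel.emeasure_pair_measure_alt) (use A in \<open>simp only: lborel_prod sets_lborel\<close>)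
  also have "\<dots> = (\<integral>\<^sup>+ Z. indicator {ZI..0} Z * ennreal (2 * W Z) \<partial>lborel)" by (simp only: slice)
  also have "\<dots> = ennreal I"
    using nn_integral_has_integral_lebesgue'[OF _ hI] wave_density_nonneg by (simp add: W_def mult.commute)
  finally have "emeasure lborel A = ennreal I" .
  moreover have "0 \<le> I" by (rule has_integral_nonneg[OF hI]) (simp add: W_def wave_density_nonneg)
  ultimately have "measure lebesgue A = I" using A by (simp add: measure_def)
  then show ?thesis by (simp add: A_def I_def W_def)
qed

lemma weyl_law:
  assumes \<mu>: "mu x = m" and E: "E < m ZI"
  defines "vol \<equiv> measure lebesgue {(Z, \<zeta>). Z \<le> 0 \<and> m Z * (1 + \<zeta>\<^sup>2) \<le> E}"
  shows "((\<lambda>\<xi>. 2 * pi * real (love_count mu x \<xi> E) / norm \<xi> - vol) \<longlongrightarrow> 0) at_infinity"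
proof -
  define I where "I = integral {ZI..0} (wave_density E)"
  have vol: "vol = 2 * I" unfolding vol_def I_def by (rule phase_volume[OF E])
  define N where "N = (\<lambda>\<xi>. real (love_count mu x \<xi> E))"
  have "((\<lambda>\<xi>. 2 * pi * N \<xi> / norm \<xi> - vol) \<longlongrightarrow> 0) at_infinity"
  proof (rule tendstoI)
    fix e :: real assume e: "0 < e"
    obtain C where C: "\<And>k \<theta>. 0 < k \<Longrightarrow> pruefer k E \<theta> \<Longrightarrow> \<bar>\<theta> 0 - \<theta> ZI + k * I\<bar> \<le> C + k * (e / 4)"
      using pruefer_asymptotics[of "e / 4" E] e unfolding I_def by auto
    have "\<forall>\<^sub>F \<xi> :: real^2 in at_infinity. (2 * \<bar>C\<bar> + 5 * pi) / (e / 2) < norm \<xi>"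
      unfolding eventually_at_infinity
      by (intro exI[of _ "(2 * \<bar>C\<bar> + 5 * pi) / (e / 2) + 1"]) auto
    then show "\<forall>\<^sub>F \<xi> in at_infinity. dist (2 * pi * N \<xi> / norm \<xi> - vol) 0 < e"
    proof eventually_elim
      case (elim \<xi>)
      note \<xi> = this
      define k where "k = norm \<xi>"
      have "0 \<le> (2 * \<bar>C\<bar> + 5 * pi) / (e / 2)" using e by (intro divide_nonneg_nonneg add_nonneg_nonneg) auto
      then have k: "0 < k" using \<xi> unfolding k_def by (rule le_less_trans)
      then have \<xi>0: "\<xi> \<noteq> 0" by (auto simp: k_def)
      have ke: "2 * \<bar>C\<bar> + 5 * pi < k * (e / 2)" using \<xi> e by (simp only: pos_divide_less_eq k_def half_gt_zero)
      obtain \<theta> where \<theta>: "pruefer k E \<theta>" "end_angle k E = \<theta> 0" by (rule end_angle_pruefer[OF k less_imp_le[OF E]])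
      have "\<theta> ZI = init_angle E" using \<theta>(1) by (simp add: pruefer_def)
      then have i: "0 < \<theta> ZI" "\<theta> ZI < pi / 2" using init_angle_bounds[OF E] by auto
      have c: "\<bar>N \<xi> * pi + \<theta> 0\<bar> \<le> 2 * pi"
        using love_count_bound(2)[where mu = mu, OF \<mu> \<xi>0 E] by (simp add: N_def k_def[symmetric] \<theta>(2))
      have "\<bar>N \<xi> * pi - k * I\<bar> \<le> 5 / 2 * pi + \<bar>C\<bar> + k * (e / 4)"
        using c i C[OF k \<theta>(1)] unfolding abs_le_iff by linarith
      moreover have "k * (e / 4) = k * e / 4" "k * (e / 2) = k * e / 2" by simp_all
      ultimately have "2 * \<bar>N \<xi> * pi - k * I\<bar> < k * e" using ke by argo
      moreover have "2 * pi * N \<xi> / k - vol = 2 * (N \<xi> * pi - k * I) / k"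
        using k by (simp add: vol diff_divide_distrib right_diff_distrib)
      then have "\<bar>2 * pi * N \<xi> / k - vol\<bar> = 2 * \<bar>N \<xi> * pi - k * I\<bar> / k"
        using k by (simp only: abs_mult abs_divide abs_numeral abs_of_pos)
      ultimately have "\<bar>2 * pi * N \<xi> / k - vol\<bar> < e" using k by (simp add: pos_divide_less_eq mult.commute)
      then show ?case by (simp add: k_def)
    qed
  qed
  then show ?thesis by (simp add: N_def)
qed

end

text \<open>The trace-free strain with a single off-diagonal pair of ones probes the shear modulus alone:
  for it the quadratic form is \<open>4 mu\<close> while \<open>\<Sum> \<epsilon>\<^sub>i\<^sub>j\<^sup>2 = 2\<close>.\<close>

lemma strongly_convex_imp_mu_pos:
  assumes "strongly_convex lam mu" and Z: "Z \<le> 0"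
  shows "0 < mu x Z"
proof -
  obtain \<delta> where \<delta>: "0 < \<delta>" and sc: "\<And>\<epsilon>::real^3^3. transpose \<epsilon> = \<epsilon> \<Longrightarrow>
        (\<Sum>i\<in>UNIV. \<Sum>j\<in>UNIV. \<Sum>k\<in>UNIV. \<Sum>n\<in>UNIV.
           isotropic_tensor (lam x Z) (mu x Z) i j k n * \<epsilon> $ i $ j * \<epsilon> $ k $ n)
        \<ge> \<delta> * (\<Sum>i\<in>UNIV. \<Sum>j\<in>UNIV. (\<epsilon> $ i $ j)\<^sup>2)"
    using assms unfolding strongly_convex_def by blast
  define \<epsilon> :: "real^3^3" where
    "\<epsilon> = (\<chi> i j. if (i = 1 \<and> j = 2) \<or> (i = 2 \<and> j = 1) then 1 else 0)"
  have "transpose \<epsilon> = \<epsilon>" by (auto simp: \<epsilon>_def transpose_def vec_eq_iff)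
  from sc[OF this] have "\<delta> * 2 \<le> 4 * mu x Z"
    by (simp add: sum_3 \<epsilon>_def isotropic_tensor_def kronecker_def)
  then show ?thesis using \<delta> by linarith
qed

theorem theorem6p1:
  fixes lam mu :: "real^2 \<Rightarrow> real \<Rightarrow> real" and Z\<^sub>I E :: real and x :: "real^2"
  assumes "smooth_on (UNIV \<times> {..0}) (\<lambda>(y, Z). lam y Z)"
    and "smooth_on (UNIV \<times> {..0}) (\<lambda>(y, Z). mu y Z)"
    and "strongly_convex lam mu"
    and "Z\<^sub>I < 0"
    and "\<And>y Z. Z \<le> Z\<^sub>I \<Longrightarrow> lam y Z = lam y Z\<^sub>I"
    and "\<And>y Z. Z \<le> Z\<^sub>I \<Longrightarrow> mu y Z = mu y Z\<^sub>I"
    and "\<And>y. (INF Z\<in>{..0}. mu y Z) < mu y Z\<^sub>I"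
    and "E < mu x Z\<^sub>I"
  shows "(\<forall>\<xi>. \<xi> \<noteq> 0 \<longrightarrow> finite (love_eigenvalues_upto mu x \<xi> E)) \<and>
    (\<exists>r :: real^2 \<Rightarrow> real. (r \<longlongrightarrow> 0) at_infinity \<and>
      (\<forall>\<xi>. \<xi> \<noteq> 0 \<longrightarrow>
        real (love_count mu x \<xi> E) =
          norm \<xi> / (2 * pi) *
            (measure lebesgue {(Z, \<zeta>). Z \<le> 0 \<and> mu x Z * (1 + \<zeta>\<^sup>2) \<le> E} + r \<xi>)))"
proof -
  have sm: "smooth_on {..0} (mu x)"
    unfolding smooth_on_def
  proof
    fix k
    have "Ck_on k (UNIV \<times> {..0}) (\<lambda>(y, Z). mu y Z)" using assms(2) unfolding smooth_on_def by blast
    from Ck_on_slice[OF this, of x] show "Ck_on k {..0} (mu x)" by simp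
  qed
  then have "Ck_on (Suc 0) {..0} (mu x)" unfolding smooth_on_def by blast
  then obtain m' where m': "\<And>Z. Z \<le> 0 \<Longrightarrow> (mu x has_real_derivative m' Z) (at Z within {..0})" "continuous_on {..0} m'"
    unfolding Ck_on_Suc_real by auto
  interpret layered_profile "mu x" m' Z\<^sub>I
  proof
    show "Z\<^sub>I < 0" by (rule assms(4))
    show "smooth_on {..0} (mu x)" by (rule sm)
    show "(mu x has_real_derivative m' Z) (at Z within {..0})" if "Z \<le> 0" for Z by (rule m'(1)[OF that])
    show "continuous_on {..0} m'" by (rule m'(2))
    show "0 < mu x Z" if "Z \<le> 0" for Z by (rule strongly_convex_imp_mu_pos[OF assms(3) that])
    show "mu x Z = mu x Z\<^sub>I" if "Z \<le> Z\<^sub>I" for Z by (rule assms(6)[OF that])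
  qed
  define vol where "vol = measure lebesgue {(Z, \<zeta>). Z \<le> 0 \<and> mu x Z * (1 + \<zeta>\<^sup>2) \<le> E}"
  define r where "r = (\<lambda>\<xi>. 2 * pi * real (love_count mu x \<xi> E) / norm \<xi> - vol)"
  have "(r \<longlongrightarrow> 0) at_infinity"
    unfolding r_def vol_def by (rule weyl_law[where mu = mu, OF refl assms(8)])
  moreover have "real (love_count mu x \<xi> E) = norm \<xi> / (2 * pi) * (vol + r \<xi>)" if "\<xi> \<noteq> 0" for \<xi>
    using that by (simp add: r_def)
  moreover have "finite (love_eigenvalues_upto mu x \<xi> E)" if "\<xi> \<noteq> 0" for \<xi>
    by (rule love_count_bound(1)[where mu = mu, OF refl that assms(8)])
  ultimately show ?thesis unfolding vol_def by blast
qed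

end
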